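(* Let $\mathcal{C}$ be a cocomplete category. The enrichment of $\mathcal{C}^{\Delta^{\mathrm{op}}}$ in simplicial sets $(\mathrm{Set}^{\Delta^{\mathrm{op}}},\times)$ given by $$\underline{\mathrm{Hom}}_F(X,Y)_{[n]}=\mathrm{Hom}_{\mathcal{C}^{(\Delta^{\mathrm{op}})^{n+1}}}(\mathrm{dec}_{n+1}^*X,\mathrm{dec}_{n+1}^*Y),$$ with the simplicial structure induced by the functor $F:\Delta^{\mathrm{op}}\to\mathrm{Cat}$ described in the context, is naturally isomorphic to the canonical enrichment of $\mathcal{C}^{\Delta^{\mathrm{op}}}$ in simplicial sets.
   Context: $\mathrm{dec}_{n+1}:(\Delta^{\mathrm{op}})^{n+1}\to\Delta^{\mathrm{op}}$ is $([k_0],\dots,[k_n])\mapsto[k_0]\ast\dots\ast[k_n]$ (concatenation of ordinals, $[k]\ast[l]=[k+l+1]$), and $\mathrm{dec}_{n+1}^*$ is precomposition ($\mathrm{dec}_1=\mathrm{id}$). The functor $F:\Delta^{\mathrm{op}}\to\mathrm{Cat}$ (pseudo-functor) sends $[n]$ to $\mathcal{C}^{(\Delta^{\mathrm{op}})^{n+1}}$ and an order-preserving map $\varphi:[n]\to[m]$ to the functor $F(\varphi):\mathcal{C}^{(\Delta^{\mathrm{op}})^{m+1}}\to\mathcal{C}^{(\Delta^{\mathrm{op}})^{n+1}}$ which, in each variable $j\in[m]$, is: precomposition with $\mathrm{dec}_{r}:(\Delta^{\mathrm{op}})^{r}\to\Delta^{\mathrm{op}}$ if $\varphi^{-1}(j)$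 has $r\ge1$ elements, and the colimit over that variable $\Delta^{\mathrm{op}}$ if $\varphi^{-1}(j)=\emptyset$. (There are canonical isomorphisms making this pseudo-functorial; in particular the colimit of $\mathrm{dec}_2^*X$ over one of its variables is canonically $X$.) For a category $I$ with final object $i$ and a (pseudo-)functor $F:I^{\mathrm{op}}\to\mathrm{Cat}$, with $p_j:j\to i$ the unique morphism, one sets $\underline{\mathrm{Hom}}_F(X,Y)(j)=\mathrm{Hom}_{F(j)}(F(p_j)X,F(p_j)Y)$ for $X,Y\in F(i)$; it is a presheaf in $j$ through $F(\alpha)$ and the isomorphisms $F(\alpha)F(p_k)\cong F(p_j)$ for $\alpha:j\to k$, and composition in the $F(j)$ makes $F(i)$ enriched in $(\mathrm{Set}^{I^{\mathrm{op}}},\times)$. Here $I=\Delta$, $i=[0]$ and $F(p_n)=\mathrm{dec}_{n+1}^*$. The canonical enrichment on $\mathcal{C}^{\Delta^{\mathrm{op}}}$ is $\underline{\mathrm{Hom}}(X,Y)_{[n]}=\int_{[k]\in\Delta}\mathrm{Hom}_{\mathrm{Set}}\big(\mathrm{Hom}_\Delta([k],[n]),\mathrm{Hom}_{\mathcal{C}}(X_{[k]},Y_{[k]})\big)$, i.e. $\mathrm{Hom}(\Delta_n\otimes X,Y)$ with $(K\otimes X)_{[k]}=\coprod_{K_{[k]}}X_{[k]}$ the point-wise tensoring. *)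

theory Defs
  imports "HOL-Library.FuncSet"
begin

section \<open>Categories, functors, natural transformations\<close>

record ('o, 'a) cat =
  Obj :: "'o set"
  Arr :: "'a set"
  Dom :: "'a \<Rightarrow> 'o"
  Cod :: "'a \<Rightarrow> 'o"
  Idt :: "'o \<Rightarrow> 'a"
  Comp :: "'a \<Rightarrow> 'a \<Rightarrow> 'a"  (infixl "\<cdot>\<index>" 70)

definition Hom :: "('o, 'a) cat \<Rightarrow> 'o \<Rightarrow> 'o \<Rightarrow> 'a set" where
  "Hom C x y = {f \<in> Arr C. Dom C f = x \<and> Cod C f = y}"

locale category =
  fixes C :: "('o, 'a) cat" (structure)
  assumes dom_obj: "f \<in> Arr C \<Longrightarrow> Dom C f \<in> Obj C"
    and cod_obj: "f \<in> Arr C \<Longrightarrow> Cod C f \<in> Obj C"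
    and idt_hom: "x \<in> Obj C \<Longrightarrow> Idt C x \<in> Hom C x x"
    and comp_hom: "f \<in> Hom C x y \<Longrightarrow> g \<in> Hom C y z \<Longrightarrow> g \<cdot> f \<in> Hom C x z"
    and comp_idt_left: "f \<in> Hom C x y \<Longrightarrow> Idt C y \<cdot> f = f"
    and comp_idt_right: "f \<in> Hom C x y \<Longrightarrow> f \<cdot> Idt C x = f"
    and comp_assoc:
      "f \<in> Hom C x y \<Longrightarrow> g \<in> Hom C y z \<Longrightarrow> h \<in> Hom C z w \<Longrightarrow> (h \<cdot> g) \<cdot> f = h \<cdot> (g \<cdot> f)"

definition inv_arr :: "('o, 'a) cat \<Rightarrow> 'a \<Rightarrow> 'a" where
  "inv_arr C f = (THE g. g \<in> Hom C (Cod C f) (Dom C f)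
     \<and> g \<cdot>\<^bsub>C\<^esub> f = Idt C (Dom C f) \<and> f \<cdot>\<^bsub>C\<^esub> g = Idt C (Cod C f))"

definition op_cat :: "('o, 'a) cat \<Rightarrow> ('o, 'a) cat" where
  "op_cat C = \<lparr>Obj = Obj C, Arr = Arr C, Dom = Cod C, Cod = Dom C, Idt = Idt C,
     Comp = (\<lambda>g f. f \<cdot>\<^bsub>C\<^esub> g)\<rparr>"

text \<open>The \<open>p\<close>-fold power of a category; objects and arrows are lists of length \<open>p\<close>.\<close>

definition pow_cat :: "('o, 'a) cat \<Rightarrow> nat \<Rightarrow> ('o list, 'a list) cat" where
  "pow_cat C p = \<lparr>Obj = {xs. length xs = p \<and> set xs \<subseteq> Obj C},
     Arr = {fs. length fs = p \<and> set fs \<subseteq> Arr C},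
     Dom = map (Dom C), Cod = map (Cod C), Idt = map (Idt C), Comp = map2 (Comp C)\<rparr>"

text \<open>
  Functors and natural transformations are required to be \<^const>\<open>undefined\<close> outside of
  their domain, so that equality of the records is equality of functors, respectively of
  natural transformations.
\<close>

record ('jo, 'ja, 'o, 'a) fn =
  FOb :: "'jo \<Rightarrow> 'o"
  FAr :: "'ja \<Rightarrow> 'a"

definition is_functor ::
  "('jo, 'ja) cat \<Rightarrow> ('o, 'a) cat \<Rightarrow> ('jo, 'ja, 'o, 'a) fn \<Rightarrow> bool" where
  "is_functor J C F \<longleftrightarrow>
     FOb F \<in> Obj J \<rightarrow>\<^sub>E Obj C \<and> FAr F \<in> Arr J \<rightarrow>\<^sub>E Arr C \<and>
     (\<forall>f\<in>Arr J. FAr F f \<in> Hom C (FOb F (Dom J f)) (FOb F (Cod J f))) \<and>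
     (\<forall>x\<in>Obj J. FAr F (Idt J x) = Idt C (FOb F x)) \<and>
     (\<forall>f\<in>Arr J. \<forall>g\<in>Arr J. Cod J f = Dom J g \<longrightarrow>
        FAr F (g \<cdot>\<^bsub>J\<^esub> f) = FAr F g \<cdot>\<^bsub>C\<^esub> FAr F f)"

definition id_fn :: "('jo, 'ja) cat \<Rightarrow> ('jo, 'ja, 'jo, 'ja) fn" where
  "id_fn J = \<lparr>FOb = (\<lambda>x\<in>Obj J. x), FAr = (\<lambda>f\<in>Arr J. f)\<rparr>"

text \<open>The composite \<open>G \<circ> F\<close> of a functor \<open>F\<close> with domain \<open>J\<close> and a functor \<open>G\<close>.\<close>

definition comp_fn ::
  "('jo, 'ja) cat \<Rightarrow> ('ko, 'ka, 'o, 'a) fn \<Rightarrow> ('jo, 'ja, 'ko, 'ka) fn \<Rightarrow> ('jo, 'ja, 'o, 'a) fn"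
  where
  "comp_fn J G F = \<lparr>FOb = (\<lambda>x\<in>Obj J. FOb G (FOb F x)), FAr = (\<lambda>f\<in>Arr J. FAr G (FAr F f))\<rparr>"

record ('jo, 'ja, 'o, 'a) nt =
  Src :: "('jo, 'ja, 'o, 'a) fn"
  Tgt :: "('jo, 'ja, 'o, 'a) fn"
  App :: "'jo \<Rightarrow> 'a"

definition is_nat_trans ::
  "('jo, 'ja) cat \<Rightarrow> ('o, 'a) cat \<Rightarrow> ('jo, 'ja, 'o, 'a) nt \<Rightarrow> bool" where
  "is_nat_trans J C \<eta> \<longleftrightarrow>
     is_functor J C (Src \<eta>) \<and> is_functor J C (Tgt \<eta>) \<and>
     App \<eta> \<in> (\<Pi>\<^sub>E x\<in>Obj J. Hom C (FOb (Src \<eta>) x) (FOb (Tgt \<eta>) x)) \<and>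
     (\<forall>f\<in>Arr J. App \<eta> (Cod J f) \<cdot>\<^bsub>C\<^esub> FAr (Src \<eta>) f = FAr (Tgt \<eta>) f \<cdot>\<^bsub>C\<^esub> App \<eta> (Dom J f))"

definition fun_cat ::
  "('jo, 'ja) cat \<Rightarrow> ('o, 'a) cat \<Rightarrow> (('jo, 'ja, 'o, 'a) fn, ('jo, 'ja, 'o, 'a) nt) cat" where
  "fun_cat J C = \<lparr>Obj = {F. is_functor J C F}, Arr = {\<eta>. is_nat_trans J C \<eta>},
     Dom = Src, Cod = Tgt,
     Idt = (\<lambda>F. \<lparr>Src = F, Tgt = F, App = (\<lambda>x\<in>Obj J. Idt C (FOb F x))\<rparr>),
     Comp = (\<lambda>\<theta> \<eta>. \<lparr>Src = Src \<eta>, Tgt = Tgt \<theta>, App = (\<lambda>x\<in>Obj J. App \<theta> x \<cdot>\<^bsub>C\<^esub> App \<eta> x)\<rparr>)\<rparr>"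

text \<open>Precomposition with \<open>G : J \<rightarrow> K\<close>, as a functor from \<open>C\<^sup>K\<close> to \<open>C\<^sup>J\<close>.\<close>

definition precomp ::
  "('jo, 'ja) cat \<Rightarrow> ('ko, 'ka) cat \<Rightarrow> ('o, 'a) cat \<Rightarrow> ('jo, 'ja, 'ko, 'ka) fn \<Rightarrow>
   (('ko, 'ka, 'o, 'a) fn, ('ko, 'ka, 'o, 'a) nt, ('jo, 'ja, 'o, 'a) fn, ('jo, 'ja, 'o, 'a) nt) fn"
  where
  "precomp J K C G =
     \<lparr>FOb = (\<lambda>F\<in>Obj (fun_cat K C). comp_fn J F G),
      FAr = (\<lambda>\<eta>\<in>Arr (fun_cat K C).
        \<lparr>Src = comp_fn J (Src \<eta>) G, Tgt = comp_fn J (Tgt \<eta>) G,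
         App = (\<lambda>x\<in>Obj J. App \<eta> (FOb G x))\<rparr>)\<rparr>"


section \<open>Colimits\<close>

definition is_cocone ::
  "('jo, 'ja) cat \<Rightarrow> ('o, 'a) cat \<Rightarrow> ('jo, 'ja, 'o, 'a) fn \<Rightarrow> 'o \<Rightarrow> ('jo \<Rightarrow> 'a) \<Rightarrow> bool" where
  "is_cocone J C D c \<kappa> \<longleftrightarrow> c \<in> Obj C \<and> (\<forall>x\<in>Obj J. \<kappa> x \<in> Hom C (FOb D x) c) \<and>
     (\<forall>f\<in>Arr J. \<kappa> (Cod J f) \<cdot>\<^bsub>C\<^esub> FAr D f = \<kappa> (Dom J f))"

definition is_colimit ::
  "('jo, 'ja) cat \<Rightarrow> ('o, 'a) cat \<Rightarrow> ('jo, 'ja, 'o, 'a) fn \<Rightarrow> 'o \<Rightarrow> ('jo \<Rightarrow> 'a) \<Rightarrow> bool" where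
  "is_colimit J C D c \<kappa> \<longleftrightarrow> is_cocone J C D c \<kappa> \<and>
     (\<forall>d \<mu>. is_cocone J C D d \<mu> \<longrightarrow> (\<exists>!u. u \<in> Hom C c d \<and> (\<forall>x\<in>Obj J. u \<cdot>\<^bsub>C\<^esub> \<kappa> x = \<mu> x)))"

text \<open>
  The universe of small sets is represented by a type \<open>'s\<close>: a small category is one
  whose objects and arrows are elements of \<open>'s\<close>.
\<close>

definition cocomplete :: "'s itself \<Rightarrow> ('o, 'a) cat \<Rightarrow> bool" where
  "cocomplete s C \<longleftrightarrow> (\<forall>(J :: ('s, 's) cat) D. category J \<longrightarrow> is_functor J C D \<longrightarrow>
     (\<exists>c \<kappa>. is_colimit J C D c \<kappa>))"

definition colimit_choice ::
  "('jo, 'ja) cat \<Rightarrow> ('o, 'a) cat \<Rightarrow> (('jo, 'ja, 'o, 'a) fn \<Rightarrow> 'o \<times> ('jo \<Rightarrow> 'a)) \<Rightarrow> bool" where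
  "colimit_choice J C cl \<longleftrightarrow>
     (\<forall>D. is_functor J C D \<longrightarrow> is_colimit J C D (fst (cl D)) (snd (cl D)))"

text \<open>The arrow out of a colimit \<open>(c, \<kappa>)\<close> induced by a cocone \<open>(d, \<mu>)\<close>.\<close>

definition colim_desc ::
  "('jo, 'ja) cat \<Rightarrow> ('o, 'a) cat \<Rightarrow> 'o \<times> ('jo \<Rightarrow> 'a) \<Rightarrow> 'o \<Rightarrow> ('jo \<Rightarrow> 'a) \<Rightarrow> 'a" where
  "colim_desc J C ck d \<mu> =
     (THE u. u \<in> Hom C (fst ck) d \<and> (\<forall>x\<in>Obj J. u \<cdot>\<^bsub>C\<^esub> snd ck x = \<mu> x))"


section \<open>The simplex category and concatenation of ordinals\<close>

text \<open>
  The object \<open>[k]\<close> is the natural number \<open>k\<close>, standing for \<open>{0, \<dots>, k}\<close>. The triple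
  \<open>(k, n, f)\<close> is the order-preserving map \<open>f : [k] \<rightarrow> [n]\<close>.
\<close>

type_synonym darr = "nat \<times> nat \<times> (nat \<Rightarrow> nat)"

definition Delta :: "(nat, darr) cat" where
  "Delta = \<lparr>Obj = UNIV,
     Arr = {(k, n, f). f \<in> {..k} \<rightarrow>\<^sub>E {..n} \<and> mono_on {..k} f},
     Dom = (\<lambda>(k, n, f). k), Cod = (\<lambda>(k, n, f). n),
     Idt = (\<lambda>k. (k, k, \<lambda>i\<in>{..k}. i)),
     Comp = (\<lambda>(_, m, g) (k, _, f). (k, m, compose {..k} g f))\<rparr>"

abbreviation Dop :: "(nat, darr) cat" where
  "Dop \<equiv> op_cat Delta"

abbreviation Dop_pow :: "nat \<Rightarrow> (nat list, darr list) cat" where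
  "Dop_pow p \<equiv> pow_cat Dop p"

fun join_arr :: "darr \<Rightarrow> darr \<Rightarrow> darr" where
  "join_arr (k, k', f) (l, l', g) =
     (k + l + 1, k' + l' + 1, \<lambda>i\<in>{..k + l + 1}. if i \<le> k then f i else k' + 1 + g (i - (k + 1)))"

text \<open>
  The values on the empty list are irrelevant: \<open>dec\<^sub>p\<close> is only used for \<open>p \<ge> 1\<close>.
\<close>

fun dec_ob :: "nat list \<Rightarrow> nat" where
  "dec_ob [] = undefined"
| "dec_ob [k] = k"
| "dec_ob (k # l # ks) = k + dec_ob (l # ks) + 1"

fun dec_arr :: "darr list \<Rightarrow> darr" where
  "dec_arr [] = undefined"
| "dec_arr [f] = f"
| "dec_arr (f # g # fs) = join_arr f (dec_arr (g # fs))"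

definition dec :: "nat \<Rightarrow> (nat list, darr list, nat, darr) fn" where
  "dec p = \<lparr>FOb = (\<lambda>ks\<in>Obj (Dop_pow p). dec_ob ks), FAr = (\<lambda>fs\<in>Arr (Dop_pow p). dec_arr fs)\<rparr>"

type_synonym ('o, 'a) sfn = "(nat, darr, 'o, 'a) fn"
type_synonym ('o, 'a) snt = "(nat, darr, 'o, 'a) nt"
type_synonym ('o, 'a) msfn = "(nat list, darr list, 'o, 'a) fn"
type_synonym ('o, 'a) msnt = "(nat list, darr list, 'o, 'a) nt"
type_synonym ('o, 'a) colims = "('o, 'a) sfn \<Rightarrow> 'o \<times> (nat \<Rightarrow> 'a)"

definition simp_cat :: "('o, 'a) cat \<Rightarrow> (('o, 'a) sfn, ('o, 'a) snt) cat" where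
  "simp_cat C = fun_cat Dop C"

definition msimp_cat :: "('o, 'a) cat \<Rightarrow> nat \<Rightarrow> (('o, 'a) msfn, ('o, 'a) msnt) cat" where
  "msimp_cat C p = fun_cat (Dop_pow p) C"

definition dec_pull ::
  "('o, 'a) cat \<Rightarrow> nat \<Rightarrow> (('o, 'a) sfn, ('o, 'a) snt, ('o, 'a) msfn, ('o, 'a) msnt) fn" where
  "dec_pull C p = precomp (Dop_pow p) Dop C (dec p)"


section \<open>The pseudo-functor F\<close>

subsection \<open>Colimit over one variable\<close>

definition insert_at :: "nat \<Rightarrow> 'x \<Rightarrow> 'x list \<Rightarrow> 'x list" where
  "insert_at j x xs = take j xs @ x # drop j xs"

text \<open>
  \<open>slice j Z ks\<close> is \<open>Z\<close> as a functor of its variable \<open>j\<close> (counted from 0) alone, with \<open>ks\<close>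
  as values of the other ones.
\<close>

definition slice :: "nat \<Rightarrow> ('o, 'a) msfn \<Rightarrow> nat list \<Rightarrow> ('o, 'a) sfn" where
  "slice j Z ks =
     \<lparr>FOb = (\<lambda>l\<in>Obj Dop. FOb Z (insert_at j l ks)),
      FAr = (\<lambda>f\<in>Arr Dop. FAr Z (insert_at j f (map (Idt Dop) ks)))\<rparr>"

definition colim_var_ob ::
  "('o, 'a) cat \<Rightarrow> ('o, 'a) colims \<Rightarrow> nat \<Rightarrow> nat \<Rightarrow> ('o, 'a) msfn \<Rightarrow> ('o, 'a) msfn" where
  "colim_var_ob C cl p j Z =
     \<lparr>FOb = (\<lambda>ks\<in>Obj (Dop_pow (p - 1)). fst (cl (slice j Z ks))),
      FAr = (\<lambda>fs\<in>Arr (Dop_pow (p - 1)).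
        let ks = map (Dom Dop) fs; ls = map (Cod Dop) fs in
        colim_desc Dop C (cl (slice j Z ks)) (fst (cl (slice j Z ls)))
          (\<lambda>l. snd (cl (slice j Z ls)) l \<cdot>\<^bsub>C\<^esub> FAr Z (insert_at j (Idt Dop l) fs)))\<rparr>"

text \<open>
  The colimit over the variable \<open>j\<close> of a functor of \<open>p\<close> variables, computed point-wise
  by means of the choice \<open>cl\<close> of colimits.
\<close>

definition colim_var ::
  "('o, 'a) cat \<Rightarrow> ('o, 'a) colims \<Rightarrow> nat \<Rightarrow> nat \<Rightarrow>
   (('o, 'a) msfn, ('o, 'a) msnt, ('o, 'a) msfn, ('o, 'a) msnt) fn" where
  "colim_var C cl p j =
     \<lparr>FOb = (\<lambda>Z\<in>Obj (msimp_cat C p). colim_var_ob C cl p j Z),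
      FAr = (\<lambda>\<eta>\<in>Arr (msimp_cat C p).
        \<lparr>Src = colim_var_ob C cl p j (Src \<eta>), Tgt = colim_var_ob C cl p j (Tgt \<eta>),
         App = (\<lambda>ks\<in>Obj (Dop_pow (p - 1)).
           colim_desc Dop C (cl (slice j (Src \<eta>) ks)) (fst (cl (slice j (Tgt \<eta>) ks)))
             (\<lambda>l. snd (cl (slice j (Tgt \<eta>) ks)) l \<cdot>\<^bsub>C\<^esub> App \<eta> (insert_at j l ks)))\<rparr>)\<rparr>"

text \<open>
  Colimits over several variables, given by a strictly decreasing list, so that the
  variables still to be treated keep their positions.
\<close>

fun colim_vars ::
  "('o, 'a) cat \<Rightarrow> ('o, 'a) colims \<Rightarrow> nat \<Rightarrow> nat list \<Rightarrow>
   (('o, 'a) msfn, ('o, 'a) msnt, ('o, 'a) msfn, ('o, 'a) msnt) fn" where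
  "colim_vars C cl p [] = id_fn (msimp_cat C p)"
| "colim_vars C cl p (j # js) =
     comp_fn (msimp_cat C p) (colim_vars C cl (p - 1) js) (colim_var C cl p j)"

subsection \<open>The functors attached to order-preserving maps\<close>

text \<open>For \<open>\<alpha> : [n] \<rightarrow> [m]\<close>, the elements of \<open>[m]\<close> with empty, respectively non-empty, fibre.\<close>

fun missed :: "darr \<Rightarrow> nat list" where
  "missed (n, m, a) = filter (\<lambda>j. j \<notin> a ` {..n}) (rev [0..<Suc m])"

fun hit :: "darr \<Rightarrow> nat list" where
  "hit (n, m, a) = filter (\<lambda>j. j \<in> a ` {..n}) [0..<Suc m]"

fun fibre_sub :: "darr \<Rightarrow> nat \<Rightarrow> 'x list \<Rightarrow> 'x list" where
  "fibre_sub (n, m, a) j xs = map (nth xs) (filter (\<lambda>i. a i = j) [0..<Suc n])"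

text \<open>
  The functor from \<open>n + 1\<close> variables to as many variables as \<open>\<alpha>\<close> has non-empty fibres,
  which is \<open>dec\<^sub>r\<close> for a fibre with \<open>r\<close> elements.
\<close>

definition dec_fibres :: "darr \<Rightarrow> (nat list, darr list, nat list, darr list) fn" where
  "dec_fibres \<alpha> =
     \<lparr>FOb = (\<lambda>ks\<in>Obj (Dop_pow (Suc (Dom Delta \<alpha>))). map (\<lambda>j. dec_ob (fibre_sub \<alpha> j ks)) (hit \<alpha>)),
      FAr = (\<lambda>fs\<in>Arr (Dop_pow (Suc (Dom Delta \<alpha>))). map (\<lambda>j. dec_arr (fibre_sub \<alpha> j fs)) (hit \<alpha>))\<rparr>"

definition pull_fibres ::
  "('o, 'a) cat \<Rightarrow> darr \<Rightarrow>
   (('o, 'a) msfn, ('o, 'a) msnt, ('o, 'a) msfn, ('o, 'a) msnt) fn" where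
  "pull_fibres C \<alpha> =
     precomp (Dop_pow (Suc (Dom Delta \<alpha>))) (Dop_pow (length (hit \<alpha>))) C (dec_fibres \<alpha>)"

definition F_ob :: "('o, 'a) cat \<Rightarrow> nat \<Rightarrow> (('o, 'a) msfn, ('o, 'a) msnt) cat" where
  "F_ob C n = msimp_cat C (Suc n)"

definition F_arr ::
  "('o, 'a) cat \<Rightarrow> ('o, 'a) colims \<Rightarrow> darr \<Rightarrow>
   (('o, 'a) msfn, ('o, 'a) msnt, ('o, 'a) msfn, ('o, 'a) msnt) fn" where
  "F_arr C cl \<alpha> =
     comp_fn (F_ob C (Cod Delta \<alpha>)) (pull_fibres C \<alpha>)
       (colim_vars C cl (Suc (Cod Delta \<alpha>)) (missed \<alpha>))"

subsection \<open>The canonical isomorphisms\<close>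

text \<open>
  The inclusion of \<open>[k\<^sub>0] * \<dots> * [k\<^sub>q]\<close> into the same concatenation with an additional \<open>[l]\<close>
  at position \<open>j\<close>; it omits precisely the elements of this \<open>[l]\<close>.
\<close>

definition incl_at :: "nat \<Rightarrow> nat \<Rightarrow> nat list \<Rightarrow> darr" where
  "incl_at j l ks =
     (dec_ob ks, dec_ob (insert_at j l ks),
      \<lambda>i\<in>{..dec_ob ks}. if i < sum_list (map Suc (take j ks)) then i else i + l + 1)"

text \<open>
  For \<open>p \<ge> 2\<close>, the comparison from the colimit over the variable \<open>j\<close> of \<open>dec\<^sub>p\<^sup>*X\<close> to
  \<open>dec\<^sub>p\<^sub>-\<^sub>1\<^sup>*X\<close>; it is induced by the images under \<open>X\<close> of the inclusions.
\<close>

definition can_var ::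
  "('o, 'a) cat \<Rightarrow> ('o, 'a) colims \<Rightarrow> nat \<Rightarrow> nat \<Rightarrow> ('o, 'a) sfn \<Rightarrow> ('o, 'a) msnt" where
  "can_var C cl p j X =
     \<lparr>Src = FOb (colim_var C cl p j) (FOb (dec_pull C p) X),
      Tgt = FOb (dec_pull C (p - 1)) X,
      App = (\<lambda>ks\<in>Obj (Dop_pow (p - 1)).
        colim_desc Dop C (cl (slice j (FOb (dec_pull C p) X) ks)) (FOb X (dec_ob ks))
          (\<lambda>l. FAr X (incl_at j l ks)))\<rparr>"

fun can_vars ::
  "('o, 'a) cat \<Rightarrow> ('o, 'a) colims \<Rightarrow> nat \<Rightarrow> nat list \<Rightarrow> ('o, 'a) sfn \<Rightarrow> ('o, 'a) msnt" where
  "can_vars C cl p [] X = Idt (msimp_cat C p) (FOb (dec_pull C p) X)"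
| "can_vars C cl p (j # js) X =
     can_vars C cl (p - 1) js X
       \<cdot>\<^bsub>msimp_cat C (p - 1 - length js)\<^esub> FAr (colim_vars C cl (p - 1) js) (can_var C cl p j X)"

text \<open>
  The isomorphism \<open>F(\<alpha>) F(p\<^sub>m) X \<cong> F(p\<^sub>n) X\<close> for \<open>\<alpha> : [n] \<rightarrow> [m]\<close>. For surjective \<open>\<alpha>\<close> it is the
  identity, both sides being equal by associativity of concatenation.
\<close>

definition F_can ::
  "('o, 'a) cat \<Rightarrow> ('o, 'a) colims \<Rightarrow> darr \<Rightarrow> ('o, 'a) sfn \<Rightarrow> ('o, 'a) msnt" where
  "F_can C cl \<alpha> X =
     FAr (pull_fibres C \<alpha>) (can_vars C cl (Suc (Cod Delta \<alpha>)) (missed \<alpha>) X)"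


section \<open>Enrichments in simplicial sets\<close>

text \<open>
  An enrichment of \<open>D\<close> in simplicial sets with the cartesian product: simplicial sets
  \<open>EHom X Y\<close> with action \<open>EAct X Y\<close> of the arrows of \<open>Delta\<close>, composition and units, together
  with an identification \<open>EUnd\<close> of \<open>D\<close> with the underlying category, whose arrows are the
  0-simplices. As the monoidal unit is the terminal simplicial set, the unit of \<open>X\<close> is a
  compatible family \<open>EIdt X n\<close> of \<open>n\<close>-simplices.
\<close>

record ('x, 'u, 'e) enr =
  EHom :: "'x \<Rightarrow> 'x \<Rightarrow> nat \<Rightarrow> 'e set"
  EAct :: "'x \<Rightarrow> 'x \<Rightarrow> darr \<Rightarrow> 'e \<Rightarrow> 'e"
  EComp :: "'x \<Rightarrow> 'x \<Rightarrow> 'x \<Rightarrow> nat \<Rightarrow> 'e \<Rightarrow> 'e \<Rightarrow> 'e"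
  EIdt :: "'x \<Rightarrow> nat \<Rightarrow> 'e"
  EUnd :: "'x \<Rightarrow> 'x \<Rightarrow> 'u \<Rightarrow> 'e"

locale simplicial_enrichment =
  fixes D :: "('x, 'u) cat" and E :: "('x, 'u, 'e) enr"
  assumes base: "category D"
    and act_closed: "\<lbrakk>X \<in> Obj D; Y \<in> Obj D; \<alpha> \<in> Hom Delta n m; f \<in> EHom E X Y m\<rbrakk>
      \<Longrightarrow> EAct E X Y \<alpha> f \<in> EHom E X Y n"
    and act_idt: "\<lbrakk>X \<in> Obj D; Y \<in> Obj D; f \<in> EHom E X Y n\<rbrakk> \<Longrightarrow> EAct E X Y (Idt Delta n) f = f"
    and act_comp: "\<lbrakk>X \<in> Obj D; Y \<in> Obj D; \<alpha> \<in> Hom Delta n m; \<beta> \<in> Hom Delta m q; f \<in> EHom E X Y q\<rbrakk>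
      \<Longrightarrow> EAct E X Y (\<beta> \<cdot>\<^bsub>Delta\<^esub> \<alpha>) f = EAct E X Y \<alpha> (EAct E X Y \<beta> f)"
    and ecomp_closed: "\<lbrakk>X \<in> Obj D; Y \<in> Obj D; Z \<in> Obj D; f \<in> EHom E X Y n; g \<in> EHom E Y Z n\<rbrakk>
      \<Longrightarrow> EComp E X Y Z n g f \<in> EHom E X Z n"
    and ecomp_act: "\<lbrakk>X \<in> Obj D; Y \<in> Obj D; Z \<in> Obj D; \<alpha> \<in> Hom Delta n m;
        f \<in> EHom E X Y m; g \<in> EHom E Y Z m\<rbrakk>
      \<Longrightarrow> EAct E X Z \<alpha> (EComp E X Y Z m g f) = EComp E X Y Z n (EAct E Y Z \<alpha> g) (EAct E X Y \<alpha> f)"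
    and ecomp_assoc: "\<lbrakk>X \<in> Obj D; Y \<in> Obj D; Z \<in> Obj D; W \<in> Obj D;
        f \<in> EHom E X Y n; g \<in> EHom E Y Z n; h \<in> EHom E Z W n\<rbrakk>
      \<Longrightarrow> EComp E X Y W n (EComp E Y Z W n h g) f = EComp E X Z W n h (EComp E X Y Z n g f)"
    and eidt_closed: "X \<in> Obj D \<Longrightarrow> EIdt E X n \<in> EHom E X X n"
    and eidt_act: "\<lbrakk>X \<in> Obj D; \<alpha> \<in> Hom Delta n m\<rbrakk> \<Longrightarrow> EAct E X X \<alpha> (EIdt E X m) = EIdt E X n"
    and ecomp_idt_left: "\<lbrakk>X \<in> Obj D; Y \<in> Obj D; f \<in> EHom E X Y n\<rbrakk>
      \<Longrightarrow> EComp E X Y Y n (EIdt E Y n) f = f"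
    and ecomp_idt_right: "\<lbrakk>X \<in> Obj D; Y \<in> Obj D; f \<in> EHom E X Y n\<rbrakk>
      \<Longrightarrow> EComp E X X Y n f (EIdt E X n) = f"
    and und_bij: "\<lbrakk>X \<in> Obj D; Y \<in> Obj D\<rbrakk> \<Longrightarrow> bij_betw (EUnd E X Y) (Hom D X Y) (EHom E X Y 0)"
    and und_idt: "X \<in> Obj D \<Longrightarrow> EUnd E X X (Idt D X) = EIdt E X 0"
    and und_comp: "\<lbrakk>X \<in> Obj D; Y \<in> Obj D; Z \<in> Obj D; u \<in> Hom D X Y; v \<in> Hom D Y Z\<rbrakk>
      \<Longrightarrow> EUnd E X Z (v \<cdot>\<^bsub>D\<^esub> u) = EComp E X Y Z 0 (EUnd E Y Z v) (EUnd E X Y u)"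

text \<open>
  Isomorphisms of enrichments of the same category \<open>D\<close> are the identity on objects and on the
  underlying category \<open>D\<close>. Compatibility with composition and with the underlying
  category includes naturality in \<open>X\<close> and \<open>Y\<close>.
\<close>

locale enrichment_iso =
  fixes D :: "('x, 'u) cat" and E :: "('x, 'u, 'e) enr" and E' :: "('x, 'u, 'e1) enr"
    and \<Theta> :: "'x \<Rightarrow> 'x \<Rightarrow> nat \<Rightarrow> 'e \<Rightarrow> 'e1"
  assumes iso_bij: "\<lbrakk>X \<in> Obj D; Y \<in> Obj D\<rbrakk> \<Longrightarrow> bij_betw (\<Theta> X Y n) (EHom E X Y n) (EHom E' X Y n)"
    and iso_act: "\<lbrakk>X \<in> Obj D; Y \<in> Obj D; \<alpha> \<in> Hom Delta n m; f \<in> EHom E X Y m\<rbrakk>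
      \<Longrightarrow> \<Theta> X Y n (EAct E X Y \<alpha> f) = EAct E' X Y \<alpha> (\<Theta> X Y m f)"
    and iso_comp: "\<lbrakk>X \<in> Obj D; Y \<in> Obj D; Z \<in> Obj D; f \<in> EHom E X Y n; g \<in> EHom E Y Z n\<rbrakk>
      \<Longrightarrow> \<Theta> X Z n (EComp E X Y Z n g f) = EComp E' X Y Z n (\<Theta> Y Z n g) (\<Theta> X Y n f)"
    and iso_idt: "X \<in> Obj D \<Longrightarrow> \<Theta> X X n (EIdt E X n) = EIdt E' X n"
    and iso_und: "\<lbrakk>X \<in> Obj D; Y \<in> Obj D; u \<in> Hom D X Y\<rbrakk>
      \<Longrightarrow> \<Theta> X Y 0 (EUnd E X Y u) = EUnd E' X Y u"

definition enrichments_isomorphic ::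
  "('x, 'u) cat \<Rightarrow> ('x, 'u, 'e) enr \<Rightarrow> ('x, 'u, 'e1) enr \<Rightarrow> bool" where
  "enrichments_isomorphic D E E' \<longleftrightarrow> (\<exists>\<Theta>. enrichment_iso D E E' \<Theta>)"

text \<open>
  The enrichment \<open>Hom\<^sub>F\<close>. The category of simplicial objects is identified with \<open>F([0])\<close> by
  \<open>dec\<^sub>1\<^sup>*\<close>, which only replaces \<open>[k]\<close> by one-element lists.
\<close>

definition dec_enrichment ::
  "('o, 'a) cat \<Rightarrow> ('o, 'a) colims \<Rightarrow> (('o, 'a) sfn, ('o, 'a) snt, ('o, 'a) msnt) enr" where
  "dec_enrichment C cl =
     \<lparr>EHom = (\<lambda>X Y n. Hom (F_ob C n) (FOb (dec_pull C (Suc n)) X) (FOb (dec_pull C (Suc n)) Y)),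
      EAct = (\<lambda>X Y \<alpha> f. let K = F_ob C (Dom Delta \<alpha>) in
        F_can C cl \<alpha> Y \<cdot>\<^bsub>K\<^esub> FAr (F_arr C cl \<alpha>) f \<cdot>\<^bsub>K\<^esub> inv_arr K (F_can C cl \<alpha> X)),
      EComp = (\<lambda>X Y Z n g f. g \<cdot>\<^bsub>F_ob C n\<^esub> f),
      EIdt = (\<lambda>X n. Idt (F_ob C n) (FOb (dec_pull C (Suc n)) X)),
      EUnd = (\<lambda>X Y u. FAr (dec_pull C 1) u)\<rparr>"

text \<open>
  The end of a functor \<open>T : J\<^sup>o\<^sup>p \<times> J \<rightarrow> Set\<close>, given by its values \<open>T\<^sub>o k l\<close> and its action
  \<open>T\<^sub>a f g : T\<^sub>o k' l \<rightarrow> T\<^sub>o k l'\<close> for \<open>f : k \<rightarrow> k'\<close> and \<open>g : l \<rightarrow> l'\<close>.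
\<close>

definition set_end ::
  "('jo, 'ja) cat \<Rightarrow> ('jo \<Rightarrow> 'jo \<Rightarrow> 'e set) \<Rightarrow> ('ja \<Rightarrow> 'ja \<Rightarrow> 'e \<Rightarrow> 'e) \<Rightarrow> ('jo \<Rightarrow> 'e) set" where
  "set_end J To Ta = {e \<in> (\<Pi>\<^sub>E k\<in>Obj J. To k k). \<forall>f\<in>Arr J.
     Ta (Idt J (Dom J f)) f (e (Dom J f)) = Ta f (Idt J (Cod J f)) (e (Cod J f))}"

text \<open>
  In the integrand of the canonical enrichment \<open>Hom\<^sub>\<Delta>([l],[n])\<close> and \<open>X\<^sub>l\<close> sit in the covariant
  variable \<open>l\<close>, and \<open>Y\<^sub>k\<close> in the contravariant variable \<open>k\<close>. An arrow \<open>f\<close> of \<open>Delta\<close> acts by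
  \<open>FAr X f\<close> in the opposite direction.
\<close>

definition canonical_enrichment ::
  "('o, 'a) cat \<Rightarrow> (('o, 'a) sfn, ('o, 'a) snt, nat \<Rightarrow> darr \<Rightarrow> 'a) enr" where
  "canonical_enrichment C =
     \<lparr>EHom = (\<lambda>X Y n. set_end Delta
        (\<lambda>k l. Hom Delta l n \<rightarrow>\<^sub>E Hom C (FOb X l) (FOb Y k))
        (\<lambda>f g h. \<lambda>\<sigma>\<in>Hom Delta (Cod Delta g) n.
           FAr Y f \<cdot>\<^bsub>C\<^esub> h (\<sigma> \<cdot>\<^bsub>Delta\<^esub> g) \<cdot>\<^bsub>C\<^esub> FAr X g)),
      EAct = (\<lambda>X Y \<alpha> e k. \<lambda>\<sigma>\<in>Hom Delta k (Dom Delta \<alpha>). e k (\<alpha> \<cdot>\<^bsub>Delta\<^esub> \<sigma>)),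
      EComp = (\<lambda>X Y Z n e' e k. \<lambda>\<sigma>\<in>Hom Delta k n. e' k \<sigma> \<cdot>\<^bsub>C\<^esub> e k \<sigma>),
      EIdt = (\<lambda>X n k. \<lambda>\<sigma>\<in>Hom Delta k n. Idt C (FOb X k)),
      EUnd = (\<lambda>X Y u k. \<lambda>\<sigma>\<in>Hom Delta k 0. App u k)\<rparr>"

end

theory Submission
  imports Defs
begin

text \<open>
  An element of the canonical \<open>Hom(X, Y)\<^sub>n\<close> is a family \<open>e\<^sub>\<sigma> : X\<^sub>k \<rightarrow> Y\<^sub>k\<close>, natural in \<open>\<sigma> : [k] \<rightarrow> [n]\<close>. A
  surjective \<open>\<sigma>\<close> is the same as a decomposition \<open>[k] = [k\<^sub>0] * \<dots> * [k\<^sub>n]\<close>, so that restricting \<open>e\<close> to the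
  surjective \<open>\<sigma>\<close> gives a transformation from \<open>dec\<^sub>n\<^sub>+\<^sub>1\<^sup>*X\<close> to \<open>dec\<^sub>n\<^sub>+\<^sub>1\<^sup>*Y\<close>. Restriction is a bijection:
  if \<open>\<sigma>'\<close> arises from \<open>\<sigma>\<close> by adding one element to a fibre, with inclusion \<open>\<iota>\<close> and retraction \<open>\<rho>\<close>, then
  \<open>e\<^sub>\<sigma> = Y(\<iota>) e\<^sub>\<sigma>\<^sub>' X(\<rho>)\<close>, and this formula extends a natural family from the \<open>\<sigma>\<close> hitting all \<open>i \<ge> j\<close> to those
  hitting all \<open>i > j\<close>.

  The comparison from the colimit of \<open>dec\<^sub>p\<^sup>*X\<close> over one variable to \<open>dec\<^sub>p\<^sub>-\<^sub>1\<^sup>*X\<close> is induced by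
  inclusions of ordinals, so by naturality of \<open>e\<close> it carries the colimit of the restriction of \<open>e\<close> to the
  restriction of \<open>e\<close> along the injection omitting that variable. Hence restriction is compatible with
  the actions of \<open>\<Delta>\<close>. The colimits that occur are absolute; all other axioms of the enrichment
  \<open>Hom\<^sub>F\<close> are transported from the canonical one.
\<close>

section \<open>Functor categories, invertible transformations and comparison of colimits\<close>

section \<open>Categories\<close>

text \<open>The action on Hom_F conjugates by isomorphisms that are defined only through chosen
  colimits; a direct proof that it is functorial would need their coherence. Since
  \<open>enrichment_iso\<close> does not presuppose that its second structure is an enrichment, it
  is enough to compare raw operations along bijections that start at the canonical side, and the
  axioms then follow.

  Comparing the actions requires a restriction of e at every stage of the evaluation of F(\<alpha>),
  not only at its two ends. Once variables have been eliminated, the remaining blocks are no longer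
  labelled by all of 0, ..., n. Restriction is therefore defined for every nondecreasing list of
  labels, one per block: a colimit deletes the label of its variable, and pulling back along the
  fibres repeats each label over its fibre.

  In the extension from surjections the obstacle is naturality: the retraction \<rho> is in general
  not a map over [n], so naturality of the given family does not apply to it. Two added points in
  the same fibre remove it: either of them may be kept without changing the map to [n], and both
  choices agree on the old elements.\<close>

lemma in_Hom: "f \<in> Hom C x y \<longleftrightarrow> f \<in> Arr C \<and> Dom C f = x \<and> Cod C f = y"
  by (auto simp: Hom_def)

lemma Arr_in_Hom: "f \<in> Arr C \<Longrightarrow> f \<in> Hom C (Dom C f) (Cod C f)"
  by (simp add: in_Hom)

context category
begin

lemma Hom_obj:
  assumes "f \<in> Hom C x y"
  shows "x \<in> Obj C" "y \<in> Obj C"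
  using assms dom_obj cod_obj by (auto simp: in_Hom)

lemma inv_arr_eqI:
  assumes f: "f \<in> Hom C x y" and g: "g \<in> Hom C y x"
    and gf: "g \<cdot> f = Idt C x" and fg: "f \<cdot> g = Idt C y"
  shows "inv_arr C f = g"
proof -
  have dc: "Dom C f = x" "Cod C f = y" using f by (auto simp: in_Hom)
  show ?thesis unfolding inv_arr_def dc
  proof (rule the_equality)
    show "g \<in> Hom C y x \<and> g \<cdot> f = Idt C x \<and> f \<cdot> g = Idt C y" using assms by simp
  next
    fix h assume h: "h \<in> Hom C y x \<and> h \<cdot> f = Idt C x \<and> f \<cdot> h = Idt C y"
    have "h = h \<cdot> (f \<cdot> g)" using h fg comp_idt_right[of h y x] by simp
    also have "\<dots> = (h \<cdot> f) \<cdot> g" using comp_assoc[OF g f, of h x] h by simp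
    also have "\<dots> = g" using h comp_idt_left[OF g] by simp
    finally show "h = g" .
  qed
qed

end

definition iso_arr :: "('o, 'a) cat \<Rightarrow> 'o \<Rightarrow> 'o \<Rightarrow> 'a \<Rightarrow> bool" where
  "iso_arr C x y f \<longleftrightarrow> f \<in> Hom C x y \<and>
     (\<exists>g\<in>Hom C y x. g \<cdot>\<^bsub>C\<^esub> f = Idt C x \<and> f \<cdot>\<^bsub>C\<^esub> g = Idt C y)"

context category
begin

lemma iso_arr_Hom: "iso_arr C x y f \<Longrightarrow> f \<in> Hom C x y"
  by (simp add: iso_arr_def)

lemma iso_arr_inv:
  assumes "iso_arr C x y f"
  shows "inv_arr C f \<in> Hom C y x" "inv_arr C f \<cdot> f = Idt C x" "f \<cdot> inv_arr C f = Idt C y"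
  using assms inv_arr_eqI unfolding iso_arr_def by metis+

lemma iso_arr_idt: "x \<in> Obj C \<Longrightarrow> iso_arr C x x (Idt C x)"
  unfolding iso_arr_def using idt_hom comp_idt_left by blast

lemma comp_assoc4:
  assumes "f \<in> Hom C x y" "g \<in> Hom C y z" "h \<in> Hom C z w" "k \<in> Hom C w v"
  shows "(k \<cdot> h) \<cdot> (g \<cdot> f) = k \<cdot> ((h \<cdot> g) \<cdot> f)"
  using comp_assoc[OF comp_hom[OF assms(1,2)] assms(3,4)] comp_assoc[OF assms(1-3)] by simp

lemma iso_arr_comp:
  assumes f: "iso_arr C x y f" and g: "iso_arr C y z g"
  shows "iso_arr C x z (g \<cdot> f)"
proof -
  obtain f' where f': "f' \<in> Hom C y x" "f' \<cdot> f = Idt C x" "f \<cdot> f' = Idt C y"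
    using f unfolding iso_arr_def by blast
  obtain g' where g': "g' \<in> Hom C z y" "g' \<cdot> g = Idt C y" "g \<cdot> g' = Idt C z"
    using g unfolding iso_arr_def by blast
  have fg: "f \<in> Hom C x y" "g \<in> Hom C y z" using f g by (auto simp: iso_arr_def)
  have "(f' \<cdot> g') \<cdot> (g \<cdot> f) = Idt C x"
    using comp_assoc4[OF fg g'(1) f'(1)] g' f' fg comp_idt_left by simp
  moreover have "(g \<cdot> f) \<cdot> (f' \<cdot> g') = Idt C z"
    using comp_assoc4[OF g'(1) f'(1) fg] g' f' fg comp_idt_left by simp
  ultimately show ?thesis
    unfolding iso_arr_def using comp_hom fg f'(1) g'(1) by blast
qed

text \<open>A commuting square determines the conjugate: cancel a on the right. \<open>EAct\<close>
  of \<open>dec_enrichment\<close> has this shape, so the inverse of \<open>F_can\<close> never has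
  to be computed.\<close>

lemma iso_arr_conj:
  assumes a: "iso_arr C x x' a" and b: "b \<in> Hom C y y'" and f: "f \<in> Hom C x y"
    and g: "g \<in> Hom C x' y'" and eq: "b \<cdot> f = g \<cdot> a"
  shows "b \<cdot> f \<cdot> inv_arr C a = g"
proof -
  have "b \<cdot> f \<cdot> inv_arr C a = g \<cdot> (a \<cdot> inv_arr C a)"
    using eq comp_assoc[OF iso_arr_inv(1)[OF a] iso_arr_Hom[OF a] g] by simp
  then show ?thesis using iso_arr_inv(3)[OF a] comp_idt_right[OF g] by simp
qed

end

subsection \<open>Opposite and power categories\<close>

lemma op_cat_simps [simp]:
  "Obj (op_cat C) = Obj C" "Arr (op_cat C) = Arr C" "Dom (op_cat C) = Cod C"
  "Cod (op_cat C) = Dom C" "Idt (op_cat C) = Idt C" "g \<cdot>\<^bsub>op_cat C\<^esub> f = f \<cdot>\<^bsub>C\<^esub> g"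
  by (simp_all add: op_cat_def)

lemma Hom_op [simp]: "Hom (op_cat C) x y = Hom C y x"
  by (auto simp: Hom_def)

lemma category_op: "category C \<Longrightarrow> category (op_cat C)"
  unfolding category_def by (simp, metis)

lemma pow_cat_simps [simp]:
  "Obj (pow_cat C p) = {xs. length xs = p \<and> set xs \<subseteq> Obj C}"
  "Arr (pow_cat C p) = {fs. length fs = p \<and> set fs \<subseteq> Arr C}"
  "Dom (pow_cat C p) = map (Dom C)" "Cod (pow_cat C p) = map (Cod C)"
  "Idt (pow_cat C p) = map (Idt C)" "gs \<cdot>\<^bsub>pow_cat C p\<^esub> fs = map2 (Comp C) gs fs"
  by (simp_all add: pow_cat_def)

lemma Hom_pow: "fs \<in> Hom (pow_cat C p) xs ys \<longleftrightarrow>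
    length fs = p \<and> length xs = p \<and> length ys = p \<and> (\<forall>i<p. fs ! i \<in> Hom C (xs ! i) (ys ! i))"
  by (auto simp: in_Hom set_conv_nth list_eq_iff_nth_eq)

lemma category_pow:
  assumes "category C"
  shows "category (pow_cat C p)"
proof -
  interpret category C by fact
  show ?thesis
  proof
    fix fs gs hs xs ys zs ws
    show "fs \<in> Arr (pow_cat C p) \<Longrightarrow> Dom (pow_cat C p) fs \<in> Obj (pow_cat C p)"
      "fs \<in> Arr (pow_cat C p) \<Longrightarrow> Cod (pow_cat C p) fs \<in> Obj (pow_cat C p)"
      using dom_obj cod_obj by auto
    show "xs \<in> Obj (pow_cat C p) \<Longrightarrow> Idt (pow_cat C p) xs \<in> Hom (pow_cat C p) xs xs"
      unfolding Hom_pow using idt_hom by (auto simp: set_conv_nth)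
    assume f: "fs \<in> Hom (pow_cat C p) xs ys"
    show "Idt (pow_cat C p) ys \<cdot>\<^bsub>pow_cat C p\<^esub> fs = fs" "fs \<cdot>\<^bsub>pow_cat C p\<^esub> Idt (pow_cat C p) xs = fs"
      using f comp_idt_left comp_idt_right by (auto simp: Hom_pow intro!: nth_equalityI)
    assume g: "gs \<in> Hom (pow_cat C p) ys zs"
    show "gs \<cdot>\<^bsub>pow_cat C p\<^esub> fs \<in> Hom (pow_cat C p) xs zs"
      using f g comp_hom unfolding Hom_pow by auto
    assume h: "hs \<in> Hom (pow_cat C p) zs ws"
    show "(hs \<cdot>\<^bsub>pow_cat C p\<^esub> gs) \<cdot>\<^bsub>pow_cat C p\<^esub> fs = hs \<cdot>\<^bsub>pow_cat C p\<^esub> (gs \<cdot>\<^bsub>pow_cat C p\<^esub> fs)"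
      using f g h unfolding Hom_pow by (auto intro!: nth_equalityI comp_assoc)
  qed
qed

subsection \<open>Functors and natural transformations\<close>

lemma is_functor_Ob: "is_functor J C F \<Longrightarrow> x \<in> Obj J \<Longrightarrow> FOb F x \<in> Obj C"
  by (auto simp: is_functor_def)

lemma is_functor_Hom: "is_functor J C F \<Longrightarrow> f \<in> Hom J x y \<Longrightarrow> FAr F f \<in> Hom C (FOb F x) (FOb F y)"
  by (auto simp: is_functor_def in_Hom)

lemma is_functor_Idt: "is_functor J C F \<Longrightarrow> x \<in> Obj J \<Longrightarrow> FAr F (Idt J x) = Idt C (FOb F x)"
  by (auto simp: is_functor_def)

lemma is_functor_Comp: "is_functor J C F \<Longrightarrow> f \<in> Hom J x y \<Longrightarrow> g \<in> Hom J y z \<Longrightarrow>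
    FAr F (g \<cdot>\<^bsub>J\<^esub> f) = FAr F g \<cdot>\<^bsub>C\<^esub> FAr F f"
  by (auto simp: is_functor_def in_Hom)

lemma is_functorI:
  assumes "FOb F \<in> extensional (Obj J)" "FAr F \<in> extensional (Arr J)"
    and "\<And>x. x \<in> Obj J \<Longrightarrow> FOb F x \<in> Obj C"
    and "\<And>f x y. f \<in> Hom J x y \<Longrightarrow> FAr F f \<in> Hom C (FOb F x) (FOb F y)"
    and "\<And>x. x \<in> Obj J \<Longrightarrow> FAr F (Idt J x) = Idt C (FOb F x)"
    and "\<And>f g x y z. f \<in> Hom J x y \<Longrightarrow> g \<in> Hom J y z \<Longrightarrow> FAr F (g \<cdot>\<^bsub>J\<^esub> f) = FAr F g \<cdot>\<^bsub>C\<^esub> FAr F f"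
  shows "is_functor J C F"
  using assms unfolding is_functor_def PiE_def by (auto simp: in_Hom)

lemma functor_eqI:
  assumes "is_functor J C F" "is_functor J C G"
    and "\<And>x. x \<in> Obj J \<Longrightarrow> FOb F x = FOb G x" "\<And>f. f \<in> Arr J \<Longrightarrow> FAr F f = FAr G f"
  shows "F = G"
proof -
  have "FOb F = FOb G" "FAr F = FAr G"
    using assms unfolding is_functor_def by (auto intro: PiE_ext)
  then show ?thesis by simp
qed

lemma is_functor_id: "category J \<Longrightarrow> is_functor J J (id_fn J)"
  by (rule is_functorI) (auto simp: id_fn_def in_Hom category.dom_obj category.cod_obj
      dest: category.idt_hom category.comp_hom[unfolded in_Hom])

lemma is_functor_comp:
  assumes J: "category J" and F: "is_functor J K F" and G: "is_functor K C G"
  shows "is_functor J C (comp_fn J G F)"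
proof -
  interpret J: category J by fact
  show ?thesis
  proof (rule is_functorI, goal_cases)
    case (3 x)
    then show ?case using F G by (simp add: comp_fn_def is_functor_Ob)
  next
    case (4 f x y)
    then show ?case
      using is_functor_Hom[OF G is_functor_Hom[OF F 4]] J.Hom_obj[OF 4] by (simp add: comp_fn_def in_Hom)
  next
    case (5 x)
    then show ?case using J.idt_hom[OF 5] F G
      by (simp add: comp_fn_def in_Hom is_functor_Idt is_functor_Ob)
  next
    case (6 f g x y z)
    then show ?case
      using J.comp_hom[OF 6] is_functor_Comp[OF F 6]
        is_functor_Comp[OF G is_functor_Hom[OF F 6(1)] is_functor_Hom[OF F 6(2)]]
      by (simp add: comp_fn_def in_Hom)
  qed (auto simp: comp_fn_def)
qed

lemma iso_arr_functor:
  assumes F: "is_functor J C F" and f: "iso_arr J x y f" and "category J"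
  shows "iso_arr C (FOb F x) (FOb F y) (FAr F f)"
proof -
  interpret category J by fact
  obtain g where g: "f \<in> Hom J x y" "g \<in> Hom J y x" "g \<cdot>\<^bsub>J\<^esub> f = Idt J x" "f \<cdot>\<^bsub>J\<^esub> g = Idt J y"
    using f by (auto simp: iso_arr_def)
  then show ?thesis
    unfolding iso_arr_def using is_functor_Hom[OF F] is_functor_Comp[OF F] is_functor_Idt[OF F] Hom_obj
    by metis
qed

lemma fun_cat_simps [simp]:
  "Obj (fun_cat J C) = {F. is_functor J C F}" "Arr (fun_cat J C) = {\<eta>. is_nat_trans J C \<eta>}"
  "Dom (fun_cat J C) = Src" "Cod (fun_cat J C) = Tgt"
  "Idt (fun_cat J C) F = \<lparr>Src = F, Tgt = F, App = (\<lambda>x\<in>Obj J. Idt C (FOb F x))\<rparr>"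
  "\<theta> \<cdot>\<^bsub>fun_cat J C\<^esub> \<eta> = \<lparr>Src = Src \<eta>, Tgt = Tgt \<theta>, App = (\<lambda>x\<in>Obj J. App \<theta> x \<cdot>\<^bsub>C\<^esub> App \<eta> x)\<rparr>"
  by (simp_all add: fun_cat_def)

lemma Hom_fun: "\<eta> \<in> Hom (fun_cat J C) F G \<longleftrightarrow> is_nat_trans J C \<eta> \<and> Src \<eta> = F \<and> Tgt \<eta> = G"
  by (auto simp: in_Hom)

lemma Hom_fun_App: "\<eta> \<in> Hom (fun_cat J C) F G \<Longrightarrow> x \<in> Obj J \<Longrightarrow> App \<eta> x \<in> Hom C (FOb F x) (FOb G x)"
  unfolding Hom_fun is_nat_trans_def by (auto dest: PiE_mem)

lemma Hom_fun_nat: "\<eta> \<in> Hom (fun_cat J C) F G \<Longrightarrow> f \<in> Hom J x y \<Longrightarrow>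
   App \<eta> y \<cdot>\<^bsub>C\<^esub> FAr F f = FAr G f \<cdot>\<^bsub>C\<^esub> App \<eta> x"
  unfolding Hom_fun is_nat_trans_def by (auto simp: in_Hom)

lemma Hom_fun_functor:
  assumes "\<eta> \<in> Hom (fun_cat J C) F G"
  shows "is_functor J C F" "is_functor J C G"
  using assms unfolding Hom_fun is_nat_trans_def by auto

lemma Hom_funI:
  assumes "is_functor J C F" "is_functor J C G" "Src \<eta> = F" "Tgt \<eta> = G" "App \<eta> \<in> extensional (Obj J)"
    and "\<And>x. x \<in> Obj J \<Longrightarrow> App \<eta> x \<in> Hom C (FOb F x) (FOb G x)"
    and "\<And>f x y. f \<in> Hom J x y \<Longrightarrow> App \<eta> y \<cdot>\<^bsub>C\<^esub> FAr F f = FAr G f \<cdot>\<^bsub>C\<^esub> App \<eta> x"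
  shows "\<eta> \<in> Hom (fun_cat J C) F G"
  using assms unfolding Hom_fun is_nat_trans_def by (auto simp: in_Hom PiE_def)

lemma Hom_fun_eqI:
  assumes "\<eta> \<in> Hom (fun_cat J C) F G" "\<theta> \<in> Hom (fun_cat J C) F G"
    and "\<And>x. x \<in> Obj J \<Longrightarrow> App \<eta> x = App \<theta> x"
  shows "\<eta> = \<theta>"
proof -
  have "App \<eta> = App \<theta>"
    using assms unfolding Hom_fun is_nat_trans_def PiE_def
    by (intro extensionalityI[of _ "Obj J"]) auto
  then show ?thesis using assms(1,2) unfolding Hom_fun by simp
qed

lemma category_fun_cat:
  assumes J: "category J" and C: "category C"
  shows "category (fun_cat J C)"
proof -
  interpret J: category J by fact
  interpret C: category C by fact
  have comp: "\<theta> \<cdot>\<^bsub>fun_cat J C\<^esub> \<eta> \<in> Hom (fun_cat J C) F H"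
    if e: "\<eta> \<in> Hom (fun_cat J C) F G" and t: "\<theta> \<in> Hom (fun_cat J C) G H" for \<eta> \<theta> F G H
  proof (rule Hom_funI, goal_cases)
    case (6 x)
    then show ?case using C.comp_hom[OF Hom_fun_App[OF e 6] Hom_fun_App[OF t 6]] by simp
  next
    case (7 f x y)
    note o = J.Hom_obj[OF 7]
    note h = is_functor_Hom[OF Hom_fun_functor(1)[OF e] 7] is_functor_Hom[OF Hom_fun_functor(1)[OF t] 7]
      is_functor_Hom[OF Hom_fun_functor(2)[OF t] 7]
    note a = Hom_fun_App[OF e o(1)] Hom_fun_App[OF e o(2)] Hom_fun_App[OF t o(1)] Hom_fun_App[OF t o(2)]
    have "App \<theta> y \<cdot>\<^bsub>C\<^esub> App \<eta> y \<cdot>\<^bsub>C\<^esub> FAr F f = App \<theta> y \<cdot>\<^bsub>C\<^esub> (FAr G f \<cdot>\<^bsub>C\<^esub> App \<eta> x)"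
      using C.comp_assoc[OF h(1) a(2) a(4)] Hom_fun_nat[OF e 7] by simp
    also have "\<dots> = FAr H f \<cdot>\<^bsub>C\<^esub> (App \<theta> x \<cdot>\<^bsub>C\<^esub> App \<eta> x)"
      using C.comp_assoc[OF a(1) h(2) a(4)] C.comp_assoc[OF a(1) a(3) h(3)] Hom_fun_nat[OF t 7] by simp
    finally show ?case using o by simp
  qed (use e t in \<open>auto simp: Hom_fun is_nat_trans_def\<close>)
  have idt: "Idt (fun_cat J C) F \<in> Hom (fun_cat J C) F F" if "is_functor J C F" for F
  proof (rule Hom_funI, goal_cases)
    case (6 x)
    then show ?case using that by (simp add: C.idt_hom is_functor_Ob)
  next
    case (7 f x y)
    then show ?case using is_functor_Hom[OF that 7] J.Hom_obj[OF 7] C.comp_idt_left C.comp_idt_right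
      by simp
  qed (use that in auto)
  show ?thesis
  proof
    fix \<eta> \<theta> \<zeta> F G H K
    show "\<eta> \<in> Arr (fun_cat J C) \<Longrightarrow> Dom (fun_cat J C) \<eta> \<in> Obj (fun_cat J C)"
      "\<eta> \<in> Arr (fun_cat J C) \<Longrightarrow> Cod (fun_cat J C) \<eta> \<in> Obj (fun_cat J C)"
      by (auto simp: is_nat_trans_def)
    show "F \<in> Obj (fun_cat J C) \<Longrightarrow> Idt (fun_cat J C) F \<in> Hom (fun_cat J C) F F"
      using idt by simp
    assume e: "\<eta> \<in> Hom (fun_cat J C) F G"
    note fn = Hom_fun_functor[OF e]
    show "Idt (fun_cat J C) G \<cdot>\<^bsub>fun_cat J C\<^esub> \<eta> = \<eta>"
      by (rule Hom_fun_eqI[OF comp[OF e idt] e])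
        (use fn Hom_fun_App[OF e] in \<open>auto intro!: C.comp_idt_left\<close>)
    show "\<eta> \<cdot>\<^bsub>fun_cat J C\<^esub> Idt (fun_cat J C) F = \<eta>"
      by (rule Hom_fun_eqI[OF comp[OF idt e] e])
        (use fn Hom_fun_App[OF e] in \<open>auto intro!: C.comp_idt_right\<close>)
    assume t: "\<theta> \<in> Hom (fun_cat J C) G H"
    show "\<theta> \<cdot>\<^bsub>fun_cat J C\<^esub> \<eta> \<in> Hom (fun_cat J C) F H" by (rule comp[OF e t])
    assume z: "\<zeta> \<in> Hom (fun_cat J C) H K"
    show "(\<zeta> \<cdot>\<^bsub>fun_cat J C\<^esub> \<theta>) \<cdot>\<^bsub>fun_cat J C\<^esub> \<eta> = \<zeta> \<cdot>\<^bsub>fun_cat J C\<^esub> (\<theta> \<cdot>\<^bsub>fun_cat J C\<^esub> \<eta>)"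
      by (rule Hom_fun_eqI[OF comp[OF e comp[OF t z]] comp[OF comp[OF e t] z]])
       (use Hom_fun_App[OF e] Hom_fun_App[OF t] Hom_fun_App[OF z] in \<open>auto intro!: C.comp_assoc\<close>)
  qed
qed

text \<open>Pointwise inverses are natural: the naturality square of \<eta> is multiplied by the
  inverses at both ends. This turns componentwise comparisons of colimits into isomorphisms of
  functors.\<close>

lemma iso_arr_fun_cat:
  assumes J: "category J" and C: "category C" and e: "\<eta> \<in> Hom (fun_cat J C) F G"
    and iso: "\<And>x. x \<in> Obj J \<Longrightarrow> iso_arr C (FOb F x) (FOb G x) (App \<eta> x)"
  shows "iso_arr (fun_cat J C) F G \<eta>"
proof -
  interpret J: category J by fact
  interpret C: category C by fact
  interpret FC: category "fun_cat J C" by (rule category_fun_cat[OF J C])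
  define \<theta> where "\<theta> = \<lparr>Src = G, Tgt = F, App = (\<lambda>x\<in>Obj J. inv_arr C (App \<eta> x))\<rparr>"
  note fn = Hom_fun_functor[OF e]
  have t: "\<theta> \<in> Hom (fun_cat J C) G F"
  proof (rule Hom_funI, goal_cases)
    case (6 x)
    then show ?case using C.iso_arr_inv(1)[OF iso[OF 6]] by (simp add: \<theta>_def)
  next
    case (7 f x y)
    note o = J.Hom_obj[OF 7]
    note i = C.iso_arr_inv[OF iso[OF o(1)]] C.iso_arr_inv[OF iso[OF o(2)]]
    note h = is_functor_Hom[OF fn(1) 7] is_functor_Hom[OF fn(2) 7]
    note a = Hom_fun_App[OF e o(1)] Hom_fun_App[OF e o(2)]
    have "inv_arr C (App \<eta> y) \<cdot>\<^bsub>C\<^esub> FAr G f =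
        inv_arr C (App \<eta> y) \<cdot>\<^bsub>C\<^esub> (FAr G f \<cdot>\<^bsub>C\<^esub> (App \<eta> x \<cdot>\<^bsub>C\<^esub> inv_arr C (App \<eta> x)))"
      using i(3) C.comp_idt_right[OF h(2)] by simp
    also have "\<dots> = inv_arr C (App \<eta> y) \<cdot>\<^bsub>C\<^esub> ((App \<eta> y \<cdot>\<^bsub>C\<^esub> FAr F f) \<cdot>\<^bsub>C\<^esub> inv_arr C (App \<eta> x))"
      using C.comp_assoc[OF i(1) a(1) h(2)] Hom_fun_nat[OF e 7] by simp
    also have "\<dots> = (inv_arr C (App \<eta> y) \<cdot>\<^bsub>C\<^esub> App \<eta> y) \<cdot>\<^bsub>C\<^esub> (FAr F f \<cdot>\<^bsub>C\<^esub> inv_arr C (App \<eta> x))"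
      using C.comp_assoc4[OF i(1) h(1) a(2) i(4)] by simp
    also have "\<dots> = FAr F f \<cdot>\<^bsub>C\<^esub> inv_arr C (App \<eta> x)"
      using i(5) C.comp_idt_left C.comp_hom[OF i(1) h(1)] by simp
    finally show ?case using o by (simp add: \<theta>_def)
  qed (use fn in \<open>auto simp: \<theta>_def\<close>)
  have "\<theta> \<cdot>\<^bsub>fun_cat J C\<^esub> \<eta> = Idt (fun_cat J C) F"
    by (rule Hom_fun_eqI[OF FC.comp_hom[OF e t] FC.idt_hom])
      (use fn C.iso_arr_inv(2)[OF iso] in \<open>auto simp: \<theta>_def\<close>)
  moreover have "\<eta> \<cdot>\<^bsub>fun_cat J C\<^esub> \<theta> = Idt (fun_cat J C) G"
    by (rule Hom_fun_eqI[OF FC.comp_hom[OF t e] FC.idt_hom])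
      (use fn C.iso_arr_inv(3)[OF iso] in \<open>auto simp: \<theta>_def\<close>)
  ultimately show ?thesis using e t by (auto simp: iso_arr_def)
qed

section \<open>Precomposition as a functor between functor categories\<close>

lemma precomp_simps:
  "is_functor K C F \<Longrightarrow> FOb (precomp J K C G) F = comp_fn J F G"
  "\<eta> \<in> Hom (fun_cat K C) F F' \<Longrightarrow> FAr (precomp J K C G) \<eta> =
     \<lparr>Src = comp_fn J F G, Tgt = comp_fn J F' G, App = (\<lambda>x\<in>Obj J. App \<eta> (FOb G x))\<rparr>"
  by (simp_all add: precomp_def Hom_fun)

lemma is_functor_precomp:
  assumes J: "category J" and K: "category K" and C: "category C" and G: "is_functor J K G"
  shows "is_functor (fun_cat K C) (fun_cat J C) (precomp J K C G)"
proof -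
  interpret J: category J by fact
  interpret C: category C by fact
  interpret KC: category "fun_cat K C" by (rule category_fun_cat[OF K C])
  interpret JC: category "fun_cat J C" by (rule category_fun_cat[OF J C])
  have Ob: "is_functor J C (comp_fn J F G)" if "is_functor K C F" for F
    using is_functor_comp[OF J G that] .
  have Ar: "FAr (precomp J K C G) \<eta> \<in> Hom (fun_cat J C) (comp_fn J F G) (comp_fn J F' G)"
    if e: "\<eta> \<in> Hom (fun_cat K C) F F'" for \<eta> F F'
  proof (rule Hom_funI, goal_cases)
    case (6 x)
    then show ?case
      using Hom_fun_App[OF e is_functor_Ob[OF G 6]] e by (simp add: precomp_simps comp_fn_def)
  next
    case (7 f x y)
    then show ?case
      using Hom_fun_nat[OF e is_functor_Hom[OF G 7]] e J.Hom_obj[OF 7]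
      by (simp add: precomp_simps comp_fn_def in_Hom)
  qed (use e Ob Hom_fun_functor[OF e] in \<open>auto simp: precomp_simps\<close>)
  show ?thesis
  proof (rule is_functorI, goal_cases)
    case (3 F)
    then show ?case using Ob by (simp add: precomp_simps)
  next
    case (4 \<eta> F F')
    then show ?case using Ar[OF 4] Hom_fun_functor[OF 4] by (simp add: precomp_simps)
  next
    case (5 F)
    then have F: "is_functor K C F" by simp
    show ?case
      using Ob[OF F] KC.idt_hom[OF 5] is_functor_Ob[OF G] F
      by (simp add: precomp_simps comp_fn_def restrict_def cong: if_cong)
  next
    case (6 \<eta> \<theta> F F' F'')
    show ?case
      using KC.comp_hom[OF 6] 6 is_functor_Ob[OF G] Hom_fun_functor[OF 6(1)] Hom_fun_functor[OF 6(2)]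
      by (simp add: precomp_simps restrict_def  cong: if_cong)
  qed (auto simp: precomp_def)
qed

subsection \<open>Colimits\<close>

lemma colim_desc_unique:
  assumes "is_colimit J C D (fst ck) (snd ck)" "is_cocone J C D d \<mu>"
  shows "colim_desc J C ck d \<mu> \<in> Hom C (fst ck) d"
    and "x \<in> Obj J \<Longrightarrow> colim_desc J C ck d \<mu> \<cdot>\<^bsub>C\<^esub> snd ck x = \<mu> x"
    and "\<lbrakk>u \<in> Hom C (fst ck) d; \<And>x. x \<in> Obj J \<Longrightarrow> u \<cdot>\<^bsub>C\<^esub> snd ck x = \<mu> x\<rbrakk> \<Longrightarrow> u = colim_desc J C ck d \<mu>"
proof -
  have ex1: "\<exists>!u. u \<in> Hom C (fst ck) d \<and> (\<forall>x\<in>Obj J. u \<cdot>\<^bsub>C\<^esub> snd ck x = \<mu> x)"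
    using assms unfolding is_colimit_def by blast
  note th = theI'[OF ex1, folded colim_desc_def]
  show "colim_desc J C ck d \<mu> \<in> Hom C (fst ck) d" using th by blast
  show "x \<in> Obj J \<Longrightarrow> colim_desc J C ck d \<mu> \<cdot>\<^bsub>C\<^esub> snd ck x = \<mu> x" using th by blast
  show "u = colim_desc J C ck d \<mu>"
    if "u \<in> Hom C (fst ck) d" "\<And>x. x \<in> Obj J \<Longrightarrow> u \<cdot>\<^bsub>C\<^esub> snd ck x = \<mu> x" for u
    using ex1 th that by blast
qed

lemma (in category) cocone_comp:
  assumes J: "category J" and D: "is_functor J C D" and c: "is_cocone J C D c \<kappa>" and u: "u \<in> Hom C c d"
  shows "is_cocone J C D d (\<lambda>x. u \<cdot> \<kappa> x)"
proof -
  interpret J: category J by fact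
  show ?thesis
    unfolding is_cocone_def
  proof (intro conjI ballI)
    show "d \<in> Obj C" using Hom_obj[OF u] by simp
    show "u \<cdot> \<kappa> x \<in> Hom C (FOb D x) d" if "x \<in> Obj J" for x
      using c u that comp_hom unfolding is_cocone_def by blast
    show "u \<cdot> \<kappa> (Cod J f) \<cdot> FAr D f = u \<cdot> \<kappa> (Dom J f)" if f: "f \<in> Arr J" for f
      using c u f comp_assoc[OF is_functor_Hom[OF D Arr_in_Hom[OF f]] _ u, of "\<kappa> (Cod J f)"]
        J.cod_obj[OF f] unfolding is_cocone_def by auto
  qed
qed

text \<open>Both arrows mediate the cocone formed by the \<open>u \<cdot> \<kappa> x\<close>, so
  they coincide. Below, equations between arrows out of colimits are checked on the injections in
  this way.\<close>

lemma (in category) colimit_ext: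
  assumes J: "category J" and D: "is_functor J C D" and c: "is_colimit J C D c \<kappa>"
    and u: "u \<in> Hom C c d" "v \<in> Hom C c d" and eq: "\<And>x. x \<in> Obj J \<Longrightarrow> u \<cdot> \<kappa> x = v \<cdot> \<kappa> x"
  shows "u = v"
proof -
  have "is_cocone J C D d (\<lambda>x. u \<cdot> \<kappa> x)"
    using cocone_comp[OF J D _ u(1)] c by (simp add: is_colimit_def)
  then have "\<exists>!w. w \<in> Hom C c d \<and> (\<forall>x\<in>Obj J. w \<cdot> \<kappa> x = u \<cdot> \<kappa> x)"
    using c unfolding is_colimit_def by blast
  then show ?thesis using u eq by metis
qed

text \<open>The target is any colimit of the same diagram, so that an unspecified chosen colimit can
  be compared with one that is computed explicitly.\<close>

lemma (in category) iso_arr_colim_desc: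
  assumes J: "category J" and D: "is_functor J C D" and c: "is_colimit J C D (fst ck) (snd ck)"
    and d: "is_colimit J C D d \<mu>"
  shows "iso_arr C (fst ck) d (colim_desc J C ck d \<mu>)"
proof -
  have cc: "is_cocone J C D (fst ck) (snd ck)" "is_cocone J C D d \<mu>"
    using c d by (auto simp: is_colimit_def)
  define u where "u = colim_desc J C ck d \<mu>"
  note u = colim_desc_unique(1,2)[OF c cc(2), folded u_def]
  obtain v where v: "v \<in> Hom C d (fst ck)" "\<And>x. x \<in> Obj J \<Longrightarrow> v \<cdot> \<mu> x = snd ck x"
    using d cc unfolding is_colimit_def by blast
  note ob = Hom_obj[OF v(1)]
  have k: "snd ck x \<in> Hom C (FOb D x) (fst ck)" "\<mu> x \<in> Hom C (FOb D x) d" if "x \<in> Obj J" for x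
    using cc that by (auto simp: is_cocone_def)
  have "v \<cdot> u = Idt C (fst ck)"
    by (rule colimit_ext[OF J D c comp_hom[OF u(1) v(1)] idt_hom[OF ob(2)]])
      (simp add: comp_assoc[OF k(1) u(1) v(1)] u(2) v(2) comp_idt_left[OF k(1)])
  moreover have "u \<cdot> v = Idt C d"
    by (rule colimit_ext[OF J D d comp_hom[OF v(1) u(1)] idt_hom[OF ob(1)]])
      (simp add: comp_assoc[OF k(2) v(1) u(1)] u(2) v(2) comp_idt_left[OF k(2)])
  ultimately show ?thesis using u v unfolding iso_arr_def u_def by blast
qed

section \<open>Ordinals, joins of monotone maps and their blocks\<close>

section \<open>The simplex category\<close>

abbreviation comp_Delta :: "darr \<Rightarrow> darr \<Rightarrow> darr"  (infixl "\<odot>" 70) where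
  "\<beta> \<odot> \<alpha> \<equiv> \<beta> \<cdot>\<^bsub>Delta\<^esub> \<alpha>"

text \<open>Normal form for arrows of \<open>Delta\<close>: the restriction supplies the required
  extensionality, so values of f above k are irrelevant and equations of arrows become pointwise
  equations up to k.\<close>

definition dmap :: "nat \<Rightarrow> nat \<Rightarrow> (nat \<Rightarrow> nat) \<Rightarrow> darr" where
  "dmap k n f = (k, n, restrict f {..k})"

definition dfun :: "darr \<Rightarrow> nat \<Rightarrow> nat" where
  "dfun \<alpha> = snd (snd \<alpha>)"

definition dmono :: "nat \<Rightarrow> nat \<Rightarrow> (nat \<Rightarrow> nat) \<Rightarrow> bool" where
  "dmono k n f \<longleftrightarrow> (\<forall>i\<le>k. f i \<le> n) \<and> (\<forall>i j. i \<le> j \<longrightarrow> j \<le> k \<longrightarrow> f i \<le> f j)"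

lemma Delta_simps [simp]:
  "Obj Delta = UNIV" "Dom Delta (k, n, f) = k" "Cod Delta (k, n, f) = n"
  by (simp_all add: Delta_def)

lemma dmap_simps [simp]: "Dom Delta (dmap k n f) = k" "Cod Delta (dmap k n f) = n"
  by (simp_all add: dmap_def)

lemma dfun_dmap [simp]: "i \<le> k \<Longrightarrow> dfun (dmap k n f) i = f i"
  by (simp add: dfun_def dmap_def)

lemma Idt_Delta: "Idt Delta k = dmap k k (\<lambda>i. i)"
  by (simp add: Delta_def dmap_def)

lemma dmap_Hom [simp]: "dmap k n f \<in> Hom Delta k' n' \<longleftrightarrow> k' = k \<and> n' = n \<and> dmono k n f"
  by (auto simp: in_Hom Delta_def dmap_def dmono_def mono_on_def)

lemma dmap_cong: "(\<And>i. i \<le> k \<Longrightarrow> f i = g i) \<Longrightarrow> dmap k n f = dmap k n g"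
  by (auto simp: dmap_def)

lemma dmap_eq_iff: "dmap k n f = dmap k' n' g \<longleftrightarrow> k = k' \<and> n = n' \<and> (\<forall>i\<le>k. f i = g i)"
  by (auto simp: dmap_def fun_eq_iff restrict_def)

lemma Hom_Delta_dfun:
  assumes "\<alpha> \<in> Hom Delta k n"
  shows "\<alpha> = dmap k n (dfun \<alpha>)" "dmono k n (dfun \<alpha>)"
proof -
  show *: "\<alpha> = dmap k n (dfun \<alpha>)"
    using assms by (cases \<alpha>) (auto simp: in_Hom Delta_def dmap_def dfun_def PiE_def extensional_restrict)
  show "dmono k n (dfun \<alpha>)"
    using assms * by (metis dmap_Hom)
qed

lemma Hom_Delta_cases [consumes 1]:
  assumes "\<alpha> \<in> Hom Delta k n"
  obtains f where "\<alpha> = dmap k n f" "dmono k n f"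
  using Hom_Delta_dfun[OF assms] by blast

lemma dmap_comp [simp]:
  "dmono k m f \<Longrightarrow> dmap m q g \<odot> dmap k m f = dmap k q (\<lambda>i. g (f i))"
  by (auto simp: Delta_def dmap_def compose_def dmono_def restrict_def fun_eq_iff)

lemma dmono_comp: "dmono k m f \<Longrightarrow> dmono m q g \<Longrightarrow> dmono k q (\<lambda>i. g (f i))"
  unfolding dmono_def by auto

lemma dmonoD:
  "dmono k n f \<Longrightarrow> i \<le> k \<Longrightarrow> f i \<le> n"
  "dmono k n f \<Longrightarrow> i \<le> j \<Longrightarrow> j \<le> k \<Longrightarrow> f i \<le> f j"
  unfolding dmono_def by auto

lemma dmono_id: "dmono k k (\<lambda>i. i)"
  by (simp add: dmono_def)

lemma category_Delta: "category Delta"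
proof
  fix f g h x y z w
  show "f \<in> Arr Delta \<Longrightarrow> Dom Delta f \<in> Obj Delta" "f \<in> Arr Delta \<Longrightarrow> Cod Delta f \<in> Obj Delta"
    "Idt Delta x \<in> Hom Delta x x"
    by (simp_all add: Idt_Delta dmono_id)
  assume f: "f \<in> Hom Delta x y"
  then show "Idt Delta y \<odot> f = f" "f \<odot> Idt Delta x = f"
    by (auto elim!: Hom_Delta_cases simp: Idt_Delta dmono_id)
  assume g: "g \<in> Hom Delta y z"
  show "g \<odot> f \<in> Hom Delta x z"
    using f g by (auto elim!: Hom_Delta_cases intro: dmono_comp)
  assume h: "h \<in> Hom Delta z w"
  show "(h \<odot> g) \<odot> f = h \<odot> (g \<odot> f)"
    using f g h by (auto elim!: Hom_Delta_cases simp: dmono_comp)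
qed

interpretation Delta: category Delta by (rule category_Delta)

lemma category_Dop: "category Dop"
  by (rule category_op[OF category_Delta])

lemma category_Dop_pow: "category (Dop_pow p)"
  by (rule category_pow[OF category_Dop])

text \<open>Lists of arrows of \<open>Dop\<close> are handled as lists of arrows of
  \<open>Delta\<close> with the ends exchanged, so that the combinatorics takes place between
  ordinals.\<close>

lemma Hom_Dop_pow: "Hom (Dop_pow p) ks ls = Hom (pow_cat Delta p) ls ks"
  by (auto simp: Hom_pow)

lemma Comp_Dop_pow: "gs \<cdot>\<^bsub>Dop_pow p\<^esub> fs = fs \<cdot>\<^bsub>pow_cat Delta p\<^esub> gs"
  by (simp, subst zip_commute) (simp add: case_prod_beta)

subsection \<open>Concatenation\<close>

lemma dec_ob_Cons: "dec_ob (k # ks) = (if ks = [] then k else Suc (k + dec_ob ks))"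
  by (cases ks) auto

lemma dec_ob_append: "ks \<noteq> [] \<Longrightarrow> ls \<noteq> [] \<Longrightarrow> dec_ob (ks @ ls) = Suc (dec_ob ks + dec_ob ls)"
  by (induction ks) (auto simp: dec_ob_Cons)

text \<open>Associativity of concatenation in the form that fibres require: join within groups, then
  join the results. Empty groups are excluded because \<open>dec_ob []\<close> carries no
  meaning.\<close>

lemma dec_ob_concat:
  "\<lbrakk>kss \<noteq> []; \<forall>ks\<in>set kss. ks \<noteq> []\<rbrakk> \<Longrightarrow> dec_ob (concat kss) = dec_ob (map dec_ob kss)"
  by (induction kss) (auto simp: dec_ob_Cons dec_ob_append)

lemma join_arr_assoc: "join_arr (join_arr f g) h = join_arr f (join_arr g h)"
  by (cases f; cases g; cases h) (auto simp: fun_eq_iff)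

lemma dec_arr_Cons: "dec_arr (f # fs) = (if fs = [] then f else join_arr f (dec_arr fs))"
  by (cases fs) auto

lemma dec_arr_append:
  "fs \<noteq> [] \<Longrightarrow> gs \<noteq> [] \<Longrightarrow> dec_arr (fs @ gs) = join_arr (dec_arr fs) (dec_arr gs)"
  by (induction fs) (auto simp: dec_arr_Cons join_arr_assoc)

lemma dec_arr_concat:
  "\<lbrakk>fss \<noteq> []; \<forall>fs\<in>set fss. fs \<noteq> []\<rbrakk> \<Longrightarrow> dec_arr (concat fss) = dec_arr (map dec_arr fss)"
  by (induction fss) (auto simp: dec_arr_Cons dec_arr_append)

text \<open>Underlying function of \<open>dec_arr\<close> as a total function, which permits
  inductions over the blocks without carrying source and target along.\<close>

fun dec_fun :: "darr list \<Rightarrow> nat \<Rightarrow> nat" where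
  "dec_fun [] i = 0"
| "dec_fun (f # fs) i =
     (if i \<le> Dom Delta f then dfun f i else Suc (Cod Delta f + dec_fun fs (i - Suc (Dom Delta f))))"

text \<open>The number of the block of \<open>[k\<^sub>0] * \<dots> * [k\<^sub>q]\<close> that contains \<open>i\<close>.\<close>

fun block :: "nat list \<Rightarrow> nat \<Rightarrow> nat" where
  "block [] i = 0"
| "block (k # ks) i = (if i \<le> k then 0 else Suc (block ks (i - Suc k)))"

lemma dec_arr_dmap:
  assumes "fs \<noteq> []" "set fs \<subseteq> Arr Delta"
  shows "dec_arr fs = dmap (dec_ob (map (Dom Delta) fs)) (dec_ob (map (Cod Delta) fs)) (dec_fun fs)"
  using assms
proof (induction fs)
  case (Cons f fs)
  obtain k n g where f: "f = dmap k n g" "dmono k n g"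
    using Cons.prems Arr_in_Hom[of f Delta] by (auto elim!: Hom_Delta_cases)
  show ?case
  proof (cases "fs = []")
    case True
    then show ?thesis using f by (auto intro!: dmap_cong)
  next
    case False
    then have "dec_arr fs = dmap (dec_ob (map (Dom Delta) fs)) (dec_ob (map (Cod Delta) fs)) (dec_fun fs)"
      using Cons by simp
    then show ?thesis using f False
      by (auto simp: dec_arr_Cons dec_ob_Cons dmap_def fun_eq_iff restrict_def dfun_def)
  qed
qed simp

lemma dec_fun_mono:
  assumes "fs \<noteq> []" "set fs \<subseteq> Arr Delta"
  shows "dmono (dec_ob (map (Dom Delta) fs)) (dec_ob (map (Cod Delta) fs)) (dec_fun fs)"
  using assms
proof (induction fs)
  case (Cons f fs)
  obtain k n g where f: "f = dmap k n g" "dmono k n g"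
    using Cons.prems Arr_in_Hom[of f Delta] by (auto elim!: Hom_Delta_cases)
  have IH: "dmono (dec_ob (map (Dom Delta) fs)) (dec_ob (map (Cod Delta) fs)) (dec_fun fs)" if "fs \<noteq> []"
    using that Cons by simp
  show ?case
    unfolding dmono_def
  proof (intro conjI allI impI)
    fix i j
    show "i \<le> dec_ob (map (Dom Delta) (f # fs)) \<Longrightarrow> dec_fun (f # fs) i \<le> dec_ob (map (Cod Delta) (f # fs))"
      using f dmonoD(1)[OF f(2), of i] dmonoD(1)[OF IH, of "i - Suc k"]
      by (auto simp: dec_ob_Cons split: if_splits)
    assume "i \<le> j" "j \<le> dec_ob (map (Dom Delta) (f # fs))"
    then show "dec_fun (f # fs) i \<le> dec_fun (f # fs) j"
      using f dmonoD(2)[OF f(2), of i j] dmonoD(1)[OF f(2), of i] dmonoD(2)[OF IH, of "i - Suc k" "j - Suc k"]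
      by (auto simp: dec_ob_Cons split: if_splits)
  qed
qed simp

text \<open>A join sends each block into the block with the same number, hence is a map over the
  ordinal of block numbers. \<open>dec_arr_full\<close> is the converse; together they identify the
  maps that are joins.\<close>

lemma block_dec_fun:
  assumes "set fs \<subseteq> Arr Delta" "i \<le> dec_ob (map (Dom Delta) fs)"
  shows "block (map (Cod Delta) fs) (dec_fun fs i) = block (map (Dom Delta) fs) i"
  using assms
proof (induction fs arbitrary: i)
  case (Cons f fs)
  obtain k n g where f: "f = dmap k n g" "dmono k n g"
    using Cons.prems Arr_in_Hom[of f Delta] by (auto elim!: Hom_Delta_cases)
  have "block (map (Cod Delta) fs) (dec_fun fs (i - Suc k)) = block (map (Dom Delta) fs) (i - Suc k)"
    if "\<not> i \<le> k"
    using that Cons f by (auto simp: dec_ob_Cons split: if_splits)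
  then show ?case using f dmonoD(1)[OF f(2), of i] by auto
qed simp

lemma dec_fun_comp:
  assumes "set fs \<subseteq> Arr Delta" "set gs \<subseteq> Arr Delta" "map (Dom Delta) gs = map (Cod Delta) fs"
    "i \<le> dec_ob (map (Dom Delta) fs)"
  shows "dec_fun (map2 (Comp Delta) gs fs) i = dec_fun gs (dec_fun fs i)"
  using assms
proof (induction fs arbitrary: i gs)
  case (Cons f fs i gs')
  obtain g gs where gs': "gs' = g # gs" using Cons.prems(3) by (cases gs') auto
  obtain k n a where f: "f = dmap k n a" "dmono k n a"
    using Cons.prems Arr_in_Hom[of f Delta] by (auto elim!: Hom_Delta_cases)
  obtain m b where g: "g = dmap n m b" "dmono n m b"
    using Cons.prems gs' f Arr_in_Hom[of g Delta] by (auto elim!: Hom_Delta_cases)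
  have "dec_fun (map2 (Comp Delta) gs fs) (i - Suc k) = dec_fun gs (dec_fun fs (i - Suc k))"
    if "\<not> i \<le> k"
    using that Cons f gs' by (auto simp: dec_ob_Cons split: if_splits)
  then show ?case using f g gs' dmonoD(1)[OF f(2), of i] by auto
qed simp

lemma dec_fun_idt: "i \<le> dec_ob ks \<Longrightarrow> ks \<noteq> [] \<Longrightarrow> dec_fun (map (Idt Delta) ks) i = i"
  by (induction ks arbitrary: i) (auto simp: Idt_Delta dec_ob_Cons split: if_splits)

lemma Hom_powD:
  "fs \<in> Hom (pow_cat C p) ks ls \<Longrightarrow>
    set fs \<subseteq> Arr C \<and> ks = map (Dom C) fs \<and> ls = map (Cod C) fs \<and> length fs = p"
  by (auto simp: in_Hom)

lemma dec_arr_Hom: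
  assumes "fs \<in> Hom (pow_cat Delta p) ks ls" "p > 0"
  shows "dec_arr fs \<in> Hom Delta (dec_ob ks) (dec_ob ls)"
    "dec_arr fs = dmap (dec_ob ks) (dec_ob ls) (dec_fun fs)"
    "dmono (dec_ob ks) (dec_ob ls) (dec_fun fs)"
proof -
  have "fs \<noteq> []" using Hom_powD[OF assms(1)] assms(2) by auto
  then show "dec_arr fs \<in> Hom Delta (dec_ob ks) (dec_ob ls)"
    "dec_arr fs = dmap (dec_ob ks) (dec_ob ls) (dec_fun fs)" "dmono (dec_ob ks) (dec_ob ls) (dec_fun fs)"
    using dec_arr_dmap[of fs] dec_fun_mono[of fs] Hom_powD[OF assms(1)] by simp_all
qed

lemma dec_arr_comp:
  assumes fs: "fs \<in> Hom (pow_cat Delta p) ks ls" and gs: "gs \<in> Hom (pow_cat Delta p) ls ms" and p: "p > 0"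
  shows "dec_arr (gs \<cdot>\<^bsub>pow_cat Delta p\<^esub> fs) = dec_arr gs \<odot> dec_arr fs"
proof -
  have gf: "gs \<cdot>\<^bsub>pow_cat Delta p\<^esub> fs \<in> Hom (pow_cat Delta p) ks ms"
    using category.comp_hom[OF category_pow[OF category_Delta] fs gs] .
  show ?thesis
    unfolding dec_arr_Hom(2)[OF fs p] dec_arr_Hom(2)[OF gs p] dec_arr_Hom(2)[OF gf p]
      dmap_comp[OF dec_arr_Hom(3)[OF fs p]]
    by (rule dmap_cong) (use Hom_powD[OF fs] Hom_powD[OF gs] in \<open>simp add: dec_fun_comp\<close>)
qed

lemma dec_arr_idt:
  assumes "ks \<noteq> []"
  shows "dec_arr (map (Idt Delta) ks) = Idt Delta (dec_ob ks)"
proof -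
  have "map (Idt Delta) ks \<in> Hom (pow_cat Delta (length ks)) ks ks"
    by (simp add: Hom_pow Idt_Delta dmono_id)
  from dec_arr_Hom(2)[OF this] show ?thesis
    using assms by (simp add: dec_fun_idt dmap_eq_iff Idt_Delta[of "dec_ob ks"])
qed

lemma is_functor_dec:
  assumes "p > 0"
  shows "is_functor (Dop_pow p) Dop (dec p)"
proof (rule is_functorI, goal_cases)
  case (4 fs ks ls)
  then show ?case using category.Hom_obj[OF category_Dop_pow 4] dec_arr_Hom(1)[OF _ assms, of fs ls ks]
    unfolding Hom_Dop_pow by (auto simp: dec_def in_Hom)
next
  case (5 ks)
  then have "ks \<noteq> []" using assms by auto
  then show ?case using 5 category.idt_hom[OF category_Dop_pow 5]
    by (simp add: dec_def dec_arr_idt in_Hom)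
next
  case (6 fs gs ks ls ms)
  then show ?case
    using dec_arr_comp[OF _ _ assms, of gs ms ls fs ks] category.comp_hom[OF category_Dop_pow 6]
    unfolding Comp_Dop_pow Hom_Dop_pow by (simp add: dec_def in_Hom)
qed (auto simp: dec_def)

section \<open>Blocks of a join, block-preserving maps and surjections\<close>

lemma block_less: "ks \<noteq> [] \<Longrightarrow> i \<le> dec_ob ks \<Longrightarrow> block ks i < length ks"
  by (induction ks arbitrary: i) (auto simp: dec_ob_Cons split: if_splits)

lemma block_mono: "i \<le> j \<Longrightarrow> block ks i \<le> block ks j"
  by (induction ks arbitrary: i j) auto

lemma block_surj: "m < length ks \<Longrightarrow> \<exists>i\<le>dec_ob ks. block ks i = m"
proof (induction ks arbitrary: m)
  case (Cons k ks)
  show ?case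
  proof (cases m)
    case 0
    then show ?thesis by (intro exI[of _ 0]) simp
  next
    case (Suc m')
    then obtain i where "i \<le> dec_ob ks" "block ks i = m'" "ks \<noteq> []" using Cons by fastforce
    then show ?thesis using Suc by (intro exI[of _ "i + Suc k"]) (auto simp: dec_ob_Cons)
  qed
qed simp

lemma block_append: "ks \<noteq> [] \<Longrightarrow> block (ks @ ls) i =
    (if i \<le> dec_ob ks then block ks i else length ks + block ls (i - Suc (dec_ob ks)))"
  by (induction ks arbitrary: i) (auto simp: dec_ob_Cons)

text \<open>Blocks are collected into groups, group j being \<open>K j\<close>. A coarse block is a
  union of consecutive fine ones, so repeating each label over its group and reading it at a fine
  block gives the label of the coarse block.\<close>

lemma nth_block_concat:
  assumes "\<And>j. j \<in> set js \<Longrightarrow> K j \<noteq> []" "js \<noteq> []" "i \<le> dec_ob (map (\<lambda>j. dec_ob (K j)) js)"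
  shows "concat (map (\<lambda>j. replicate (length (K j)) j) js) ! block (concat (map K js)) i =
    js ! block (map (\<lambda>j. dec_ob (K j)) js) i"
  using assms
proof (induction js arbitrary: i)
  case (Cons j js)
  have Kj: "K j \<noteq> []" using Cons.prems by simp
  show ?case
  proof (cases "i \<le> dec_ob (K j)")
    case True
    then show ?thesis using block_less[OF Kj True] Kj
      by (simp add: block_append nth_append)
  next
    case False
    then have "js \<noteq> []" "i - Suc (dec_ob (K j)) \<le> dec_ob (map (\<lambda>j. dec_ob (K j)) js)"
      using Cons.prems by (auto simp: dec_ob_Cons split: if_splits)
    then show ?thesis using Cons False Kj by (simp add: block_append nth_append)
  qed
qed simp

text \<open>The first block is mapped into the first block and the rest beyond it, so the first
  factor is a restriction of g and the induction continues with the remainder.\<close>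

lemma dec_fun_full:
  assumes "length ks = length ls" "ks \<noteq> []" "dmono (dec_ob ks) (dec_ob ls) g"
    "\<And>i. i \<le> dec_ob ks \<Longrightarrow> block ls (g i) = block ks i"
  shows "\<exists>fs. set fs \<subseteq> Arr Delta \<and> map (Dom Delta) fs = ks \<and> map (Cod Delta) fs = ls \<and>
    (\<forall>i\<le>dec_ob ks. dec_fun fs i = g i)"
  using assms
proof (induction ks arbitrary: ls g)
  case (Cons k ks ls')
  obtain l ls where ls': "ls' = l # ls" using Cons.prems(1) by (cases ls') auto
  have lo: "g i \<le> l" if "i \<le> k" for i
  proof -
    have "i \<le> dec_ob (k # ks)" using that by (simp add: dec_ob_Cons)
    then show ?thesis using Cons.prems(4)[of i] that ls' by (auto split: if_splits)
  qed
  have f: "dmap k l g \<in> Arr Delta"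
    using lo Cons.prems(3) dmap_Hom[of k l g k l] unfolding dmono_def in_Hom
    by (auto simp: dec_ob_Cons split: if_splits)
  show ?case
  proof (cases "ks = []")
    case True
    then show ?thesis using f ls' Cons.prems(1) by (intro exI[of _ "[dmap k l g]"]) simp
  next
    case False
    \<comment> \<open>The part of g past the first block, with source shifted by k + 1 and values by
      l + 1; the fact \<open>b\<close> below makes the subtraction exact.\<close>
    define g' where "g' i = g (i + Suc k) - Suc l" for i
    have ne: "ls \<noteq> []" using False Cons.prems(1) ls' by auto
    have b: "\<not> g (i + Suc k) \<le> l \<and> block ls (g' i) = block ks i" if "i \<le> dec_ob ks" for i
      using Cons.prems(4)[of "i + Suc k"] that ls' False
      by (auto simp: dec_ob_Cons g'_def split: if_splits)
    have "dmono (dec_ob ks) (dec_ob ls) g'"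
      unfolding dmono_def g'_def
    proof (intro conjI allI impI)
      show "g (i + Suc k) - Suc l \<le> dec_ob ls" if "i \<le> dec_ob ks" for i
        using dmonoD(1)[OF Cons.prems(3), of "i + Suc k"] that False ne ls' by (simp add: dec_ob_Cons)
      show "g (i + Suc k) - Suc l \<le> g (j + Suc k) - Suc l" if "i \<le> j" "j \<le> dec_ob ks" for i j
        using dmonoD(2)[OF Cons.prems(3), of "i + Suc k" "j + Suc k"] that False ne ls'
        by (simp add: dec_ob_Cons diff_le_mono)
    qed
    then obtain fs where fs: "set fs \<subseteq> Arr Delta" "map (Dom Delta) fs = ks" "map (Cod Delta) fs = ls"
      "\<forall>i\<le>dec_ob ks. dec_fun fs i = g' i"
      using Cons.IH[of ls g'] b False Cons.prems(1) ls' by auto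
    have "dec_fun (dmap k l g # fs) i = g i" if "i \<le> dec_ob (k # ks)" for i
    proof (cases "i \<le> k")
      case nle: False
      then have "i - Suc k \<le> dec_ob ks" using that False by (simp add: dec_ob_Cons)
      then show ?thesis using nle fs(4)[rule_format, of "i - Suc k"] b[of "i - Suc k"] by (simp add: g'_def)
    qed simp
    then show ?thesis using fs f ls' by (intro exI[of _ "dmap k l g # fs"]) auto
  qed
qed simp

lemma dec_arr_full:
  assumes "length ks = p" "length ls = p" "p > 0" "dmono (dec_ob ks) (dec_ob ls) g"
    "\<And>i. i \<le> dec_ob ks \<Longrightarrow> block ls (g i) = block ks i"
  obtains fs where "fs \<in> Hom (pow_cat Delta p) ks ls" "dec_arr fs = dmap (dec_ob ks) (dec_ob ls) g"
proof -
  obtain fs where fs: "set fs \<subseteq> Arr Delta \<and> map (Dom Delta) fs = ks \<and> map (Cod Delta) fs = ls \<and>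
    (\<forall>i\<le>dec_ob ks. dec_fun fs i = g i)"
    using dec_fun_full[OF _ _ assms(4,5)] assms(1-3) by fastforce
  then have h: "fs \<in> Hom (pow_cat Delta p) ks ls" using assms(1) by (auto simp: in_Hom)
  show thesis
    by (rule that[OF h]) (use dec_arr_Hom(2)[OF h assms(3)] fs in \<open>auto intro: dmap_cong\<close>)
qed

text \<open>The blocks are the fibres of f; surjectivity makes each of them nonempty, as an ordinal
  [k] has to be. The induction removes the fibre over 0.\<close>

lemma surj_is_block:
  assumes "dmono k n f" "\<And>j. j \<le> n \<Longrightarrow> \<exists>i\<le>k. f i = j"
  shows "\<exists>ks. length ks = Suc n \<and> dec_ob ks = k \<and> (\<forall>i\<le>k. block ks i = f i)"
  using assms
proof (induction n arbitrary: k f)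
  case 0
  then show ?case by (intro exI[of _ "[k]"]) (auto simp: dmono_def)
next
  case (Suc n)
  \<comment> \<open>The last element over 0: this fibre has k0 + 1 elements and becomes the block
    [k0].\<close>
  define k0 where "k0 = Max {i. i \<le> k \<and> f i = 0}"
  have fin: "finite {i. i \<le> k \<and> f i = 0}" by simp
  have "k0 \<in> {i. i \<le> k \<and> f i = 0}"
    unfolding k0_def by (rule Max_in[OF fin]) (use Suc.prems(2)[of 0] in auto)
  then have k0: "k0 \<le> k" "f k0 = 0" by auto
  have lo: "f i = 0" if "i \<le> k0" for i
    using dmonoD(2)[OF Suc.prems(1) that k0(1)] k0(2) by simp
  have hi: "f i \<noteq> 0" if "k0 < i" "i \<le> k" for i
    using Max_ge[OF fin, of i] that unfolding k0_def by fastforce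
  obtain i1 where "i1 \<le> k" "f i1 = Suc n" using Suc.prems(2)[of "Suc n"] by auto
  then have "k0 < k" using lo[of i1] by force
  \<comment> \<open>The remaining elements, renumbered from 0 and with values lowered by 1.\<close>
  define g where "g i = f (i + Suc k0) - 1" for i
  have "dmono (k - Suc k0) n g"
    unfolding dmono_def g_def
  proof (intro conjI allI impI)
    show "f (i + Suc k0) - 1 \<le> n" if "i \<le> k - Suc k0" for i
    proof -
      have "i + Suc k0 \<le> k" using that \<open>k0 < k\<close> by simp
      then show ?thesis using dmonoD(1)[OF Suc.prems(1), of "i + Suc k0"] by simp
    qed
    show "f (i + Suc k0) - 1 \<le> f (j + Suc k0) - 1" if "i \<le> j" "j \<le> k - Suc k0" for i j
      using dmonoD(2)[OF Suc.prems(1), of "i + Suc k0" "j + Suc k0"] that \<open>k0 < k\<close> by (simp add: diff_le_mono)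
  qed
  moreover have "\<exists>i\<le>k - Suc k0. g i = j" if j: "j \<le> n" for j
  proof -
    obtain i where "i \<le> k" "f i = Suc j" using Suc.prems(2)[of "Suc j"] j by auto
    moreover from this have "i > k0" using lo[of i] by fastforce
    ultimately show ?thesis by (intro exI[of _ "i - Suc k0"]) (auto simp: g_def)
  qed
  ultimately obtain ks where ks: "length ks = Suc n" "dec_ob ks = k - Suc k0" "\<forall>i\<le>k - Suc k0. block ks i = g i"
    using Suc.IH by blast
  have "ks \<noteq> []" using ks(1) by auto
  moreover have "block (k0 # ks) i = f i" if "i \<le> k" for i
    using lo[of i] hi[of i] that ks(3)[rule_format, of "i - Suc k0"] by (auto simp: g_def)
  ultimately show ?case using ks \<open>k0 < k\<close> by (intro exI[of _ "k0 # ks"]) (auto simp: dec_ob_Cons)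
qed

subsection \<open>Inserting a block\<close>

text \<open>Underlying function of \<open>incl_at\<close>, by recursion over the blocks so that it
  can be followed alongside \<open>block\<close> and \<open>dec_fun\<close>;
  \<open>incl_fun_if\<close> links it to the closed form.\<close>

fun incl_fun :: "nat \<Rightarrow> nat \<Rightarrow> nat list \<Rightarrow> nat \<Rightarrow> nat" where
  "incl_fun (Suc j) l (k # ks) i = (if i \<le> k then i else Suc (k + incl_fun j l ks (i - Suc k)))"
| "incl_fun _ l _ i = i + l + 1"

lemma insert_at_simps [simp]:
  "insert_at 0 x xs = x # xs" "insert_at (Suc j) x (y # ys) = y # insert_at j x ys"
  "insert_at j x [] = [x]"
  by (simp_all add: insert_at_def)

lemma length_insert_at [simp]: "length (insert_at j x xs) = Suc (length xs)"
  by (simp add: insert_at_def)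

lemma insert_at_not_Nil [simp]: "insert_at j x xs \<noteq> []"
  by (simp add: insert_at_def)

lemma set_insert_at [simp]: "set (insert_at j x xs) = insert x (set xs)"
  unfolding insert_at_def using set_append[of "take j xs" "drop j xs"] by simp

lemma map_insert_at: "map f (insert_at j x xs) = insert_at j (f x) (map f xs)"
  by (simp add: insert_at_def take_map drop_map)

lemma map2_insert_at: "length xs = length ys \<Longrightarrow>
    map2 f (insert_at j x xs) (insert_at j y ys) = insert_at j (f x y) (map2 f xs ys)"
  by (simp add: insert_at_def take_zip drop_zip take_map drop_map)

lemma insert_at_Hom_pow:
  assumes "fs \<in> Hom (pow_cat C p) xs ys" "f \<in> Hom C x y"
  shows "insert_at j f fs \<in> Hom (pow_cat C (Suc p)) (insert_at j x xs) (insert_at j y ys)"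
  using assms by (auto simp: in_Hom map_insert_at)

lemma dec_ob_insert_at: "ks \<noteq> [] \<Longrightarrow> dec_ob (insert_at j l ks) = Suc (dec_ob ks + l)"
proof (induction ks arbitrary: j)
  case (Cons k ks)
  then show ?case by (cases j; cases "ks = []") (auto simp: dec_ob_Cons)
qed simp

lemma incl_fun_if: "j \<le> length ks \<Longrightarrow>
    incl_fun j l ks i = (if i < sum_list (map Suc (take j ks)) then i else i + l + 1)"
  by (induction j l ks i rule: incl_fun.induct) auto

lemma incl_at_dmap:
  assumes "j \<le> length ks"
  shows "incl_at j l ks = dmap (dec_ob ks) (dec_ob (insert_at j l ks)) (incl_fun j l ks)"
  using incl_fun_if[OF assms] by (simp add: incl_at_def dmap_def fun_eq_iff restrict_def)

lemma dmono_incl_fun: "j \<le> length ks \<Longrightarrow> ks \<noteq> [] \<Longrightarrow> dmono (dec_ob ks) (dec_ob (insert_at j l ks)) (incl_fun j l ks)"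
  by (auto simp: dmono_def dec_ob_insert_at incl_fun_if)

lemma incl_at_Hom: "j \<le> length ks \<Longrightarrow> ks \<noteq> [] \<Longrightarrow>
    incl_at j l ks \<in> Hom Delta (dec_ob ks) (dec_ob (insert_at j l ks))"
  by (simp add: incl_at_dmap dmono_incl_fun)

lemma block_incl_fun: "j \<le> length ks \<Longrightarrow> i \<le> dec_ob ks \<Longrightarrow>
    block (insert_at j l ks) (incl_fun j l ks i) = (if block ks i < j then block ks i else Suc (block ks i))"
  by (induction j l ks i rule: incl_fun.induct) (auto simp: dec_ob_Cons split: if_splits)

lemma dec_fun_insert_at:
  assumes "set fs \<subseteq> Arr Delta" "h \<in> Hom Delta l l'" "j \<le> length fs" "i \<le> dec_ob (map (Dom Delta) fs)"
    "fs \<noteq> []"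
  shows "dec_fun (insert_at j h fs) (incl_fun j l (map (Dom Delta) fs) i) =
     incl_fun j l' (map (Cod Delta) fs) (dec_fun fs i)"
  using assms
proof (induction fs arbitrary: j i)
  case (Cons f fs)
  obtain k n a where f: "f = dmap k n a" "dmono k n a"
    using Cons.prems Arr_in_Hom[of f Delta] by (auto elim!: Hom_Delta_cases)
  have h: "Dom Delta h = l" "Cod Delta h = l'" using assms(2) by (auto simp: in_Hom)
  show ?case
  proof (cases j)
    case 0
    then show ?thesis using f h by (auto simp: in_Hom)
  next
    case (Suc j')
    show ?thesis
    proof (cases "i \<le> k")
      case True
      then show ?thesis using f Suc dmonoD(1)[OF f(2), of i] by simp
    next
      case False
      then have "fs \<noteq> []" "i - Suc k \<le> dec_ob (map (Dom Delta) fs)"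
        using Cons.prems f by (auto simp: dec_ob_Cons split: if_splits)
      then show ?thesis using Cons.IH[of j' "i - Suc k"] Cons.prems f Suc False by simp
    qed
  qed
qed simp

text \<open>Naturality in the inserted block and in the other blocks at once. With identities for
  \<open>fs\<close> it yields the cocone, with an identity for \<open>h\<close> the naturality of
  \<open>can_var\<close>.\<close>

lemma incl_at_natural:
  assumes fs: "fs \<in> Hom (pow_cat Delta p) ks ls" and h: "h \<in> Hom Delta l l'" and "j \<le> p" "p > 0"
  shows "dec_arr (insert_at j h fs) \<odot> incl_at j l ks = incl_at j l' ls \<odot> dec_arr fs"
proof -
  note fs' = Hom_powD[OF fs]
  have ne: "ks \<noteq> []" "ls \<noteq> []" "fs \<noteq> []" using fs' assms(4) by auto
  have le: "j \<le> length ks" "j \<le> length ls" using fs' assms(3) by auto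
  note i = insert_at_Hom_pow[OF fs h, of j]
  show ?thesis
    unfolding incl_at_dmap[OF le(1)] incl_at_dmap[OF le(2)] dec_arr_Hom(2)[OF fs assms(4)]
      dec_arr_Hom(2)[OF i zero_less_Suc] dmap_comp[OF dmono_incl_fun[OF le(1) ne(1)]]
      dmap_comp[OF dec_arr_Hom(3)[OF fs assms(4)]]
    by (rule dmap_cong) (use dec_fun_insert_at[OF _ h] fs' assms(3) ne in simp)
qed

text \<open>Identities on the other blocks leave three zones: before the inserted block, which
  starts at s, inside it, and after it, where positions shift by l' - l. The extra degeneracy below
  is computed from this formula.\<close>

lemma dec_fun_insert_idt:
  assumes "j \<le> length ks" "ks \<noteq> []" "i \<le> dec_ob (insert_at j l ks)" "dmono l l' h"
    "s = sum_list (map Suc (take j ks))"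
  shows "dec_fun (insert_at j (dmap l l' h) (map (Idt Delta) ks)) i =
    (if i < s then i else if i \<le> s + l then s + h (i - s) else i - l + l')"
  using assms
proof (induction ks arbitrary: j i s)
  case (Cons k ks)
  show ?case
  proof (cases j)
    case 0
    then show ?thesis using Cons.prems
      by (auto simp: dec_fun_idt[of _ "k # ks", simplified] dec_ob_Cons split: if_splits)
  next
    case (Suc j')
    show ?thesis
    proof (cases "i \<le> k")
      case True
      then show ?thesis using Suc Cons.prems by (simp add: Idt_Delta)
    next
      case False
      show ?thesis
      proof (cases "ks = []")
        case True
        then show ?thesis using Suc False Cons.prems by (auto simp: Idt_Delta)
      next
        case ne: False
        then show ?thesis using Suc False Cons.prems Cons.IH[of j' "i - Suc k", OF _ ne _ _ refl]
          by (auto simp: Idt_Delta dec_ob_insert_at dec_ob_Cons)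
      qed
    qed
  qed
qed simp

text \<open>An element of a neighbouring block serves as an extra degeneracy, so the colimit is absolute.\<close>

lemma split_insert:
  assumes j: "j \<le> length ks" and ks: "ks \<noteq> []"
  obtains \<rho> where "\<rho> \<in> Hom Delta (dec_ob (insert_at j 0 ks)) (dec_ob ks)"
    "\<rho> \<odot> incl_at j 0 ks = Idt Delta (dec_ob ks)"
    "\<And>l. \<exists>a b t. a \<in> Hom Delta 0 (Suc l) \<and> b \<in> Hom Delta l (Suc l) \<and>
       t \<in> Hom Delta (dec_ob (insert_at j (Suc l) ks)) (dec_ob (insert_at j l ks)) \<and>
       t \<odot> dec_arr (insert_at j a (map (Idt Delta) ks)) = incl_at j l ks \<odot> \<rho> \<and>
       t \<odot> dec_arr (insert_at j b (map (Idt Delta) ks)) = Idt Delta (dec_ob (insert_at j l ks))"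
proof -
  define s where "s = sum_list (map Suc (take j ks))"
  define D where "D = dec_ob ks"
  have D: "dec_ob (insert_at j l ks) = Suc (D + l)" for l using dec_ob_insert_at[OF ks] by (simp add: D_def)
  \<comment> \<open>The inserted block starts no later than after all elements of \<open>ks\<close>,
    whose number is \<open>Suc D\<close>.\<close>
  have s: "s \<le> Suc D"
  proof -
    have "sum_list (map Suc (take j ks)) \<le> sum_list (map Suc (take j ks)) + sum_list (map Suc (drop j ks))" by simp
    also have "\<dots> = sum_list (map Suc ks)" by (metis append_take_drop_id map_append sum_list_append)
    also have "\<dots> = Suc D" unfolding D_def using ks by (induction ks) (auto simp: dec_ob_Cons)
    finally show ?thesis by (simp add: s_def)
  qed
  have incl: "incl_at j l ks = dmap D (Suc (D + l)) (\<lambda>i. if i < s then i else i + l + 1)" for l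
    unfolding incl_at_dmap[OF j] D D_def[symmetric] by (rule dmap_cong) (simp add: incl_fun_if[OF j] s_def)
  have ih: "dmono D (Suc (D + l)) (\<lambda>i. if i < s then i else i + l + 1)" for l
    by (auto simp: dmono_def)
  have ins: "dec_arr (insert_at j h (map (Idt Delta) ks)) = dmap (Suc (D + l)) (Suc (D + l'))
      (\<lambda>i. if i < s then i else if i \<le> s + l then s + dfun h (i - s) else i - l + l')"
    "dmono (Suc (D + l)) (Suc (D + l'))
      (\<lambda>i. if i < s then i else if i \<le> s + l then s + dfun h (i - s) else i - l + l')"
    if h: "h \<in> Hom Delta l l'" for h l l'
  proof -
    note hd = Hom_Delta_dfun[OF h]
    have iks: "map (Idt Delta) ks \<in> Hom (pow_cat Delta (length ks)) ks ks"
      by (simp add: Hom_pow Idt_Delta dmono_id)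
    note H = insert_at_Hom_pow[OF iks h, of j]
    have eq: "dec_arr (insert_at j h (map (Idt Delta) ks)) = dmap (Suc (D + l)) (Suc (D + l'))
      (\<lambda>i. if i < s then i else if i \<le> s + l then s + dfun h (i - s) else i - l + l')"
      unfolding dec_arr_Hom(2)[OF H zero_less_Suc] D
    proof (rule dmap_cong)
      show "dec_fun (insert_at j h (map (Idt Delta) ks)) i =
          (if i < s then i else if i \<le> s + l then s + dfun h (i - s) else i - l + l')" if "i \<le> Suc (D + l)" for i
        using dec_fun_insert_idt[OF j ks _ hd(2) s_def, of i] hd(1)[symmetric] that by (simp add: D)
    qed
    then show "dec_arr (insert_at j h (map (Idt Delta) ks)) = dmap (Suc (D + l)) (Suc (D + l'))
      (\<lambda>i. if i < s then i else if i \<le> s + l then s + dfun h (i - s) else i - l + l')"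
      "dmono (Suc (D + l)) (Suc (D + l'))
      (\<lambda>i. if i < s then i else if i \<le> s + l then s + dfun h (i - s) else i - l + l')"
      using dec_arr_Hom(1)[OF H zero_less_Suc] by (auto simp: D)
  qed
  \<comment> \<open>The inserted point s goes to its left neighbour s - 1. For s = 0 truncated
    subtraction gives 0, so it merges with the element on its right instead.\<close>
  define \<rho> where "\<rho> = dmap (Suc D) D (\<lambda>i. if i < s then i else i - 1)"
  have rm: "dmono (Suc D) D (\<lambda>i. if i < s then i else i - 1)" using s by (auto simp: dmono_def)
  show thesis
  proof (rule that)
    show "\<rho> \<in> Hom Delta (dec_ob (insert_at j 0 ks)) (dec_ob ks)"
      using rm by (simp add: \<rho>_def D D_def[symmetric])
    have "\<rho> \<odot> incl_at j 0 ks = dmap D D (\<lambda>i. i)"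
      unfolding \<rho>_def using incl[of 0] ih[of 0] by (auto simp: dmap_eq_iff)
    then show "\<rho> \<odot> incl_at j 0 ks = Idt Delta (dec_ob ks)" by (simp add: Idt_Delta D_def)
    fix l
    have ir: "incl_at j l ks \<odot> \<rho> = dmap (Suc D) (Suc (D + l))
       (\<lambda>i. if (if i < s then i else i - 1) < s then (if i < s then i else i - 1) else (if i < s then i else i - 1) + l + 1)"
      unfolding incl \<rho>_def using rm by (rule dmap_comp)
    show "\<exists>a b t. a \<in> Hom Delta 0 (Suc l) \<and> b \<in> Hom Delta l (Suc l) \<and>
       t \<in> Hom Delta (dec_ob (insert_at j (Suc l) ks)) (dec_ob (insert_at j l ks)) \<and>
       t \<odot> dec_arr (insert_at j a (map (Idt Delta) ks)) = incl_at j l ks \<odot> \<rho> \<and>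
       t \<odot> dec_arr (insert_at j b (map (Idt Delta) ks)) = Idt Delta (dec_ob (insert_at j l ks))"
    proof (cases "s = 0")
      \<comment> \<open>The block comes first, so a neighbour exists only on the right: t merges the
        last point of [l + 1], which a picks and b omits, with the element following the
        block.\<close>
      case True
      define a where "a = dmap 0 (Suc l) (\<lambda>_. Suc l)"
      define b where "b = dmap l (Suc l) (\<lambda>i. i)"
      define t where "t = dmap (Suc (D + Suc l)) (Suc (D + l)) (\<lambda>i. if i \<le> Suc l then i else i - 1)"
      have ah: "a \<in> Hom Delta 0 (Suc l)" and bh: "b \<in> Hom Delta l (Suc l)"
        by (simp_all add: a_def b_def dmono_def)
      have "dmono (Suc (D + Suc l)) (Suc (D + l)) (\<lambda>i. if i \<le> Suc l then i else i - 1)"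
        by (auto simp: dmono_def)
      then have th: "t \<in> Hom Delta (dec_ob (insert_at j (Suc l) ks)) (dec_ob (insert_at j l ks))"
        by (simp add: t_def D)
      have "t \<odot> dec_arr (insert_at j a (map (Idt Delta) ks)) = incl_at j l ks \<odot> \<rho>"
        unfolding ir t_def ins(1)[OF ah] dmap_comp[OF ins(2)[OF ah]]
        using True by (auto simp: dmap_eq_iff a_def)
      moreover have "t \<odot> dec_arr (insert_at j b (map (Idt Delta) ks)) = Idt Delta (dec_ob (insert_at j l ks))"
        unfolding D Idt_Delta t_def ins(1)[OF bh] dmap_comp[OF ins(2)[OF bh]]
        using True by (auto simp: dmap_eq_iff b_def)
      ultimately show ?thesis using ah bh th by blast
    next
      \<comment> \<open>Here t merges the first point of the block with the element s - 1 on its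
        left; a picks that point and b omits it.\<close>
      case False
      define a where "a = dmap 0 (Suc l) (\<lambda>_. 0)"
      define b where "b = dmap l (Suc l) Suc"
      define t where "t = dmap (Suc (D + Suc l)) (Suc (D + l)) (\<lambda>i. if i < s then i else i - 1)"
      have ah: "a \<in> Hom Delta 0 (Suc l)" and bh: "b \<in> Hom Delta l (Suc l)"
        by (simp_all add: a_def b_def dmono_def)
      have "dmono (Suc (D + Suc l)) (Suc (D + l)) (\<lambda>i. if i < s then i else i - 1)"
        using s by (auto simp: dmono_def)
      then have th: "t \<in> Hom Delta (dec_ob (insert_at j (Suc l) ks)) (dec_ob (insert_at j l ks))"
        by (simp add: t_def D)
      have "t \<odot> dec_arr (insert_at j a (map (Idt Delta) ks)) = incl_at j l ks \<odot> \<rho>"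
        unfolding ir t_def ins(1)[OF ah] dmap_comp[OF ins(2)[OF ah]]
        using False by (auto simp: dmap_eq_iff a_def)
      moreover have "t \<odot> dec_arr (insert_at j b (map (Idt Delta) ks)) = Idt Delta (dec_ob (insert_at j l ks))"
        unfolding D Idt_Delta t_def ins(1)[OF bh] dmap_comp[OF ins(2)[OF bh]]
        by (auto simp: dmap_eq_iff b_def)
      ultimately show ?thesis using ah bh th by blast
    qed
  qed
qed

section \<open>Natural families over the slice of Delta over [n]\<close>

section \<open>The canonical enrichment\<close>

lemma sfn_Hom: "is_functor Dop C X \<Longrightarrow> \<alpha> \<in> Hom Delta k n \<Longrightarrow> FAr X \<alpha> \<in> Hom C (FOb X n) (FOb X k)"
  using is_functor_Hom[of Dop C X \<alpha> n k] by simp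

lemma sfn_comp: "is_functor Dop C X \<Longrightarrow> \<alpha> \<in> Hom Delta k m \<Longrightarrow> \<beta> \<in> Hom Delta m n \<Longrightarrow>
    FAr X (\<beta> \<odot> \<alpha>) = FAr X \<alpha> \<cdot>\<^bsub>C\<^esub> FAr X \<beta>"
  using is_functor_Comp[of Dop C X \<beta> n m \<alpha> k] by simp

lemma sfn_idt: "is_functor Dop C X \<Longrightarrow> FAr X (Idt Delta k) = Idt C (FOb X k)"
  using is_functor_Idt[of Dop C X k] by simp

lemma sfn_Ob: "is_functor Dop C X \<Longrightarrow> FOb X k \<in> Obj C"
  using is_functor_Ob[of Dop C X k] by simp

text \<open>The predicate S cuts out a part of the slice over [n], and naturality is demanded only
  inside it. With S always true this describes the end; with S surjectivity it describes the
  n-simplices of Hom_F.\<close>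

definition nat_family ::
  "('o, 'a) cat \<Rightarrow> ('o, 'a) sfn \<Rightarrow> ('o, 'a) sfn \<Rightarrow> nat \<Rightarrow> (darr \<Rightarrow> bool) \<Rightarrow> (nat \<Rightarrow> darr \<Rightarrow> 'a) \<Rightarrow> bool" where
  "nat_family C X Y n S e \<longleftrightarrow>
     (\<forall>k. \<forall>\<sigma>\<in>Hom Delta k n. S \<sigma> \<longrightarrow> e k \<sigma> \<in> Hom C (FOb X k) (FOb Y k)) \<and>
     (\<forall>k l. \<forall>g\<in>Hom Delta k l. \<forall>\<sigma>\<in>Hom Delta l n. S \<sigma> \<longrightarrow> S (\<sigma> \<odot> g) \<longrightarrow>
        FAr Y g \<cdot>\<^bsub>C\<^esub> e l \<sigma> = e k (\<sigma> \<odot> g) \<cdot>\<^bsub>C\<^esub> FAr X g)"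

lemma nat_family_Hom:
  "nat_family C X Y n S e \<Longrightarrow> \<sigma> \<in> Hom Delta k n \<Longrightarrow> S \<sigma> \<Longrightarrow> e k \<sigma> \<in> Hom C (FOb X k) (FOb Y k)"
  unfolding nat_family_def by blast

lemma nat_family_nat:
  "nat_family C X Y n S e \<Longrightarrow> g \<in> Hom Delta k l \<Longrightarrow> \<sigma> \<in> Hom Delta l n \<Longrightarrow> \<sigma> \<odot> g = \<tau> \<Longrightarrow>
    S \<sigma> \<Longrightarrow> S \<tau> \<Longrightarrow> FAr Y g \<cdot>\<^bsub>C\<^esub> e l \<sigma> = e k \<tau> \<cdot>\<^bsub>C\<^esub> FAr X g"
  unfolding nat_family_def by blast

abbreviation all_family ::
  "('o, 'a) cat \<Rightarrow> ('o, 'a) sfn \<Rightarrow> ('o, 'a) sfn \<Rightarrow> nat \<Rightarrow> (nat \<Rightarrow> darr \<Rightarrow> 'a) \<Rightarrow> bool" where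
  "all_family C X Y n e \<equiv> nat_family C X Y n (\<lambda>_. True) e"

lemma simp_cat_simps [simp]:
  "Obj (simp_cat C) = {X. is_functor Dop C X}"
  "Hom (simp_cat C) X Y = Hom (fun_cat Dop C) X Y"
  by (simp_all add: simp_cat_def)

context category
begin

text \<open>The wedge condition carries identities of \<open>Delta\<close> in the other variable;
  once they are removed it is naturality along g at each \<sigma>.\<close>

lemma canonical_EHom:
  assumes X: "is_functor Dop C X" and Y: "is_functor Dop C Y"
  shows "e \<in> EHom (canonical_enrichment C) X Y n \<longleftrightarrow>
    (\<forall>k. e k \<in> extensional (Hom Delta k n)) \<and> all_family C X Y n e"
    (is "?L \<longleftrightarrow> ?E \<and> ?N")
proof -
  have nat_iff: "((\<lambda>\<sigma>\<in>Hom Delta l n. FAr Y (Idt Delta k) \<cdot> e k (\<sigma> \<odot> g) \<cdot> FAr X g) =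
      (\<lambda>\<sigma>\<in>Hom Delta l n. FAr Y g \<cdot> e l (\<sigma> \<odot> Idt Delta l) \<cdot> FAr X (Idt Delta l))) \<longleftrightarrow>
     (\<forall>\<sigma>\<in>Hom Delta l n. FAr Y g \<cdot> e l \<sigma> = e k (\<sigma> \<odot> g) \<cdot> FAr X g)" (is "?l = ?r \<longleftrightarrow> ?P")
    if g: "g \<in> Hom Delta k l" and e: "\<And>k \<sigma>. \<sigma> \<in> Hom Delta k n \<Longrightarrow> e k \<sigma> \<in> Hom C (FOb X k) (FOb Y k)"
    for k l g
  proof -
    have 1: "FAr Y (Idt Delta k) \<cdot> e k (\<sigma> \<odot> g) = e k (\<sigma> \<odot> g)" if "\<sigma> \<in> Hom Delta l n" for \<sigma>
      using comp_idt_left[OF e[OF Delta.comp_hom[OF g that]]] by (simp add: sfn_idt[OF Y])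
    have 2: "FAr Y g \<cdot> e l (\<sigma> \<odot> Idt Delta l) \<cdot> FAr X (Idt Delta l) = FAr Y g \<cdot> e l \<sigma>"
      if "\<sigma> \<in> Hom Delta l n" for \<sigma>
      using comp_idt_right[OF comp_hom[OF e[OF that] sfn_Hom[OF Y g]]]
      by (simp add: sfn_idt[OF X] Delta.comp_idt_right[OF that])
    show ?thesis using 1 2 by (auto simp: restrict_def fun_eq_iff)
  qed
  have "?L \<longleftrightarrow> e \<in> (\<Pi>\<^sub>E k\<in>UNIV. Hom Delta k n \<rightarrow>\<^sub>E Hom C (FOb X k) (FOb Y k)) \<and>
    (\<forall>k l. \<forall>g\<in>Hom Delta k l.
      (\<lambda>\<sigma>\<in>Hom Delta l n. FAr Y (Idt Delta k) \<cdot> e k (\<sigma> \<odot> g) \<cdot> FAr X g) =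
      (\<lambda>\<sigma>\<in>Hom Delta l n. FAr Y g \<cdot> e l (\<sigma> \<odot> Idt Delta l) \<cdot> FAr X (Idt Delta l)))"
  proof -
    have all: "(\<forall>f\<in>Arr Delta. P (Dom Delta f) (Cod Delta f) f) \<longleftrightarrow> (\<forall>k l. \<forall>g\<in>Hom Delta k l. P k l g)" for P
      unfolding in_Hom Ball_def by blast
    have dc: "Dom Delta (Idt Delta k) = k" "Cod Delta (Idt Delta k) = k" for k by (simp_all add: Idt_Delta)
    show ?thesis unfolding canonical_enrichment_def set_end_def all[symmetric] by (simp add: dc)
  qed
  also have "\<dots> \<longleftrightarrow> ?E \<and> ?N"
  proof (cases "e \<in> (\<Pi>\<^sub>E k\<in>UNIV. Hom Delta k n \<rightarrow>\<^sub>E Hom C (FOb X k) (FOb Y k))")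
    case True
    then have "e k \<sigma> \<in> Hom C (FOb X k) (FOb Y k)" if "\<sigma> \<in> Hom Delta k n" for k \<sigma>
      using that by blast
    then show ?thesis using True nat_iff unfolding nat_family_def by (auto simp: PiE_def)
  next
    case False
    then show ?thesis unfolding nat_family_def by (auto simp: PiE_def)
  qed
  finally show ?thesis .
qed

lemma canonical_eqI:
  assumes "is_functor Dop C X" "is_functor Dop C Y"
    and "e \<in> EHom (canonical_enrichment C) X Y n" "e' \<in> EHom (canonical_enrichment C) X Y n"
    and "\<And>k \<sigma>. \<sigma> \<in> Hom Delta k n \<Longrightarrow> e k \<sigma> = e' k \<sigma>"
  shows "e = e'"
proof
  show "e k = e' k" for k
    using assms by (intro extensionalityI[of _ "Hom Delta k n"]) (auto simp: canonical_EHom)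
qed

lemma canonical_simps:
  "EAct (canonical_enrichment C) X Y \<alpha> e = (\<lambda>k. \<lambda>\<sigma>\<in>Hom Delta k (Dom Delta \<alpha>). e k (\<alpha> \<odot> \<sigma>))"
  "EComp (canonical_enrichment C) X Y Z n e' e = (\<lambda>k. \<lambda>\<sigma>\<in>Hom Delta k n. e' k \<sigma> \<cdot> e k \<sigma>)"
  "EIdt (canonical_enrichment C) X n = (\<lambda>k. \<lambda>\<sigma>\<in>Hom Delta k n. Idt C (FOb X k))"
  "EUnd (canonical_enrichment C) X Y u = (\<lambda>k. \<lambda>\<sigma>\<in>Hom Delta k 0. App u k)"
  by (simp_all add: canonical_enrichment_def fun_eq_iff)

lemma all_family_act:
  assumes "all_family C X Y m e" "\<alpha> \<in> Hom Delta n m"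
  shows "all_family C X Y n (\<lambda>k. \<lambda>\<sigma>\<in>Hom Delta k n. e k (\<alpha> \<odot> \<sigma>))"
  unfolding nat_family_def
proof (intro conjI allI ballI impI)
  fix k \<sigma> assume "\<sigma> \<in> Hom Delta k n"
  then show "(\<lambda>\<sigma>\<in>Hom Delta k n. e k (\<alpha> \<odot> \<sigma>)) \<sigma> \<in> Hom C (FOb X k) (FOb Y k)"
    using nat_family_Hom[OF assms(1) Delta.comp_hom[OF _ assms(2)]] by simp
next
  fix k l g \<sigma> assume g: "g \<in> Hom Delta k l" and s: "\<sigma> \<in> Hom Delta l n"
  then show "FAr Y g \<cdot> (\<lambda>\<sigma>\<in>Hom Delta l n. e l (\<alpha> \<odot> \<sigma>)) \<sigma> =
      (\<lambda>\<sigma>\<in>Hom Delta k n. e k (\<alpha> \<odot> \<sigma>)) (\<sigma> \<odot> g) \<cdot> FAr X g"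
    using nat_family_nat[OF assms(1) g Delta.comp_hom[OF s assms(2)] Delta.comp_assoc[OF g s assms(2)]]
      Delta.comp_hom[OF g s] by simp
qed

lemma all_family_comp:
  assumes "is_functor Dop C X" "is_functor Dop C Y" "is_functor Dop C Z"
    and e: "all_family C X Y n e" and e': "all_family C Y Z n e'"
  shows "all_family C X Z n (\<lambda>k. \<lambda>\<sigma>\<in>Hom Delta k n. e' k \<sigma> \<cdot> e k \<sigma>)"
  unfolding nat_family_def
proof (intro conjI allI ballI impI)
  fix k \<sigma> assume "\<sigma> \<in> Hom Delta k n"
  then show "(\<lambda>\<sigma>\<in>Hom Delta k n. e' k \<sigma> \<cdot> e k \<sigma>) \<sigma> \<in> Hom C (FOb X k) (FOb Z k)"
    using comp_hom[OF nat_family_Hom[OF e] nat_family_Hom[OF e']] by simp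
next
  fix k l g \<sigma> assume g: "g \<in> Hom Delta k l" and s: "\<sigma> \<in> Hom Delta l n"
  note sg = Delta.comp_hom[OF g s]
  note h = sfn_Hom[OF assms(1) g] sfn_Hom[OF assms(2) g] sfn_Hom[OF assms(3) g]
  note eh = nat_family_Hom[OF e s] nat_family_Hom[OF e sg] nat_family_Hom[OF e' s] nat_family_Hom[OF e' sg]
  note n = nat_family_nat[OF e g s refl] nat_family_nat[OF e' g s refl]
  have "FAr Z g \<cdot> (e' l \<sigma> \<cdot> e l \<sigma>) = e' k (\<sigma> \<odot> g) \<cdot> FAr Y g \<cdot> e l \<sigma>"
    using comp_assoc[OF eh(1) eh(3) h(3)] n by simp
  also have "\<dots> = e' k (\<sigma> \<odot> g) \<cdot> e k (\<sigma> \<odot> g) \<cdot> FAr X g"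
    using comp_assoc[OF eh(1) h(2) eh(4)] comp_assoc[OF h(1) eh(2) eh(4)] n by simp
  finally show "FAr Z g \<cdot> (\<lambda>\<sigma>\<in>Hom Delta l n. e' l \<sigma> \<cdot> e l \<sigma>) \<sigma> =
      (\<lambda>\<sigma>\<in>Hom Delta k n. e' k \<sigma> \<cdot> e k \<sigma>) (\<sigma> \<odot> g) \<cdot> FAr X g"
    using sg s by simp
qed

lemma all_family_idt:
  assumes "is_functor Dop C X"
  shows "all_family C X X n (\<lambda>k. \<lambda>\<sigma>\<in>Hom Delta k n. Idt C (FOb X k))"
  unfolding nat_family_def
  using comp_idt_left[OF sfn_Hom[OF assms]] comp_idt_right[OF sfn_Hom[OF assms]] Delta.comp_hom
  by (auto simp: idt_hom[OF sfn_Ob[OF assms]])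

lemma Hom_Delta_0: "\<sigma> \<in> Hom Delta k 0 \<longleftrightarrow> \<sigma> = dmap k 0 (\<lambda>_. 0)"
  by (auto elim!: Hom_Delta_cases intro!: dmap_cong simp: dmono_def)

lemma all_family_und:
  assumes u: "u \<in> Hom (fun_cat Dop C) X Y"
  shows "all_family C X Y 0 (\<lambda>k. \<lambda>\<sigma>\<in>Hom Delta k 0. App u k)"
  unfolding nat_family_def
proof (intro conjI allI ballI impI)
  fix k l g \<sigma> assume g: "g \<in> Hom Delta k l" and s: "\<sigma> \<in> Hom Delta l 0"
  then show "FAr Y g \<cdot> (\<lambda>\<sigma>\<in>Hom Delta l 0. App u l) \<sigma> =
      (\<lambda>\<sigma>\<in>Hom Delta k 0. App u k) (\<sigma> \<odot> g) \<cdot> FAr X g"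
    using Hom_fun_nat[OF u, of g l k] Delta.comp_hom[OF g s] by simp
qed (use Hom_fun_App[OF u] in simp)

text \<open>As [0] is terminal, there is exactly one \<sigma> for each k, and a 0-simplex is an
  ordinary transformation.\<close>

lemma canonical_und_bij:
  assumes X: "is_functor Dop C X" and Y: "is_functor Dop C Y"
  shows "bij_betw (EUnd (canonical_enrichment C) X Y) (Hom (simp_cat C) X Y)
    (EHom (canonical_enrichment C) X Y 0)"
proof -
  let ?s = "\<lambda>k. dmap k 0 (\<lambda>_. 0)"
  have s: "?s k \<in> Hom Delta k 0" for k by (simp add: dmono_def)
  define inv where "inv e = \<lparr>Src = X, Tgt = Y, App = (\<lambda>k. e k (?s k))\<rparr>" for e :: "nat \<Rightarrow> darr \<Rightarrow> 'a"
  have inv: "inv e \<in> Hom (fun_cat Dop C) X Y" if "e \<in> EHom (canonical_enrichment C) X Y 0" for e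
  proof (rule Hom_funI, goal_cases)
    case (6 k)
    then show ?case using that nat_family_Hom[OF _ s, of C X Y "\<lambda>_. True" e k] by (simp add: canonical_EHom[OF X Y] inv_def)
  next
    case (7 g l k)
    then have g: "g \<in> Hom Delta k l" by simp
    show ?case
      using that nat_family_nat[OF _ g s, of C X Y "\<lambda>_. True" e] Delta.comp_hom[OF g s]
      unfolding Hom_Delta_0
      by (simp add: canonical_EHom[OF X Y] inv_def)
  qed (use X Y in \<open>auto simp: inv_def\<close>)
  show ?thesis
  proof (rule bij_betw_byWitness[where f' = inv])
    show "\<forall>u\<in>Hom (simp_cat C) X Y. inv (EUnd (canonical_enrichment C) X Y u) = u"
      by (auto simp: inv_def canonical_simps Hom_fun dmono_def)
    show "\<forall>e\<in>EHom (canonical_enrichment C) X Y 0. EUnd (canonical_enrichment C) X Y (inv e) = e"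
    proof
      fix e assume e: "e \<in> EHom (canonical_enrichment C) X Y 0"
      show "EUnd (canonical_enrichment C) X Y (inv e) = e"
        by (rule canonical_eqI[OF X Y _ e])
          (use all_family_und[OF inv[OF e]] in
            \<open>auto simp: canonical_simps canonical_EHom[OF X Y] Hom_Delta_0 inv_def\<close>)
    qed
    show "EUnd (canonical_enrichment C) X Y ` Hom (simp_cat C) X Y \<subseteq> EHom (canonical_enrichment C) X Y 0"
      using all_family_und by (auto simp: canonical_EHom[OF X Y] canonical_simps)
    show "inv ` EHom (canonical_enrichment C) X Y 0 \<subseteq> Hom (simp_cat C) X Y"
      using inv by auto
  qed
qed

lemma canonical_act_closed:
  assumes "is_functor Dop C X" "is_functor Dop C Y" "\<alpha> \<in> Hom Delta n m"
    "e \<in> EHom (canonical_enrichment C) X Y m"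
  shows "EAct (canonical_enrichment C) X Y \<alpha> e \<in> EHom (canonical_enrichment C) X Y n"
  using assms all_family_act[OF _ assms(3)] by (auto simp: canonical_EHom canonical_simps in_Hom)

lemma canonical_comp_closed:
  assumes "is_functor Dop C X" "is_functor Dop C Y" "is_functor Dop C Z"
    "e \<in> EHom (canonical_enrichment C) X Y n" "e' \<in> EHom (canonical_enrichment C) Y Z n"
  shows "EComp (canonical_enrichment C) X Y Z n e' e \<in> EHom (canonical_enrichment C) X Z n"
  using assms all_family_comp[OF assms(1-3)] by (auto simp: canonical_EHom canonical_simps)

lemma canonical_Hom:
  "\<lbrakk>is_functor Dop C X; is_functor Dop C Y; e \<in> EHom (canonical_enrichment C) X Y n;
    \<sigma> \<in> Hom Delta k n\<rbrakk> \<Longrightarrow> e k \<sigma> \<in> Hom C (FOb X k) (FOb Y k)"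
  using canonical_EHom nat_family_Hom by blast

text \<open>All operations work on the components \<open>e k \<sigma>\<close> separately and
  \<alpha> acts by composing \<sigma> with \<alpha>, so the axioms reduce to those of C and
  \<open>Delta\<close>.\<close>

lemma simplicial_enrichment_canonical: "simplicial_enrichment (simp_cat C) (canonical_enrichment C)"
proof -
  interpret D: category "simp_cat C"
    unfolding simp_cat_def by (rule category_fun_cat[OF category_Dop category_axioms])
  show ?thesis
  proof (unfold_locales, unfold simp_cat_simps mem_Collect_eq, goal_cases)
    case (1 X Y \<alpha> n m f)
    then show ?case by (rule canonical_act_closed)
  next
    case (2 X Y f n)
    show ?case
      by (rule canonical_eqI[OF 2(1,2) canonical_act_closed[OF 2(1,2) Delta.idt_hom 2(3)] 2(3)])
        (simp_all add: canonical_simps Delta.comp_idt_left Delta.idt_hom[unfolded in_Hom])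
  next
    case (3 X Y \<alpha> n m \<beta> q f)
    show ?case
      by (rule canonical_eqI[OF 3(1,2) canonical_act_closed[OF 3(1,2) Delta.comp_hom[OF 3(3,4)] 3(5)]
          canonical_act_closed[OF 3(1-3) canonical_act_closed[OF 3(1,2,4,5)]]])
       (use 3(3,4) Delta.comp_hom[OF 3(3,4)] Delta.comp_hom[OF _ 3(3)] Delta.comp_assoc[OF _ 3(3,4)]
        in \<open>auto simp: canonical_simps in_Hom\<close>)
  next
    case (4 X Y Z f n g)
    then show ?case by (rule canonical_comp_closed)
  next
    case (5 X Y Z \<alpha> n m f g)
    then show ?case using Delta.comp_hom[OF _ 5(4)]
      by (auto simp: canonical_simps in_Hom fun_eq_iff restrict_def)
  next
    case (6 X Y Z W f n g h)
    then show ?case using comp_assoc[OF canonical_Hom canonical_Hom canonical_Hom]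
      by (auto simp: canonical_simps fun_eq_iff restrict_def)
  next
    case (7 X n)
    then show ?case using all_family_idt by (auto simp: canonical_EHom canonical_simps)
  next
    case (8 X \<alpha> n m)
    then show ?case using Delta.comp_hom[OF _ 8(2)]
      by (auto simp: canonical_simps in_Hom fun_eq_iff restrict_def)
  next
    case (9 X Y f n)
    show ?case
      by (rule canonical_eqI[OF 9(1,2) canonical_comp_closed[OF 9(1,2,2,3)] 9(3)])
        (use 9 all_family_idt[OF 9(2)] comp_idt_left[OF canonical_Hom[OF 9]]
          in \<open>auto simp: canonical_simps canonical_EHom\<close>)
  next
    case (10 X Y f n)
    show ?case
      by (rule canonical_eqI[OF 10(1,2) canonical_comp_closed[OF 10(1,1,2) _ 10(3)] 10(3)])
        (use 10 all_family_idt[OF 10(1)] comp_idt_right[OF canonical_Hom[OF 10]]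
          in \<open>auto simp: canonical_simps canonical_EHom\<close>)
  next
    case (11 X Y)
    then show ?case using canonical_und_bij by simp
  next
    case (12 X)
    then show ?case by (simp add: canonical_simps simp_cat_def)
  next
    case (13 X Y Z u v)
    then show ?case by (auto simp: canonical_simps simp_cat_def fun_eq_iff restrict_def)
  qed
qed

end

section \<open>Adding points to fibres, and extension of families from surjections\<close>

section \<open>Families are determined by surjections\<close>

definition face :: "nat \<Rightarrow> nat \<Rightarrow> darr" where
  "face s k = dmap k (Suc k) (\<lambda>i. if i < s then i else Suc i)"

text \<open>For s > 0 it merges s - 1 and s; for s = 0 truncated subtraction makes it merge 0 and 1.
  Thus it retracts \<open>face s k\<close> at every position s from 0 to k + 1.\<close>

definition degen :: "nat \<Rightarrow> nat \<Rightarrow> darr" where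
  "degen s k = dmap (Suc k) k (\<lambda>i. if i < s then i else i - 1)"

text \<open>By monotonicity this count is the position just after the fibre over j. Counting all
  elements of value at most j keeps it meaningful when the fibre is empty.\<close>

definition fib_end :: "nat \<Rightarrow> darr \<Rightarrow> nat" where
  "fib_end j \<sigma> = card {i. i \<le> Dom Delta \<sigma> \<and> dfun \<sigma> i \<le> j}"

text \<open>\<open>add_pt j \<sigma>\<close> has an additional element at the end of the fibre over \<open>j\<close>.\<close>

definition add_pt :: "nat \<Rightarrow> darr \<Rightarrow> darr" where
  "add_pt j \<sigma> = dmap (Suc (Dom Delta \<sigma>)) (Cod Delta \<sigma>)
     (\<lambda>i. if i < fib_end j \<sigma> then dfun \<sigma> i else if i = fib_end j \<sigma> then j else dfun \<sigma> (i - 1))"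

lemma fib_end_le: "fib_end j \<sigma> \<le> Suc (Dom Delta \<sigma>)"
proof -
  have "card {i. i \<le> Dom Delta \<sigma> \<and> dfun \<sigma> i \<le> j} \<le> card {..Dom Delta \<sigma>}"
    by (rule card_mono) auto
  then show ?thesis by (simp add: fib_end_def)
qed

text \<open>By monotonicity the elements of value at most j form an initial segment, and its
  cardinality separates members from non-members.\<close>

lemma less_fib_end:
  assumes "\<sigma> \<in> Hom Delta k n" "i \<le> k"
  shows "i < fib_end j \<sigma> \<longleftrightarrow> dfun \<sigma> i \<le> j"
proof -
  have mono: "dmono k n (dfun \<sigma>)" by (rule Hom_Delta_dfun[OF assms(1)])
  have k: "Dom Delta \<sigma> = k" using assms by (simp add: in_Hom)
  show ?thesis
  proof
    assume "dfun \<sigma> i \<le> j"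
    then have "{..i} \<subseteq> {i. i \<le> k \<and> dfun \<sigma> i \<le> j}"
      using assms(2) by (auto intro: order_trans[OF dmonoD(2)[OF mono]])
    then have "card {..i} \<le> fib_end j \<sigma>" unfolding fib_end_def k by (intro card_mono) auto
    then show "i < fib_end j \<sigma>" by simp
  next
    assume l: "i < fib_end j \<sigma>"
    show "dfun \<sigma> i \<le> j"
    proof (rule ccontr)
      assume n: "\<not> dfun \<sigma> i \<le> j"
      have "{i. i \<le> k \<and> dfun \<sigma> i \<le> j} \<subseteq> {..<i}"
      proof
        fix x assume "x \<in> {i. i \<le> k \<and> dfun \<sigma> i \<le> j}"
        then show "x \<in> {..<i}" using n dmonoD(2)[OF mono, of i x] by force
      qed
      then have "fib_end j \<sigma> \<le> card {..<i}" unfolding fib_end_def k by (intro card_mono) auto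
      then show False using l by simp
    qed
  qed
qed

lemma face_Hom: "face s k \<in> Hom Delta k (Suc k)"
  by (simp add: face_def) (auto simp: dmono_def)

lemma degen_Hom: "s \<le> Suc k \<Longrightarrow> degen s k \<in> Hom Delta (Suc k) k"
  by (simp add: degen_def) (auto simp: dmono_def)

lemma degen_face: "s \<le> Suc k \<Longrightarrow> degen s k \<odot> face s k = Idt Delta k"
  using face_Hom[of s k] unfolding degen_def face_def Idt_Delta
  by (subst dmap_comp) (auto intro!: dmap_cong)

lemma add_pt_Hom:
  assumes s: "\<sigma> \<in> Hom Delta k n" and j: "j \<le> n"
  shows "add_pt j \<sigma> \<in> Hom Delta (Suc k) n"
proof -
  have mono: "dmono k n (dfun \<sigma>)" by (rule Hom_Delta_dfun[OF s])
  have k: "Dom Delta \<sigma> = k" "Cod Delta \<sigma> = n" using s by (auto simp: in_Hom)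
  have 1: "dfun \<sigma> i \<le> j" if "i < fib_end j \<sigma>" for i
    using less_fib_end[OF s, of i j] that fib_end_le[of j \<sigma>] k by simp
  have 2: "\<not> dfun \<sigma> i \<le> j" if "\<not> i < fib_end j \<sigma>" "i \<le> k" for i
    using less_fib_end[OF s, of i j] that by simp
  show ?thesis unfolding add_pt_def k dmap_Hom dmono_def
  proof (intro conjI refl allI impI)
    fix i i'
    show "i \<le> Suc k \<Longrightarrow> (if i < fib_end j \<sigma> then dfun \<sigma> i else if i = fib_end j \<sigma> then j else dfun \<sigma> (i - 1)) \<le> n"
      using 1[of i] j dmonoD(1)[OF mono, of "i - 1"] by auto
    assume i: "i \<le> i'" "i' \<le> Suc k"
    let ?f = "\<lambda>i. if i < fib_end j \<sigma> then dfun \<sigma> i else if i = fib_end j \<sigma> then j else dfun \<sigma> (i - 1)"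
    have lo: "?f i \<le> j" if "i \<le> fib_end j \<sigma>" for i using 1 that by auto
    have hi: "j \<le> ?f i" if "fib_end j \<sigma> \<le> i" "i \<le> Suc k" for i
    proof (cases "i = fib_end j \<sigma>")
      case False
      then have "\<not> i - 1 < fib_end j \<sigma>" "i - 1 \<le> k" using that by linarith+
      then show ?thesis using 2[of "i - 1"] that False by simp
    qed simp
    consider "i' < fib_end j \<sigma>" | "i \<le> fib_end j \<sigma>" "fib_end j \<sigma> \<le> i'" | "fib_end j \<sigma> < i" by linarith
    then show "?f i \<le> ?f i'"
    proof cases
      case 1
      then show ?thesis using i dmonoD(2)[OF mono, of i i'] fib_end_le[of j \<sigma>] k by simp
    next
      case 2
      then show ?thesis using lo[of i] hi[of i'] i order_trans by blast
    next
      case 3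
      then show ?thesis using i dmonoD(2)[OF mono, of "i - 1" "i' - 1"] by simp
    qed
  qed
qed

lemma add_pt_face:
  assumes s: "\<sigma> \<in> Hom Delta k n"
  shows "add_pt j \<sigma> \<odot> face (fib_end j \<sigma>) k = \<sigma>"
proof -
  have k: "Dom Delta \<sigma> = k" "Cod Delta \<sigma> = n" using s by (auto simp: in_Hom)
  have "add_pt j \<sigma> \<odot> face (fib_end j \<sigma>) k = dmap k n (dfun \<sigma>)"
    using face_Hom[of "fib_end j \<sigma>" k] unfolding add_pt_def face_def k
    by (subst dmap_comp) (auto intro!: dmap_cong)
  then show ?thesis using Hom_Delta_dfun(1)[OF s] by simp
qed

text \<open>Adding a point is functorial over [n]: g' is g on the old elements and sends the added
  point to the added point.\<close>

lemma add_pt_natural: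
  assumes g: "g \<in> Hom Delta k l" and s: "\<sigma> \<in> Hom Delta l n" and t: "\<sigma> \<odot> g = \<tau>"
  obtains g' where "g' \<in> Hom Delta (Suc k) (Suc l)" "add_pt j \<sigma> \<odot> g' = add_pt j \<tau>"
    "g' \<odot> face (fib_end j \<tau>) k = face (fib_end j \<sigma>) l \<odot> g"
proof -
  note gd = Hom_Delta_dfun[OF g] and sd = Hom_Delta_dfun[OF s]
  have th: "\<tau> \<in> Hom Delta k n" using Delta.comp_hom[OF g s] t by simp
  have "\<tau> = dmap k n (\<lambda>i. dfun \<sigma> (dfun g i))"
    using t gd sd dmap_comp[OF gd(2), of n "dfun \<sigma>"] by simp
  then have td: "dfun \<tau> i = dfun \<sigma> (dfun g i)" if "i \<le> k" for i using that by simp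
  have dc: "Dom Delta \<sigma> = l" "Cod Delta \<sigma> = n" "Dom Delta \<tau> = k" "Cod Delta \<tau> = n"
    using s th by (auto simp: in_Hom)
  define a where "a = fib_end j \<sigma>"
  define b where "b = fib_end j \<tau>"
  have le: "a \<le> Suc l" "b \<le> Suc k"
    using fib_end_le[of j \<sigma>] fib_end_le[of j \<tau>] by (simp_all add: a_def b_def dc)
  \<comment> \<open>Both sides say that \<tau> has value at most j at i, so g respects the cuts at
    which the points are added.\<close>
  have ab: "dfun g i < a \<longleftrightarrow> i < b" if "i \<le> k" for i
    unfolding a_def b_def less_fib_end[OF s dmonoD(1)[OF gd(2) that]] less_fib_end[OF th that] td[OF that] ..
  define h where "h i = (if i < b then dfun g i else if i = b then a else Suc (dfun g (i - 1)))" for i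
  have h: "dmono (Suc k) (Suc l) h"
    unfolding dmono_def
  proof (intro conjI allI impI)
    fix i i'
    show "i \<le> Suc k \<Longrightarrow> h i \<le> Suc l"
      using dmonoD(1)[OF gd(2), of i] dmonoD(1)[OF gd(2), of "i - 1"] le by (auto simp: h_def)
    assume i: "i \<le> i'" "i' \<le> Suc k"
    have hi: "a \<le> h i'" if "b \<le> i'"
    proof (cases "i' = b")
      case False
      then have "\<not> i' - 1 < b" "i' - 1 \<le> k" using that i by linarith+
      then show ?thesis using ab[of "i' - 1"] that False by (simp add: h_def)
    qed (simp add: h_def)
    consider "i' < b" | "i < b" "b \<le> i'" | "b \<le> i" by linarith
    then show "h i \<le> h i'"
    proof cases
      case 1
      then show ?thesis using i dmonoD(2)[OF gd(2), of i i'] le by (simp add: h_def)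
    next
      case 2
      then have "h i < a" using ab[of i] i le by (simp add: h_def)
      then show ?thesis using hi 2 by simp
    next
      case 3
      then show ?thesis using hi i dmonoD(2)[OF gd(2), of "i - 1" "i' - 1"] by (auto simp: h_def)
    qed
  qed
  show thesis
  proof
    show "dmap (Suc k) (Suc l) h \<in> Hom Delta (Suc k) (Suc l)" using h by simp
    show "add_pt j \<sigma> \<odot> dmap (Suc k) (Suc l) h = add_pt j \<tau>"
      unfolding add_pt_def dc dmap_comp[OF h] a_def[symmetric] b_def[symmetric]
    proof (rule dmap_cong)
      fix i assume i: "i \<le> Suc k"
      show "(if h i < a then dfun \<sigma> (h i) else if h i = a then j else dfun \<sigma> (h i - 1)) =
         (if i < b then dfun \<tau> i else if i = b then j else dfun \<tau> (i - 1))"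
      proof (cases "i \<le> b")
        case True
        then show ?thesis using i le ab[of i] td[of i] by (auto simp: h_def)
      next
        case False
        then have "\<not> i - 1 < b" "i - 1 \<le> k" using i by linarith+
        then show ?thesis using False ab[of "i - 1"] td[of "i - 1"] by (simp add: h_def)
      qed
    qed
    have "dmap (Suc k) (Suc l) h \<odot> face b k =
        dmap k (Suc l) (\<lambda>i. h (if i < b then i else Suc i))"
      using face_Hom[of b k] unfolding face_def by (subst dmap_comp) auto
    moreover have "face a l \<odot> g = dmap k (Suc l) (\<lambda>i. if dfun g i < a then dfun g i else Suc (dfun g i))"
      unfolding face_def using dmap_comp[OF gd(2)] gd(1)[symmetric] by simp
    ultimately show "dmap (Suc k) (Suc l) h \<odot> face (fib_end j \<tau>) k = face (fib_end j \<sigma>) l \<odot> g"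
      using ab by (auto simp: a_def[symmetric] b_def[symmetric] h_def dmap_eq_iff)
  qed
qed

text \<open>
  Although \<open>face s k \<cdot> degen s k\<close> is not a map over \<open>[n]\<close>, it becomes one up to the retraction \<open>t\<close>.
\<close>

lemma add_pt_homotopy:
  assumes s: "\<sigma> \<in> Hom Delta k n" and j: "j \<le> n" and a: "a = fib_end j \<sigma>"
  obtains u v t \<omega> where "u \<in> Hom Delta (Suc k) (Suc (Suc k))" "v \<in> Hom Delta (Suc k) (Suc (Suc k))"
    "t \<in> Hom Delta (Suc (Suc k)) (Suc k)" "\<omega> = add_pt j (add_pt j \<sigma>)"
    "\<omega> \<odot> u = add_pt j \<sigma>" "\<omega> \<odot> v = add_pt j \<sigma>"
    "u \<odot> face a k = v \<odot> face a k"
    "t \<odot> u = face a k \<odot> degen a k" "t \<odot> v = Idt Delta (Suc k)"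
proof -
  note ah = add_pt_Hom[OF s j]
  note sd = Hom_Delta_dfun[OF s] Hom_Delta_dfun[OF ah]
  have dc: "Dom Delta \<sigma> = k" "Cod Delta \<sigma> = n" "Dom Delta (add_pt j \<sigma>) = Suc k" "Cod Delta (add_pt j \<sigma>) = n"
    using s ah by (auto simp: in_Hom)
  have ak: "a \<le> Suc k" using fib_end_le[of j \<sigma>] a dc by simp
  have da: "dfun (add_pt j \<sigma>) i = (if i < a then dfun \<sigma> i else if i = a then j else dfun \<sigma> (i - 1))"
    if "i \<le> Suc k" for i using that by (simp add: add_pt_def dc a)
  have fa: "fib_end j (add_pt j \<sigma>) = Suc a"
  proof -
    have "{i. i \<le> Suc k \<and> dfun (add_pt j \<sigma>) i \<le> j} = {..a}"
    proof -
      have "i \<le> Suc k \<and> dfun (add_pt j \<sigma>) i \<le> j \<longleftrightarrow> i \<le> a" for i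
        using ak da[of i] less_fib_end[OF s, of i j, folded a] less_fib_end[OF s, of "i - 1" j, folded a]
        by (cases "i \<le> Suc k"; cases "i < a"; cases "i = a"; cases "i - 1 < a"; cases "i - 1 \<le> k") auto
      then show ?thesis by auto
    qed
    then show ?thesis by (simp add: fib_end_def dc)
  qed
  \<comment> \<open>Two points are added over j, at the positions a and a + 1; omitting either of
    them gives back \<open>add_pt j \<sigma>\<close>.\<close>
  define \<omega> where "\<omega> = add_pt j (add_pt j \<sigma>)"
  have w: "\<omega> = dmap (Suc (Suc k)) n (\<lambda>i. if i < a then dfun \<sigma> i else if i \<le> Suc a then j else dfun \<sigma> (i - 2))"
    unfolding \<omega>_def add_pt_def[of j "add_pt j \<sigma>"] fa dc
  proof (rule dmap_cong)
    show "(if i < Suc a then dfun (add_pt j \<sigma>) i else if i = Suc a then j else dfun (add_pt j \<sigma>) (i - 1)) =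
      (if i < a then dfun \<sigma> i else if i \<le> Suc a then j else dfun \<sigma> (i - 2))" if "i \<le> Suc (Suc k)" for i
      using that ak da[of i] da[of "i - 1"] by (auto simp: numeral_2_eq_2)
  qed
  have dm: "dmono (Suc k) (Suc (Suc k)) (\<lambda>i. if i < b then i else Suc i)" for b
    using face_Hom[of b "Suc k"] by (simp add: face_def)
  have wf: "\<omega> \<odot> face b (Suc k) = add_pt j \<sigma>" if "b = a \<or> b = Suc a" for b
    unfolding w face_def add_pt_def dc a[symmetric] dmap_comp[OF dm]
    by (rule dmap_cong) (use that in auto)
  have ff: "face a (Suc k) \<odot> face a k = face (Suc a) (Suc k) \<odot> face a k"
    using face_Hom[of a k] unfolding face_def by (subst (1 2) dmap_comp) (auto intro!: dmap_cong)
  have fd: "face a k \<odot> degen a k = dmap (Suc k) (Suc k) (\<lambda>i. if i < a then i else if i = 0 then 1 else if i = a then a - 1 else i)"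
    using degen_Hom[OF ak] unfolding face_def degen_def by (subst dmap_comp) (auto intro!: dmap_cong)
  show thesis
  proof (cases "a = 0")
    \<comment> \<open>No element precedes the added points, so t merges the second of them with the
      first old element; u keeps this second point, v the first.\<close>
    case True
    define t where "t = dmap (Suc (Suc k)) (Suc k) (\<lambda>i. if i < 2 then i else i - 1)"
    show thesis
    proof (rule that[of "face 0 (Suc k)" "face 1 (Suc k)" t \<omega>])
      show "t \<in> Hom Delta (Suc (Suc k)) (Suc k)" using degen_Hom[of 2 "Suc k"] by (simp add: t_def degen_def)
      show "t \<odot> face 0 (Suc k) = face a k \<odot> degen a k"
        unfolding fd unfolding t_def face_def dmap_comp[OF dm] by (rule dmap_cong) (use True in auto)
      show "t \<odot> face 1 (Suc k) = Idt Delta (Suc k)"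
        unfolding Idt_Delta t_def face_def dmap_comp[OF dm] by (rule dmap_cong) auto
    qed (use True ff wf face_Hom in \<open>auto simp: \<omega>_def\<close>)
  next
    \<comment> \<open>Here t merges the first added point, at a, with the old element a - 1; u keeps
      this first point, v the second.\<close>
    case False
    define t where "t = degen a (Suc k)"
    show thesis
    proof (rule that[of "face (Suc a) (Suc k)" "face a (Suc k)" t \<omega>])
      show "t \<in> Hom Delta (Suc (Suc k)) (Suc k)" using degen_Hom[of a "Suc k"] ak by (simp add: t_def)
      show "t \<odot> face (Suc a) (Suc k) = face a k \<odot> degen a k"
        unfolding fd unfolding t_def degen_def face_def dmap_comp[OF dm] by (rule dmap_cong) (use False in auto)
      show "t \<odot> face a (Suc k) = Idt Delta (Suc k)"
        unfolding t_def using degen_face[of a "Suc k"] ak by simp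
    qed (use ff wf face_Hom in \<open>auto simp: \<omega>_def\<close>)
  qed
qed

text \<open>Interpolates between surjectivity, at j = 0, and an empty condition, at j = n + 1 for
  codomain [n].\<close>

definition hits_from :: "nat \<Rightarrow> darr \<Rightarrow> bool" where
  "hits_from j \<sigma> \<longleftrightarrow> (\<forall>i. j \<le> i \<longrightarrow> i \<le> Cod Delta \<sigma> \<longrightarrow> (\<exists>x\<le>Dom Delta \<sigma>. dfun \<sigma> x = i))"

lemma hits_from_add_pt:
  assumes s: "\<sigma> \<in> Hom Delta k n" and h: "hits_from (Suc j) \<sigma>"
  shows "hits_from j (add_pt j \<sigma>)"
  unfolding hits_from_def
proof (intro allI impI)
  have dc: "Dom Delta \<sigma> = k" "Cod Delta \<sigma> = n" using s by (auto simp: in_Hom)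
  have ak: "fib_end j \<sigma> \<le> Suc k" using fib_end_le[of j \<sigma>] dc by simp
  fix i assume i: "j \<le> i" "i \<le> Cod Delta (add_pt j \<sigma>)"
  show "\<exists>x\<le>Dom Delta (add_pt j \<sigma>). dfun (add_pt j \<sigma>) x = i"
  proof (cases "i = j")
    case True
    then show ?thesis using ak by (intro exI[of _ "fib_end j \<sigma>"]) (simp add: add_pt_def dc)
  next
    case False
    then have "Suc j \<le> i" "i \<le> n" using i by (auto simp: add_pt_def dc)
    then obtain x where x: "x \<le> k" "dfun \<sigma> x = i"
      using h unfolding hits_from_def dc by blast
    then have "\<not> x < fib_end j \<sigma>" using less_fib_end[OF s x(1), of j] False i(1) by simp
    then show ?thesis using x by (intro exI[of _ "Suc x"]) (simp add: add_pt_def dc)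
  qed
qed

lemma hits_from_Suc: "hits_from j \<sigma> \<Longrightarrow> hits_from (Suc j) \<sigma>"
  by (auto simp: hits_from_def)

context category
begin

text \<open>Naturality moves the face from Y to X, where it cancels against the degeneracy. So the
  value at \<sigma> is forced by the value at \<open>add_pt j \<sigma>\<close>.\<close>

lemma family_split:
  assumes X: "is_functor Dop C X" and Y: "is_functor Dop C Y" and e: "nat_family C X Y n S e"
    and s: "\<sigma> \<in> Hom Delta k n" "S \<sigma>" "S (add_pt j \<sigma>)" and j: "j \<le> n"
  shows "e k \<sigma> = FAr Y (face (fib_end j \<sigma>) k) \<cdot> e (Suc k) (add_pt j \<sigma>) \<cdot> FAr X (degen (fib_end j \<sigma>) k)"
proof -
  define a where "a = fib_end j \<sigma>"
  have ak: "a \<le> Suc k" using fib_end_le[of j \<sigma>] s(1) by (simp add: a_def in_Hom)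
  note fd = face_Hom[of a k] degen_Hom[OF ak]
  have "FAr Y (face a k) \<cdot> e (Suc k) (add_pt j \<sigma>) \<cdot> FAr X (degen a k) = e k \<sigma> \<cdot> FAr X (face a k) \<cdot> FAr X (degen a k)"
    using nat_family_nat[OF e fd(1) add_pt_Hom[OF s(1) j] _ s(3,2)] add_pt_face[OF s(1)] by (simp add: a_def)
  also have "\<dots> = e k \<sigma> \<cdot> (FAr X (face a k) \<cdot> FAr X (degen a k))"
    using comp_assoc[OF sfn_Hom[OF X fd(2)] sfn_Hom[OF X fd(1)] nat_family_Hom[where S = S, OF e s(1,2)]] .
  also have "FAr X (face a k) \<cdot> FAr X (degen a k) = Idt C (FOb X k)"
    using sfn_comp[OF X fd] degen_face[OF ak] sfn_idt[OF X] by simp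
  finally show ?thesis using comp_idt_right[OF nat_family_Hom[where S = S, OF e s(1,2)]] by (simp add: a_def)
qed

text \<open>Each use of \<open>family_split\<close> fills one more fibre; after n + 1 of them the
  values are expressed by values at surjections.\<close>

lemma family_unique:
  assumes X: "is_functor Dop C X" and Y: "is_functor Dop C Y"
    and e: "all_family C X Y n e" and e': "all_family C X Y n e'"
    and eq: "\<And>k \<sigma>. \<sigma> \<in> Hom Delta k n \<Longrightarrow> hits_from 0 \<sigma> \<Longrightarrow> e k \<sigma> = e' k \<sigma>" and s: "\<sigma> \<in> Hom Delta k n"
  shows "e k \<sigma> = e' k \<sigma>"
proof -
  have "j \<le> Suc n \<Longrightarrow> \<sigma> \<in> Hom Delta k n \<Longrightarrow> hits_from j \<sigma> \<Longrightarrow> e k \<sigma> = e' k \<sigma>" for j k \<sigma>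
  proof (induction j arbitrary: k \<sigma>)
    case 0
    then show ?case using eq by simp
  next
    case (Suc j)
    then have j: "j \<le> n" by simp
    show ?case
      using family_split[OF X Y e Suc.prems(2) _ _ j] family_split[OF X Y e' Suc.prems(2) _ _ j]
        Suc.IH[OF _ add_pt_Hom[OF Suc.prems(2) j] hits_from_add_pt[OF Suc.prems(2,3)]] j by simp
  qed
  moreover have "hits_from (Suc n) \<sigma>" using s by (auto simp: hits_from_def in_Hom)
  ultimately show ?thesis using s by blast
qed

text \<open>The forced formula serves as the definition. The task is naturality: the degeneracy in
  the formula depends on \<sigma> in a way that g does not respect, and the auxiliary fact
  \<open>split\<close> eliminates it after composition with the face of X.\<close>

lemma family_extend_step:
  assumes X: "is_functor Dop C X" and Y: "is_functor Dop C Y"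
    and e: "nat_family C X Y n (hits_from j) e" and j: "j \<le> n"
  obtains e' where "nat_family C X Y n (hits_from (Suc j)) e'"
    "\<And>k \<sigma>. \<sigma> \<in> Hom Delta k n \<Longrightarrow> hits_from j \<sigma> \<Longrightarrow> e' k \<sigma> = e k \<sigma>"
proof -
  define e' where "e' k \<sigma> = FAr Y (face (fib_end j \<sigma>) k) \<cdot> e (Suc k) (add_pt j \<sigma>) \<cdot> FAr X (degen (fib_end j \<sigma>) k)"
    for k \<sigma>
  have eh: "e (Suc k) (add_pt j \<sigma>) \<in> Hom C (FOb X (Suc k)) (FOb Y (Suc k))"
    if "\<sigma> \<in> Hom Delta k n" "hits_from (Suc j) \<sigma>" for k \<sigma>
    using nat_family_Hom[where S = "hits_from j", OF e add_pt_Hom[OF that(1) j] hits_from_add_pt[OF that]] .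
  have dg: "degen (fib_end j \<sigma>) k \<in> Hom Delta (Suc k) k" if "\<sigma> \<in> Hom Delta k n" for k \<sigma>
    using degen_Hom[of "fib_end j \<sigma>" k] fib_end_le[of j \<sigma>] that by (simp add: in_Hom)
  have e'h: "e' k \<sigma> \<in> Hom C (FOb X k) (FOb Y k)"
    if "\<sigma> \<in> Hom Delta k n" "hits_from (Suc j) \<sigma>" for k \<sigma>
    unfolding e'_def
    using comp_hom[OF sfn_Hom[OF X dg[OF that(1)]] comp_hom[OF eh[OF that] sfn_Hom[OF Y face_Hom]]] .
  \<comment> \<open>The degeneracy of X after its face is an idempotent, in general neither the
    identity nor induced by a map over [n]. It disappears only behind the face of Y.\<close>
  have split: "e' k \<sigma> \<cdot> FAr X (face (fib_end j \<sigma>) k) = FAr Y (face (fib_end j \<sigma>) k) \<cdot> e (Suc k) (add_pt j \<sigma>)"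
    if s: "\<sigma> \<in> Hom Delta k n" "hits_from (Suc j) \<sigma>" for k \<sigma>
  proof -
    define a where "a = fib_end j \<sigma>"
    obtain u v t \<omega> where h: "u \<in> Hom Delta (Suc k) (Suc (Suc k))" "v \<in> Hom Delta (Suc k) (Suc (Suc k))"
      "t \<in> Hom Delta (Suc (Suc k)) (Suc k)" and w: "\<omega> = add_pt j (add_pt j \<sigma>)"
      "\<omega> \<odot> u = add_pt j \<sigma>" "\<omega> \<odot> v = add_pt j \<sigma>"
      and uv: "u \<odot> face a k = v \<odot> face a k"
      and t: "t \<odot> u = face a k \<odot> degen a k" "t \<odot> v = Idt Delta (Suc k)"
      by (rule add_pt_homotopy[OF s(1) j a_def])
    note f = face_Hom[of a k] and d = dg[OF s(1), folded a_def]
    note T = add_pt_Hom[OF s(1) j] and ST = hits_from_add_pt[OF s]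
    have W: "\<omega> \<in> Hom Delta (Suc (Suc k)) n" using add_pt_Hom[OF T j] w(1) by simp
    have SW: "hits_from j \<omega>" using hits_from_add_pt[OF T hits_from_Suc[OF ST]] w(1) by simp
    note eW = nat_family_Hom[where S = "hits_from j", OF e W SW]
    note eT = eh[OF s]
    note Xh = sfn_Hom[OF X f] sfn_Hom[OF X d] sfn_Hom[OF X h(1)] sfn_Hom[OF X h(2)] sfn_Hom[OF X h(3)]
    note Yh = sfn_Hom[OF Y f] sfn_Hom[OF Y h(1)] sfn_Hom[OF Y h(2)]
    \<comment> \<open>Moving w through e leads to the twice extended \<omega>, and afterwards w
      enters only through its composite with the face, which is the same for u and v.\<close>
    have *: "(FAr Y (face a k) \<cdot> e (Suc k) (add_pt j \<sigma>)) \<cdot> (FAr X w \<cdot> FAr X t) =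
       FAr Y (w \<odot> face a k) \<cdot> (e (Suc (Suc k)) \<omega> \<cdot> FAr X t)"
      if w: "w \<in> Hom Delta (Suc k) (Suc (Suc k))" "\<omega> \<odot> w = add_pt j \<sigma>" for w
    proof -
      note Xw = sfn_Hom[OF X w(1)] and Yw = sfn_Hom[OF Y w(1)]
      have "(FAr Y (face a k) \<cdot> e (Suc k) (add_pt j \<sigma>)) \<cdot> (FAr X w \<cdot> FAr X t) =
        FAr Y (face a k) \<cdot> ((e (Suc k) (add_pt j \<sigma>) \<cdot> FAr X w) \<cdot> FAr X t)"
        using comp_assoc4[OF Xh(5) Xw eT Yh(1)] .
      also have "\<dots> = FAr Y (face a k) \<cdot> ((FAr Y w \<cdot> e (Suc (Suc k)) \<omega>) \<cdot> FAr X t)"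
        using nat_family_nat[where S = "hits_from j", OF e w(1) W w(2) SW ST] by simp
      also have "\<dots> = (FAr Y (face a k) \<cdot> FAr Y w) \<cdot> (e (Suc (Suc k)) \<omega> \<cdot> FAr X t)"
        using comp_assoc4[OF Xh(5) eW Yw Yh(1)] by simp
      finally show ?thesis using sfn_comp[OF Y f w(1)] by simp
    qed
    have "e' k \<sigma> \<cdot> FAr X (face a k) =
        (FAr Y (face a k) \<cdot> e (Suc k) (add_pt j \<sigma>)) \<cdot> (FAr X (degen a k) \<cdot> FAr X (face a k))"
      using comp_assoc[OF Xh(1,2) comp_hom[OF eT Yh(1)]] by (simp add: e'_def a_def)
    also have "FAr X (degen a k) \<cdot> FAr X (face a k) = FAr X u \<cdot> FAr X t"
      using sfn_comp[OF X d f] sfn_comp[OF X h(1,3)] t(1) by simp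
    also have "(FAr Y (face a k) \<cdot> e (Suc k) (add_pt j \<sigma>)) \<cdot> (FAr X u \<cdot> FAr X t) =
        (FAr Y (face a k) \<cdot> e (Suc k) (add_pt j \<sigma>)) \<cdot> (FAr X v \<cdot> FAr X t)"
      using *[OF h(1) w(2)] *[OF h(2) w(3)] uv by simp
    also have "FAr X v \<cdot> FAr X t = Idt C (FOb X (Suc k))"
      using sfn_comp[OF X h(2,3)] t(2) sfn_idt[OF X] by simp
    finally show ?thesis using comp_idt_right[OF comp_hom[OF eT Yh(1)]] by (simp add: a_def)
  qed
  have "nat_family C X Y n (hits_from (Suc j)) e'"
    unfolding nat_family_def
  proof (intro conjI allI ballI impI)
    fix k l g \<sigma>
    assume g: "g \<in> Hom Delta k l" and s: "\<sigma> \<in> Hom Delta l n" "hits_from (Suc j) \<sigma>"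
      and t': "hits_from (Suc j) (\<sigma> \<odot> g)"
    define \<tau> where "\<tau> = \<sigma> \<odot> g"
    have t: "\<tau> \<in> Hom Delta k n" "hits_from (Suc j) \<tau>" using Delta.comp_hom[OF g s(1)] t' by (auto simp: \<tau>_def)
    define a where "a = fib_end j \<sigma>"
    define b where "b = fib_end j \<tau>"
    obtain g' where g': "g' \<in> Hom Delta (Suc k) (Suc l)" "add_pt j \<sigma> \<odot> g' = add_pt j \<tau>"
      "g' \<odot> face b k = face a l \<odot> g"
      using add_pt_natural[OF g s(1) \<tau>_def[symmetric], of j] unfolding a_def b_def by blast
    note fa = face_Hom[of a l] and fb = face_Hom[of b k] and da = dg[OF s(1), folded a_def]
    note Xh = sfn_Hom[OF X fa] sfn_Hom[OF X fb] sfn_Hom[OF X g] sfn_Hom[OF X g'(1)] sfn_Hom[OF X da]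
    note Yh = sfn_Hom[OF Y fa] sfn_Hom[OF Y fb] sfn_Hom[OF Y g] sfn_Hom[OF Y g'(1)]
    note es = eh[OF s] e'h[OF s] and et = eh[OF t] e'h[OF t]
    note XX = sfn_comp[OF X fb g'(1)] sfn_comp[OF X g fa]
    note YY = sfn_comp[OF Y fb g'(1)] sfn_comp[OF Y g fa]
    have "(FAr Y g \<cdot> e' l \<sigma>) \<cdot> FAr X (face a l) = FAr Y g \<cdot> (FAr Y (face a l) \<cdot> e (Suc l) (add_pt j \<sigma>))"
      using comp_assoc[OF Xh(1) es(2) Yh(3)] split[OF s] by (simp add: a_def)
    also have "\<dots> = FAr Y (face b k) \<cdot> (FAr Y g' \<cdot> e (Suc l) (add_pt j \<sigma>))"
      using comp_assoc[OF es(1) Yh(1,3)] comp_assoc[OF es(1) Yh(4,2)] YY g'(3) by simp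
    also have "\<dots> = FAr Y (face b k) \<cdot> (e (Suc k) (add_pt j \<tau>) \<cdot> FAr X g')"
      using nat_family_nat[where S = "hits_from j", OF e g'(1) add_pt_Hom[OF s(1) j] g'(2)
          hits_from_add_pt[OF s] hits_from_add_pt[OF t]] by simp
    also have "\<dots> = (e' k \<tau> \<cdot> FAr X (face b k)) \<cdot> FAr X g'"
      using comp_assoc[OF Xh(4) et(1) Yh(2)] split[OF t] by (simp add: b_def)
    also have "\<dots> = (e' k \<tau> \<cdot> FAr X g) \<cdot> FAr X (face a l)"
      using comp_assoc[OF Xh(4,2) et(2)] comp_assoc[OF Xh(1,3) et(2)] XX g'(3) by simp
    finally have "(FAr Y g \<cdot> e' l \<sigma>) \<cdot> FAr X (face a l) = (e' k \<tau> \<cdot> FAr X g) \<cdot> FAr X (face a l)" .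
    \<comment> \<open>The face of X has the degeneracy as a right inverse, so it can be cancelled on
      the right.\<close>
    then have "(FAr Y g \<cdot> e' l \<sigma>) \<cdot> (FAr X (face a l) \<cdot> FAr X (degen a l)) =
        (e' k \<tau> \<cdot> FAr X g) \<cdot> (FAr X (face a l) \<cdot> FAr X (degen a l))"
      using comp_assoc[OF Xh(5,1) comp_hom[OF es(2) Yh(3)]] comp_assoc[OF Xh(5,1) comp_hom[OF Xh(3) et(2)]]
      by simp
    moreover have "FAr X (face a l) \<cdot> FAr X (degen a l) = Idt C (FOb X l)"
      using sfn_comp[OF X fa da] degen_face[of a l] sfn_idt[OF X] fib_end_le[of j \<sigma>] s(1)
      by (simp add: a_def in_Hom)
    ultimately show "FAr Y g \<cdot> e' l \<sigma> = e' k (\<sigma> \<odot> g) \<cdot> FAr X g"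
      using comp_idt_right[OF comp_hom[OF es(2) Yh(3)]] comp_idt_right[OF comp_hom[OF Xh(3) et(2)]]
      by (simp add: \<tau>_def)
  qed (rule e'h)
  moreover have "e' k \<sigma> = e k \<sigma>" if "\<sigma> \<in> Hom Delta k n" "hits_from j \<sigma>" for k \<sigma>
    unfolding e'_def
    using family_split[OF X Y e that hits_from_add_pt[OF that(1) hits_from_Suc[OF that(2)]] j] by simp
  ultimately show thesis by (rule that)
qed

text \<open>After n + 1 extension steps the family is defined on all maps. Each step agrees with the
  preceding one where that was defined, so values at surjections never change.\<close>

lemma family_extend:
  assumes X: "is_functor Dop C X" and Y: "is_functor Dop C Y"
    and e: "nat_family C X Y n (hits_from 0) e"
  obtains e' where "e' \<in> EHom (canonical_enrichment C) X Y n"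
    "\<And>k \<sigma>. \<sigma> \<in> Hom Delta k n \<Longrightarrow> hits_from 0 \<sigma> \<Longrightarrow> e' k \<sigma> = e k \<sigma>"
proof -
  have mono: "hits_from 0 \<sigma> \<Longrightarrow> hits_from j \<sigma>" for j \<sigma> by (auto simp: hits_from_def)
  have "j \<le> Suc n \<Longrightarrow> \<exists>e'. nat_family C X Y n (hits_from j) e' \<and>
     (\<forall>k. \<forall>\<sigma>\<in>Hom Delta k n. hits_from 0 \<sigma> \<longrightarrow> e' k \<sigma> = e k \<sigma>)" for j
  proof (induction j)
    case 0
    then show ?case using e by blast
  next
    case (Suc j)
    then obtain e' where e': "nat_family C X Y n (hits_from j) e'"
      "\<forall>k. \<forall>\<sigma>\<in>Hom Delta k n. hits_from 0 \<sigma> \<longrightarrow> e' k \<sigma> = e k \<sigma>" by auto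
    obtain e'' where "nat_family C X Y n (hits_from (Suc j)) e''"
      "\<And>k \<sigma>. \<sigma> \<in> Hom Delta k n \<Longrightarrow> hits_from j \<sigma> \<Longrightarrow> e'' k \<sigma> = e' k \<sigma>"
      using family_extend_step[OF X Y e'(1)] Suc.prems by (metis Suc_le_mono)
    then show ?case using e'(2) mono by metis
  qed
  from this[of "Suc n"] obtain e' where e': "nat_family C X Y n (hits_from (Suc n)) e'"
      "\<forall>k. \<forall>\<sigma>\<in>Hom Delta k n. hits_from 0 \<sigma> \<longrightarrow> e' k \<sigma> = e k \<sigma>" by auto
  have all: "hits_from (Suc n) \<sigma>" if "\<sigma> \<in> Hom Delta k n" for k \<sigma>
    using that by (auto simp: hits_from_def in_Hom)
  \<comment> \<open>Restricting to \<open>Hom Delta k n\<close> supplies the extensionality that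
    \<open>set_end\<close> demands.\<close>
  have "all_family C X Y n (\<lambda>k. restrict (e' k) (Hom Delta k n))"
    unfolding nat_family_def
  proof (intro conjI allI ballI impI)
    fix k l g \<sigma> assume g: "g \<in> Hom Delta k l" and s: "\<sigma> \<in> Hom Delta l n"
    then show "FAr Y g \<cdot> restrict (e' l) (Hom Delta l n) \<sigma> =
        restrict (e' k) (Hom Delta k n) (\<sigma> \<odot> g) \<cdot> FAr X g"
      using nat_family_nat[OF e'(1) g s refl all[OF s] all[OF Delta.comp_hom[OF g s]]] Delta.comp_hom[OF g s]
      by simp
  qed (use nat_family_Hom[OF e'(1)] all in simp)
  then have "(\<lambda>k. restrict (e' k) (Hom Delta k n)) \<in> EHom (canonical_enrichment C) X Y n"
    by (simp add: canonical_EHom[OF X Y])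
  then show thesis by (rule that) (use e'(2) in simp)
qed

end

abbreviation mfun :: "('o, 'a) cat \<Rightarrow> nat \<Rightarrow> (('o, 'a) msfn, ('o, 'a) msnt) cat" where
  "mfun C p \<equiv> fun_cat (Dop_pow p) C"

lemma category_mfun: "category C \<Longrightarrow> category (mfun C p)"
  by (rule category_fun_cat[OF category_Dop_pow])

section \<open>Families evaluated on maps that are constant on blocks\<close>

section \<open>Restriction to labelled blocks\<close>

abbreviation decs :: "nat \<Rightarrow> ('o, 'a) sfn \<Rightarrow> ('o, 'a) msfn" where
  "decs p X \<equiv> comp_fn (Dop_pow p) X (dec p)"

lemma is_functor_decs: "is_functor Dop C X \<Longrightarrow> p > 0 \<Longrightarrow> is_functor (Dop_pow p) C (decs p X)"
  by (rule is_functor_comp[OF category_Dop_pow is_functor_dec])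

lemma decs_Ob: "length ks = p \<Longrightarrow> FOb (decs p X) ks = FOb X (dec_ob ks)"
  by (simp add: comp_fn_def dec_def)

lemma decs_Ar: "fs \<in> Hom (pow_cat Delta p) ks ls \<Longrightarrow> FAr (decs p X) fs = FAr X (dec_arr fs)"
  by (simp add: comp_fn_def dec_def in_Hom)

text \<open>One label in [n] for each block. Lists other than 0, ..., n arise while F(\<alpha>) is
  evaluated: each colimit deletes a label, and the list that remains at the end is the image of
  \<alpha>.\<close>

definition labels :: "nat \<Rightarrow> nat list \<Rightarrow> bool" where
  "labels n L \<longleftrightarrow> L \<noteq> [] \<and> sorted L \<and> set L \<subseteq> {..n}"

definition label_arr :: "nat \<Rightarrow> nat list \<Rightarrow> nat list \<Rightarrow> darr" where
  "label_arr n L ks = dmap (dec_ob ks) n (\<lambda>i. L ! block ks i)"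

lemma label_arr_Hom:
  assumes "labels n L" "length ks = length L"
  shows "label_arr n L ks \<in> Hom Delta (dec_ob ks) n"
proof -
  have ne: "ks \<noteq> []" using assms by (auto simp: labels_def)
  show ?thesis
    unfolding label_arr_def dmap_Hom dmono_def
  proof (intro conjI refl allI impI)
    show "L ! block ks i \<le> n" if "i \<le> dec_ob ks" for i
      using block_less[OF ne that] assms nth_mem[of "block ks i" L] unfolding labels_def by fastforce
    show "L ! block ks i \<le> L ! block ks i'" if "i \<le> i'" "i' \<le> dec_ob ks" for i i'
      using block_less[OF ne that(2)] block_mono[OF that(1)] assms
      by (auto simp: labels_def intro!: sorted_nth_mono)
  qed
qed

text \<open>Joins preserve block numbers, so they are maps over [n] for every choice of
  labels.\<close>

lemma label_arr_dec:
  assumes "labels n L" and fs: "fs \<in> Hom (pow_cat Delta (length L)) ks ls"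
  shows "label_arr n L ls \<odot> dec_arr fs = label_arr n L ks"
proof -
  have p: "length L > 0" using assms(1) by (simp add: labels_def)
  show ?thesis
    unfolding label_arr_def dec_arr_Hom(2)[OF fs p] dmap_comp[OF dec_arr_Hom(3)[OF fs p]]
    by (rule dmap_cong) (use block_dec_fun Hom_powD[OF fs] in simp)
qed

definition remove_at :: "nat \<Rightarrow> 'x list \<Rightarrow> 'x list" where
  "remove_at j xs = take j xs @ drop (Suc j) xs"

lemma labels_remove_at:
  assumes "labels n L" "length L = Suc q" "q > 0" "j \<le> q"
  shows "labels n (remove_at j L)" "length (remove_at j L) = q"
proof -
  have "L = take j L @ L ! j # drop (Suc j) L" using assms by (simp add: id_take_nth_drop[symmetric])
  then have *: "sorted (take j L @ L ! j # drop (Suc j) L)" using assms by (auto simp: labels_def)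
  show l: "length (remove_at j L) = q" using assms by (simp add: remove_at_def)
  have "sorted (remove_at j L)" using * unfolding remove_at_def by (simp add: sorted_append)
  moreover have "set (remove_at j L) \<subseteq> {..n}"
    using assms(1) set_take_subset[of j L] set_drop_subset[of "Suc j" L] by (auto simp: labels_def remove_at_def)
  ultimately show "labels n (remove_at j L)" using l assms(3) by (auto simp: labels_def)
qed

text \<open>The inclusion meets every block except the inserted one, so exactly the label at
  position j is lost.\<close>

lemma label_arr_incl_at:
  assumes L: "labels n L" "length L = Suc q" and q: "q > 0" and j: "j \<le> q" and l: "length ks = q"
  shows "label_arr n L (insert_at j i ks) \<odot> incl_at j i ks = label_arr n (remove_at j L) ks"
proof -
  have ne: "ks \<noteq> []" and j': "j \<le> length ks" using q j l by auto
  show ?thesis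
    unfolding label_arr_def incl_at_dmap[OF j'] dmap_comp[OF dmono_incl_fun[OF j' ne]]
  proof (rule dmap_cong)
    fix x assume "x \<le> dec_ob ks"
    then show "L ! block (insert_at j i ks) (incl_fun j i ks x) = remove_at j L ! block ks x"
      using block_less[OF ne, of x] block_incl_fun[OF j', of x i] L j l
      by (auto simp: remove_at_def nth_append)
  qed
qed

text \<open>For L = 0, ..., n this is the comparison of the two enrichments; other lists describe
  the intermediate stages of the action.\<close>

definition label_nt ::
  "nat \<Rightarrow> nat list \<Rightarrow> ('o, 'a) sfn \<Rightarrow> ('o, 'a) sfn \<Rightarrow> (nat \<Rightarrow> darr \<Rightarrow> 'a) \<Rightarrow> ('o, 'a) msnt" where
  "label_nt n L X Y e = \<lparr>Src = decs (length L) X, Tgt = decs (length L) Y,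
     App = (\<lambda>ks\<in>Obj (Dop_pow (length L)). e (dec_ob ks) (label_arr n L ks))\<rparr>"

lemma label_nt_App: "length ks = length L \<Longrightarrow> App (label_nt n L X Y e) ks = e (dec_ob ks) (label_arr n L ks)"
  by (simp add: label_nt_def)

lemma label_nt_Hom:
  assumes X: "is_functor Dop C X" and Y: "is_functor Dop C Y"
    and e: "all_family C X Y n e" and L: "labels n L"
  shows "label_nt n L X Y e \<in> Hom (mfun C (length L)) (decs (length L) X) (decs (length L) Y)"
proof -
  have p: "length L > 0" using L by (simp add: labels_def)
  show ?thesis
  proof (rule Hom_funI, goal_cases)
    case (6 ks)
    then show ?case using nat_family_Hom[OF e label_arr_Hom[OF L]] by (simp add: label_nt_App decs_Ob)
  next
    case (7 fs ls ks)
    then have fs: "fs \<in> Hom (pow_cat Delta (length L)) ks ls" by (simp add: Hom_Dop_pow)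
    then have l: "length ks = length L" "length ls = length L" by (auto simp: Hom_pow)
    show ?case
      using nat_family_nat[OF e dec_arr_Hom(1)[OF fs p] label_arr_Hom[OF L l(2)] label_arr_dec[OF L fs]]
      by (simp add: label_nt_App l decs_Ar[OF fs])
  qed (use is_functor_decs[OF X p] is_functor_decs[OF Y p] in \<open>auto simp: label_nt_def\<close>)
qed

section \<open>Labels 0, ..., n: surjections as block maps, and the comparison bijection\<close>

lemma labels_upt: "labels n [0..<Suc n]"
  by (auto simp: labels_def simp del: upt_Suc)

lemma upt_nth_block: "length ks = Suc n \<Longrightarrow> i \<le> dec_ob ks \<Longrightarrow> [0..<Suc n] ! block ks i = block ks i"
  using block_less[of ks i] by (subst nth_upt) (cases ks, auto)

lemma label_arr_upt: "length ks = Suc n \<Longrightarrow> label_arr n [0..<Suc n] ks = dmap (dec_ob ks) n (block ks)"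
  unfolding label_arr_def by (rule dmap_cong) (rule upt_nth_block)

lemma hits_label_arr:
  assumes "length ks = Suc n"
  shows "hits_from 0 (label_arr n [0..<Suc n] ks)"
proof -
  have "\<exists>x\<le>dec_ob ks. dfun (dmap (dec_ob ks) n (block ks)) x = i" if "i \<le> n" for i
    using block_surj[of i ks] that assms by auto
  then show ?thesis unfolding hits_from_def label_arr_upt[OF assms] by simp
qed

lemma hits_obtain_block:
  assumes "\<sigma> \<in> Hom Delta k n" "hits_from 0 \<sigma>"
  obtains ks where "length ks = Suc n" "dec_ob ks = k" "label_arr n [0..<Suc n] ks = \<sigma>"
proof -
  note sd = Hom_Delta_dfun[OF assms(1)]
  obtain ks where ks: "length ks = Suc n" "dec_ob ks = k" "\<forall>i\<le>k. block ks i = dfun \<sigma> i"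
    using surj_is_block[OF sd(2)] assms unfolding hits_from_def by (auto simp: in_Hom)
  have "label_arr n [0..<Suc n] ks = dmap k n (dfun \<sigma>)"
    unfolding label_arr_upt[OF ks(1)] ks(2) by (rule dmap_cong) (use ks(3) in simp)
  then show thesis using that ks(1,2) sd(1) by simp
qed

context category
begin

text \<open>Injectivity is \<open>family_unique\<close>, as the surjections are the block maps with
  these labels. In the other direction a transformation is natural along joins; by
  \<open>dec_arr_full\<close> these are all maps over [n] between such block maps, so it defines a
  family on surjections, and \<open>family_extend\<close> applies.\<close>

lemma label_nt_bij:
  assumes X: "is_functor Dop C X" and Y: "is_functor Dop C Y"
  shows "bij_betw (label_nt n [0..<Suc n] X Y) (EHom (canonical_enrichment C) X Y n)
    (Hom (mfun C (Suc n)) (decs (Suc n) X) (decs (Suc n) Y))"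
  unfolding bij_betw_def
proof (intro conjI subset_antisym subsetI inj_onI)
  let ?L = "[0..<Suc n]"
  have len: "length ?L = Suc n" by simp
  {
    fix e e' assume e: "e \<in> EHom (canonical_enrichment C) X Y n" and e': "e' \<in> EHom (canonical_enrichment C) X Y n"
      and eq: "label_nt n ?L X Y e = label_nt n ?L X Y e'"
    have "e k \<sigma> = e' k \<sigma>" if s: "\<sigma> \<in> Hom Delta k n" for k \<sigma>
    proof (rule family_unique[OF X Y _ _ _ s])
      show "all_family C X Y n e" "all_family C X Y n e'" using e e' by (auto simp: canonical_EHom[OF X Y])
      fix k \<sigma> assume "\<sigma> \<in> Hom Delta k n" "hits_from 0 \<sigma>"
      then obtain ks where "length ks = Suc n" "dec_ob ks = k" "label_arr n ?L ks = \<sigma>"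
        by (rule hits_obtain_block)
      then show "e k \<sigma> = e' k \<sigma>" using arg_cong[OF eq, of "\<lambda>\<eta>. App \<eta> ks"] label_nt_App[of ks ?L n X Y]
        by (simp del: upt_Suc)
    qed
    then show "e = e'" by (rule canonical_eqI[OF X Y e e'])
  next
    fix \<eta> assume "\<eta> \<in> label_nt n ?L X Y ` EHom (canonical_enrichment C) X Y n"
    then show "\<eta> \<in> Hom (mfun C (Suc n)) (decs (Suc n) X) (decs (Suc n) Y)"
      using label_nt_Hom[OF X Y _ labels_upt] len by (auto simp: canonical_EHom[OF X Y])
  next
    fix \<eta> assume eta: "\<eta> \<in> Hom (mfun C (Suc n)) (decs (Suc n) X) (decs (Suc n) Y)"
    have nat: "FAr Y (dec_arr fs) \<cdot> App \<eta> ls = App \<eta> ks \<cdot> FAr X (dec_arr fs)"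
      if "fs \<in> Hom (pow_cat Delta (Suc n)) ks ls" for fs ks ls
      using Hom_fun_nat[OF eta, of fs ls ks] that by (simp add: Hom_Dop_pow decs_Ar)
    have Hom: "App \<eta> ks \<in> Hom C (FOb X (dec_ob ks)) (FOb Y (dec_ob ks))" if "length ks = Suc n" for ks
      using Hom_fun_App[OF eta, of ks] that by (simp add: decs_Ob)
    have over: "\<exists>fs. fs \<in> Hom (pow_cat Delta (Suc n)) ks ls \<and> dec_arr fs = g"
      if g: "g \<in> Hom Delta (dec_ob ks) (dec_ob ls)" and l: "length ks = Suc n" "length ls = Suc n"
      and eq: "label_arr n ?L ls \<odot> g = label_arr n ?L ks" for g ks ls
    proof -
      note gd = Hom_Delta_dfun[OF g]
      have "label_arr n ?L ls \<odot> g = dmap (dec_ob ks) n (\<lambda>i. block ls (dfun g i))"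
        unfolding label_arr_upt[OF l(2)] using dmap_comp[OF gd(2)] gd(1)[symmetric] by simp
      then have "block ls (dfun g i) = block ks i" if "i \<le> dec_ob ks" for i
        using eq that by (simp add: label_arr_upt[OF l(1)] dmap_eq_iff del: upt_Suc)
      then show ?thesis using dec_arr_full[OF l zero_less_Suc gd(2)] gd(1) by metis
    qed
    \<comment> \<open>The block list of a surjection is taken by choice. Two candidates are linked
      by a list of maps whose join is an identity, and naturality gives them equal
      components.\<close>
    define e where "e k \<sigma> = App \<eta> (SOME ks. length ks = Suc n \<and> dec_ob ks = k \<and> label_arr n ?L ks = \<sigma>)" for k \<sigma>
    have e: "e (dec_ob ks) (label_arr n ?L ks) = App \<eta> ks" if l: "length ks = Suc n" for ks
    proof -
      define ls where "ls = (SOME ls. length ls = Suc n \<and> dec_ob ls = dec_ob ks \<and> label_arr n ?L ls = label_arr n ?L ks)"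
      have ls: "length ls = Suc n \<and> dec_ob ls = dec_ob ks \<and> label_arr n ?L ls = label_arr n ?L ks"
        unfolding ls_def by (rule someI[of _ ks]) (simp add: l)
      note hls = label_arr_Hom[OF labels_upt, of ls n]
      obtain fs where fs: "fs \<in> Hom (pow_cat Delta (Suc n)) ks ls" "dec_arr fs = Idt Delta (dec_ob ks)"
        using over[of "Idt Delta (dec_ob ks)" ks ls] ls l Delta.idt_hom[of "dec_ob ks"]
          Delta.comp_idt_right[OF hls] by auto
      have "App \<eta> ls = App \<eta> ks"
        using nat[OF fs(1)] Hom[OF l] Hom[of ls] ls comp_idt_left comp_idt_right
        by (auto simp: fs(2) sfn_idt[OF X] sfn_idt[OF Y])
      then show ?thesis by (simp add: e_def ls_def)
    qed
    have fam: "nat_family C X Y n (hits_from 0) e"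
      unfolding nat_family_def
    proof (intro conjI allI ballI impI)
      fix k \<sigma> assume "\<sigma> \<in> Hom Delta k n" "hits_from 0 \<sigma>"
      then obtain ks where "length ks = Suc n" "dec_ob ks = k" "label_arr n ?L ks = \<sigma>"
        by (rule hits_obtain_block)
      then show "e k \<sigma> \<in> Hom C (FOb X k) (FOb Y k)" using e Hom by force
    next
      fix k l g \<sigma> assume g: "g \<in> Hom Delta k l" and s: "\<sigma> \<in> Hom Delta l n" "hits_from 0 \<sigma>"
        and t: "hits_from 0 (\<sigma> \<odot> g)"
      obtain ls where ls: "length ls = Suc n" "dec_ob ls = l" "label_arr n ?L ls = \<sigma>"
        using s by (rule hits_obtain_block)
      obtain ks where ks: "length ks = Suc n" "dec_ob ks = k" "label_arr n ?L ks = \<sigma> \<odot> g"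
        using Delta.comp_hom[OF g s(1)] t by (rule hits_obtain_block)
      obtain fs where "fs \<in> Hom (pow_cat Delta (Suc n)) ks ls" "dec_arr fs = g"
        using over[of g ks ls] g ks ls by auto
      then show "FAr Y g \<cdot> e l \<sigma> = e k (\<sigma> \<odot> g) \<cdot> FAr X g"
        using nat e[OF ks(1)] e[OF ls(1)] ks ls by force
    qed
    obtain e' where e': "e' \<in> EHom (canonical_enrichment C) X Y n"
      "\<And>k \<sigma>. \<sigma> \<in> Hom Delta k n \<Longrightarrow> hits_from 0 \<sigma> \<Longrightarrow> e' k \<sigma> = e k \<sigma>"
      using family_extend[OF X Y fam] by metis
    have "\<eta> = label_nt n ?L X Y e'"
    proof (rule Hom_fun_eqI[OF eta])
      show "label_nt n ?L X Y e' \<in> Hom (mfun C (Suc n)) (decs (Suc n) X) (decs (Suc n) Y)"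
        using label_nt_Hom[OF X Y _ labels_upt] len e'(1) by (auto simp: canonical_EHom[OF X Y])
      fix ks assume "ks \<in> Obj (Dop_pow (Suc n))"
      then have l: "length ks = Suc n" by simp
      show "App \<eta> ks = App (label_nt n ?L X Y e') ks"
        using e'(2)[OF label_arr_Hom[OF labels_upt] hits_label_arr[OF l]] e[OF l] l len
        by (subst label_nt_App) simp_all
    qed
    then show "\<eta> \<in> label_nt n ?L X Y ` EHom (canonical_enrichment C) X Y n" using e'(1) by blast
  }
qed

end

section \<open>One-variable colimits as functors, and their values on joins\<close>

section \<open>The colimit over one variable\<close>

locale dop_colimits = category C for C :: "('o, 'a) cat" (structure) +
  fixes cl :: "('o, 'a) colims"
  assumes colims: "colimit_choice Dop C cl"
begin

lemma cl_colimit: "is_functor Dop C D \<Longrightarrow> is_colimit Dop C D (fst (cl D)) (snd (cl D))"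
  using colims by (simp add: colimit_choice_def)

lemma cl_Hom: "is_functor Dop C D \<Longrightarrow> snd (cl D) l \<in> Hom C (FOb D l) (fst (cl D))"
  using cl_colimit[of D] by (simp add: is_colimit_def is_cocone_def)

lemma cl_ext:
  assumes "is_functor Dop C D" "u \<in> Hom C (fst (cl D)) d" "v \<in> Hom C (fst (cl D)) d"
    "\<And>l. u \<cdot> snd (cl D) l = v \<cdot> snd (cl D) l"
  shows "u = v"
  using colimit_ext[OF category_Dop assms(1) cl_colimit[OF assms(1)] assms(2-4)] .

text \<open>Action of the chosen colimits on maps of simplicial objects; the arrows in
  \<open>colim_var_ob\<close> and \<open>colim_var\<close> are instances of it.\<close>

definition colim_map :: "('o, 'a) sfn \<Rightarrow> ('o, 'a) sfn \<Rightarrow> (nat \<Rightarrow> 'a) \<Rightarrow> 'a" where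
  "colim_map D D' \<tau> = colim_desc Dop C (cl D) (fst (cl D')) (\<lambda>l. snd (cl D') l \<cdot> \<tau> l)"

text \<open>Every natural number is an object of \<open>Dop\<close>, so extensionality imposes
  nothing on \<tau>, and families can be given directly as abstractions.\<close>

definition sfn_map :: "('o, 'a) sfn \<Rightarrow> ('o, 'a) sfn \<Rightarrow> (nat \<Rightarrow> 'a) \<Rightarrow> bool" where
  "sfn_map D D' \<tau> \<longleftrightarrow> \<lparr>Src = D, Tgt = D', App = \<tau>\<rparr> \<in> Hom (fun_cat Dop C) D D'"

lemma sfn_mapI:
  assumes "is_functor Dop C D" "is_functor Dop C D'" "\<And>l. \<tau> l \<in> Hom C (FOb D l) (FOb D' l)"
    "\<And>f l l'. f \<in> Hom Dop l l' \<Longrightarrow> \<tau> l' \<cdot> FAr D f = FAr D' f \<cdot> \<tau> l"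
  shows "sfn_map D D' \<tau>"
  unfolding sfn_map_def by (rule Hom_funI) (use assms in auto)

lemma sfn_mapD:
  assumes "sfn_map D D' \<tau>"
  shows "is_functor Dop C D" "is_functor Dop C D'" "\<tau> l \<in> Hom C (FOb D l) (FOb D' l)"
    "f \<in> Hom Dop l l' \<Longrightarrow> \<tau> l' \<cdot> FAr D f = FAr D' f \<cdot> \<tau> l"
  using assms Hom_fun_App[of _ Dop C D D' l] Hom_fun_nat[of _ Dop C D D' f l l'] Hom_fun_functor
  unfolding sfn_map_def by fastforce+

lemma sfn_map_cocone:
  assumes "sfn_map D D' \<tau>"
  shows "is_cocone Dop C D (fst (cl D')) (\<lambda>l. snd (cl D') l \<cdot> \<tau> l)"
  unfolding is_cocone_def
proof (intro conjI ballI)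
  note t = sfn_mapD[OF assms]
  have c: "is_cocone Dop C D' (fst (cl D')) (snd (cl D'))"
    using cl_colimit[OF t(2)] by (simp add: is_colimit_def)
  show "fst (cl D') \<in> Obj C" using c by (simp add: is_cocone_def)
  show "snd (cl D') l \<cdot> \<tau> l \<in> Hom C (FOb D l) (fst (cl D'))" for l
    using comp_hom[OF t(3) cl_Hom[OF t(2)]] .
  fix f assume "f \<in> Arr Dop"
  then have f: "f \<in> Hom Dop (Dom Dop f) (Cod Dop f)" by (rule Arr_in_Hom)
  have "snd (cl D') (Cod Dop f) \<cdot> \<tau> (Cod Dop f) \<cdot> FAr D f =
      snd (cl D') (Cod Dop f) \<cdot> FAr D' f \<cdot> \<tau> (Dom Dop f)"
    using t(4)[OF f] comp_assoc[OF is_functor_Hom[OF t(1) f] t(3) cl_Hom[OF t(2)]]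
      comp_assoc[OF t(3) is_functor_Hom[OF t(2) f] cl_Hom[OF t(2)]] by simp
  also have "snd (cl D') (Cod Dop f) \<cdot> FAr D' f = snd (cl D') (Dom Dop f)"
    using c \<open>f \<in> Arr Dop\<close> by (simp add: is_cocone_def)
  finally show "snd (cl D') (Cod Dop f) \<cdot> \<tau> (Cod Dop f) \<cdot> FAr D f = snd (cl D') (Dom Dop f) \<cdot> \<tau> (Dom Dop f)" .
qed

lemma colim_map:
  assumes "sfn_map D D' \<tau>"
  shows "colim_map D D' \<tau> \<in> Hom C (fst (cl D)) (fst (cl D'))"
    and "colim_map D D' \<tau> \<cdot> snd (cl D) l = snd (cl D') l \<cdot> \<tau> l"
  using colim_desc_unique(1,2)[OF cl_colimit[OF sfn_mapD(1)[OF assms]] sfn_map_cocone[OF assms]]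
  by (auto simp: colim_map_def)

lemma colim_map_unique:
  assumes "sfn_map D D' \<tau>" "u \<in> Hom C (fst (cl D)) (fst (cl D'))"
    "\<And>l. u \<cdot> snd (cl D) l = snd (cl D') l \<cdot> \<tau> l"
  shows "colim_map D D' \<tau> = u"
  using cl_ext[OF sfn_mapD(1)[OF assms(1)] colim_map(1)[OF assms(1)] assms(2)] colim_map(2)[OF assms(1)]
    assms(3) by simp

lemma colim_map_idt:
  assumes D: "is_functor Dop C D"
  shows "colim_map D D (\<lambda>l. Idt C (FOb D l)) = Idt C (fst (cl D))"
proof (rule colim_map_unique)
  show "sfn_map D D (\<lambda>l. Idt C (FOb D l))"
    using category.idt_hom[OF category_fun_cat[OF category_Dop category_axioms], of D] D
    by (simp add: sfn_map_def restrict_UNIV)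
  show "Idt C (fst (cl D)) \<in> Hom C (fst (cl D)) (fst (cl D))"
    using idt_hom Hom_obj[OF cl_Hom[OF D]] by simp
  show "Idt C (fst (cl D)) \<cdot> snd (cl D) l = snd (cl D) l \<cdot> Idt C (FOb D l)" for l
    using comp_idt_left comp_idt_right cl_Hom[OF D, of l] by simp
qed

lemma sfn_map_comp:
  assumes "sfn_map D D' \<tau>" "sfn_map D' D'' \<tau>'"
  shows "sfn_map D D'' (\<lambda>l. \<tau>' l \<cdot> \<tau> l)"
  using category.comp_hom[OF category_fun_cat[OF category_Dop category_axioms] assms[unfolded sfn_map_def]]
  by (simp add: sfn_map_def restrict_UNIV)

lemma colim_map_comp:
  assumes t: "sfn_map D D' \<tau>" and t': "sfn_map D' D'' \<tau>'"
  shows "colim_map D D'' (\<lambda>l. \<tau>' l \<cdot> \<tau> l) = colim_map D' D'' \<tau>' \<cdot> colim_map D D' \<tau>"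
proof (rule colim_map_unique[OF sfn_map_comp[OF t t']])
  note m = colim_map[OF t] and m' = colim_map[OF t']
  show "colim_map D' D'' \<tau>' \<cdot> colim_map D D' \<tau> \<in> Hom C (fst (cl D)) (fst (cl D''))"
    by (rule comp_hom[OF m(1) m'(1)])
  fix l
  note k = cl_Hom[OF sfn_mapD(1)[OF t], of l] cl_Hom[OF sfn_mapD(2)[OF t], of l] cl_Hom[OF sfn_mapD(2)[OF t'], of l]
  show "colim_map D' D'' \<tau>' \<cdot> colim_map D D' \<tau> \<cdot> snd (cl D) l = snd (cl D'') l \<cdot> (\<tau>' l \<cdot> \<tau> l)"
    using comp_assoc[OF k(1) m(1) m'(1)] comp_assoc[OF sfn_mapD(3)[OF t] k(2) m'(1)]
      comp_assoc[OF sfn_mapD(3)[OF t] sfn_mapD(3)[OF t'] k(3)] m(2) m'(2) by simp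
qed

subsection \<open>Slices\<close>

lemma insert_at_Hom_Dop_pow:
  "fs \<in> Hom (Dop_pow q) ks ls \<Longrightarrow> f \<in> Hom Dop l l' \<Longrightarrow>
    insert_at j f fs \<in> Hom (Dop_pow (Suc q)) (insert_at j l ks) (insert_at j l' ls)"
  by (rule insert_at_Hom_pow)

lemma insert_at_Comp:
  assumes "fs \<in> Hom (Dop_pow q) ks ls" "gs \<in> Hom (Dop_pow q) ls ms"
  shows "insert_at j (g \<cdot>\<^bsub>Dop\<^esub> f) (gs \<cdot>\<^bsub>Dop_pow q\<^esub> fs) = insert_at j g gs \<cdot>\<^bsub>Dop_pow (Suc q)\<^esub> insert_at j f fs"
  using assms map2_insert_at[of gs fs "(\<cdot>\<^bsub>Dop\<^esub>)" j g f] by (simp add: Hom_pow)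

lemma Idt_Dop_pow_Hom: "length ks = q \<Longrightarrow> map (Idt Dop) ks \<in> Hom (Dop_pow q) ks ks"
  using category.idt_hom[OF category_Dop_pow, of ks q] by simp

lemma Idt_Dop_Hom: "Idt Dop l \<in> Hom Dop l l"
  using category.idt_hom[OF category_Dop, of l] by simp

lemma slice_simps:
  "FOb (slice j Z ks) l = FOb Z (insert_at j l ks)"
  "f \<in> Hom Dop l l' \<Longrightarrow> FAr (slice j Z ks) f = FAr Z (insert_at j f (map (Idt Dop) ks))"
  by (simp_all add: slice_def in_Hom)

lemma is_functor_slice:
  assumes Z: "is_functor (Dop_pow (Suc q)) C Z" and ks: "length ks = q"
  shows "is_functor Dop C (slice j Z ks)"
proof (rule is_functorI, goal_cases)
  case (3 l)
  then show ?case using is_functor_Ob[OF Z, of "insert_at j l ks"] ks by (simp add: slice_simps)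
next
  case (4 f l l')
  show ?case
    using is_functor_Hom[OF Z insert_at_Hom_Dop_pow[OF Idt_Dop_pow_Hom[OF ks] 4]]
    by (simp add: slice_simps(1) slice_simps(2)[OF 4])
next
  case (5 l)
  then show ?case
    using is_functor_Idt[OF Z, of "insert_at j l ks"] ks
    by (simp add: slice_simps(1) slice_simps(2)[OF Idt_Dop_Hom, simplified] map_insert_at)
next
  case (6 f g l l' l'')
  note i = Idt_Dop_pow_Hom[OF ks]
  have "insert_at j (g \<cdot>\<^bsub>Dop\<^esub> f) (map (Idt Dop) ks) =
      insert_at j g (map (Idt Dop) ks) \<cdot>\<^bsub>Dop_pow (Suc q)\<^esub> insert_at j f (map (Idt Dop) ks)"
    using insert_at_Comp[OF i i, of j g f] category.comp_idt_left[OF category_Dop_pow i] by simp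
  then show ?case
    using is_functor_Comp[OF Z insert_at_Hom_Dop_pow[OF i 6(1)] insert_at_Hom_Dop_pow[OF i 6(2)]]
    by (simp only: slice_simps(2)[OF 6(1)] slice_simps(2)[OF 6(2)]
        slice_simps(2)[OF category.comp_hom[OF category_Dop 6]])
qed (auto simp: slice_def)

text \<open>A change of the variable j commutes with a change of the others: both composites are Z
  at \<open>insert_at j f fs\<close>.\<close>

lemma slice_ar:
  assumes Z: "is_functor (Dop_pow (Suc q)) C Z" and fs: "fs \<in> Hom (Dop_pow q) ks ls"
  shows "sfn_map (slice j Z ks) (slice j Z ls) (\<lambda>l. FAr Z (insert_at j (Idt Dop l) fs))"
proof -
  have l: "length ks = q" "length ls = q" using fs by (auto simp: Hom_pow)
  note fsl = insert_at_Hom_Dop_pow[OF fs Idt_Dop_Hom, of j]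
  show ?thesis
  proof (rule sfn_mapI[OF is_functor_slice[OF Z l(1)] is_functor_slice[OF Z l(2)]])
    show "FAr Z (insert_at j (Idt Dop l) fs) \<in> Hom C (FOb (slice j Z ks) l) (FOb (slice j Z ls) l)" for l
      using is_functor_Hom[OF Z fsl] by (simp add: slice_simps)
    fix f l' l'' assume f: "f \<in> Hom Dop l' l''"
    note i = Idt_Dop_pow_Hom[OF l(1)] Idt_Dop_pow_Hom[OF l(2)]
    note if1 = insert_at_Hom_Dop_pow[OF i(1) f, of j] and if2 = insert_at_Hom_Dop_pow[OF i(2) f, of j]
    have "insert_at j (Idt Dop l'') fs \<cdot>\<^bsub>Dop_pow (Suc q)\<^esub> insert_at j f (map (Idt Dop) ks) = insert_at j f fs"
      using insert_at_Comp[OF i(1) fs, of j "Idt Dop l''" f] category.comp_idt_left[OF category_Dop f]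
        category.comp_idt_right[OF category_Dop_pow fs] by simp
    moreover have "insert_at j f (map (Idt Dop) ls) \<cdot>\<^bsub>Dop_pow (Suc q)\<^esub> insert_at j (Idt Dop l') fs = insert_at j f fs"
      using insert_at_Comp[OF fs i(2), of j f "Idt Dop l'"] category.comp_idt_right[OF category_Dop f]
        category.comp_idt_left[OF category_Dop_pow fs] by simp
    ultimately show "FAr Z (insert_at j (Idt Dop l'') fs) \<cdot> FAr (slice j Z ks) f =
        FAr (slice j Z ls) f \<cdot> FAr Z (insert_at j (Idt Dop l') fs)"
      using is_functor_Comp[OF Z if1 fsl] is_functor_Comp[OF Z fsl if2]
      by (simp only: slice_simps(2)[OF f])
  qed
qed

lemma slice_nt:
  assumes e: "\<eta> \<in> Hom (mfun C (Suc q)) F G" and ks: "length ks = q"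
  shows "sfn_map (slice j F ks) (slice j G ks) (\<lambda>l. App \<eta> (insert_at j l ks))"
proof (rule sfn_mapI)
  show "is_functor Dop C (slice j F ks)" "is_functor Dop C (slice j G ks)"
    using is_functor_slice[OF Hom_fun_functor(1)[OF e] ks] is_functor_slice[OF Hom_fun_functor(2)[OF e] ks] .
  show "App \<eta> (insert_at j l ks) \<in> Hom C (FOb (slice j F ks) l) (FOb (slice j G ks) l)" for l
    using Hom_fun_App[OF e, of "insert_at j l ks"] ks by (simp add: slice_simps)
  show "App \<eta> (insert_at j l' ks) \<cdot> FAr (slice j F ks) f = FAr (slice j G ks) f \<cdot> App \<eta> (insert_at j l ks)"
    if f: "f \<in> Hom Dop l l'" for f l l'
    using Hom_fun_nat[OF e insert_at_Hom_Dop_pow[OF Idt_Dop_pow_Hom[OF ks] f]] by (simp only: slice_simps(2)[OF f])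
qed

lemma colim_var_ob_simps:
  "length ks = q \<Longrightarrow> FOb (colim_var_ob C cl (Suc q) j Z) ks = fst (cl (slice j Z ks))"
  "fs \<in> Hom (Dop_pow q) ks ls \<Longrightarrow> FAr (colim_var_ob C cl (Suc q) j Z) fs =
     colim_map (slice j Z ks) (slice j Z ls) (\<lambda>l. FAr Z (insert_at j (Idt Dop l) fs))"
  by (simp_all add: colim_var_ob_def colim_map_def in_Hom Let_def)

lemma is_functor_colim_var_ob:
  assumes Z: "is_functor (Dop_pow (Suc q)) C Z"
  shows "is_functor (Dop_pow q) C (colim_var_ob C cl (Suc q) j Z)"
proof (rule is_functorI, goal_cases)
  case (3 ks)
  then show ?case using Hom_obj(2)[OF cl_Hom[OF is_functor_slice[OF Z, of ks j]]] by (simp add: colim_var_ob_simps)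
next
  case (4 fs ks ls)
  then have l: "length ks = q" "length ls = q" by (auto simp: Hom_pow)
  show ?case using colim_map(1)[OF slice_ar[OF Z 4]] by (simp add: colim_var_ob_simps(1) l colim_var_ob_simps(2)[OF 4])
next
  case (5 ks)
  then have l: "length ks = q" by simp
  have "FAr Z (insert_at j (Idt Dop l) (map (Idt Dop) ks)) = Idt C (FOb (slice j Z ks) l)" for l
    using is_functor_Idt[OF Z, of "insert_at j l ks"] l by (simp add: slice_simps map_insert_at)
  then show ?case
    using colim_map_idt[OF is_functor_slice[OF Z l], of j] l
    by (simp add: colim_var_ob_simps(1) colim_var_ob_simps(2)[OF Idt_Dop_pow_Hom[OF l], simplified])
next
  case (6 fs gs ks ls ms)
  have "FAr Z (insert_at j (Idt Dop l) (gs \<cdot>\<^bsub>Dop_pow q\<^esub> fs)) =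
      FAr Z (insert_at j (Idt Dop l) gs) \<cdot> FAr Z (insert_at j (Idt Dop l) fs)" for l
    using is_functor_Comp[OF Z insert_at_Hom_Dop_pow[OF 6(1) Idt_Dop_Hom, of j l] insert_at_Hom_Dop_pow[OF 6(2) Idt_Dop_Hom]]
      insert_at_Comp[OF 6, of j "Idt Dop l" "Idt Dop l"] category.comp_idt_left[OF category_Dop Idt_Dop_Hom]
    by simp
  then show ?case
    using colim_map_comp[OF slice_ar[OF Z 6(1)] slice_ar[OF Z 6(2)], of j]
    by (simp only: colim_var_ob_simps(2)[OF 6(1)] colim_var_ob_simps(2)[OF 6(2)]
        colim_var_ob_simps(2)[OF category.comp_hom[OF category_Dop_pow 6]])
qed (auto simp: colim_var_ob_def)

lemma colim_var_Ob:
  "is_functor (Dop_pow (Suc q)) C Z \<Longrightarrow> FOb (colim_var C cl (Suc q) j) Z = colim_var_ob C cl (Suc q) j Z"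
  by (simp add: colim_var_def msimp_cat_def)

lemma colim_var_Ar:
  "\<eta> \<in> Hom (mfun C (Suc q)) F G \<Longrightarrow> FAr (colim_var C cl (Suc q) j) \<eta> =
    \<lparr>Src = colim_var_ob C cl (Suc q) j F, Tgt = colim_var_ob C cl (Suc q) j G,
     App = (\<lambda>ks\<in>Obj (Dop_pow q). colim_map (slice j F ks) (slice j G ks) (\<lambda>l. App \<eta> (insert_at j l ks)))\<rparr>"
  by (simp add: colim_var_def msimp_cat_def Hom_fun colim_map_def)

lemma colim_var_Ar_Hom:
  assumes e: "\<eta> \<in> Hom (mfun C (Suc q)) F G"
  shows "FAr (colim_var C cl (Suc q) j) \<eta> \<in>
    Hom (mfun C q) (colim_var_ob C cl (Suc q) j F) (colim_var_ob C cl (Suc q) j G)"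
  unfolding colim_var_Ar[OF e]
proof (rule Hom_funI, goal_cases)
  case (6 ks)
  then show ?case using colim_map(1)[OF slice_nt[OF e, of ks j]] by (simp add: colim_var_ob_simps)
next
  case (7 fs ks ls)
  note fn = Hom_fun_functor[OF e]
  have l: "length ks = q" "length ls = q" using 7 by (auto simp: Hom_pow)
  have "App \<eta> (insert_at j l ls) \<cdot> FAr F (insert_at j (Idt Dop l) fs) =
      FAr G (insert_at j (Idt Dop l) fs) \<cdot> App \<eta> (insert_at j l ks)" for l
    using Hom_fun_nat[OF e insert_at_Hom_Dop_pow[OF 7 Idt_Dop_Hom]] .
  then show ?case
    using colim_map_comp[OF slice_ar[OF fn(1) 7] slice_nt[OF e l(2)], of j]
      colim_map_comp[OF slice_nt[OF e l(1)] slice_ar[OF fn(2) 7], of j] l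
    by (simp add: colim_var_ob_simps(2)[OF 7])
qed (use Hom_fun_functor[OF e] is_functor_colim_var_ob in auto)

lemma is_functor_colim_var:
  "is_functor (mfun C (Suc q)) (mfun C q) (colim_var C cl (Suc q) j)"
proof (rule is_functorI, goal_cases)
  case (3 F)
  then show ?case using is_functor_colim_var_ob by (simp add: colim_var_Ob)
next
  case (4 \<eta> F G)
  then show ?case using colim_var_Ar_Hom[OF 4] Hom_fun_functor[OF 4] by (simp add: colim_var_Ob)
next
  case (5 F)
  then have F: "is_functor (Dop_pow (Suc q)) C F" by simp
  note i = category.idt_hom[OF category_mfun[OF category_axioms] 5]
  have "is_functor (Dop_pow q) C (colim_var_ob C cl (Suc q) j F)" by (rule is_functor_colim_var_ob[OF F])
  then have i': "Idt (mfun C q) (colim_var_ob C cl (Suc q) j F) \<in>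
      Hom (mfun C q) (colim_var_ob C cl (Suc q) j F) (colim_var_ob C cl (Suc q) j F)"
    by (intro category.idt_hom[OF category_mfun[OF category_axioms]]) simp
  have "FAr (colim_var C cl (Suc q) j) (Idt (mfun C (Suc q)) F) =
     Idt (mfun C q) (colim_var_ob C cl (Suc q) j F)"
  proof (rule Hom_fun_eqI[OF colim_var_Ar_Hom[OF i] i'])
    fix ks assume "ks \<in> Obj (Dop_pow q)"
    then have l: "length ks = q" by simp
    then show "App (FAr (colim_var C cl (Suc q) j) (Idt (mfun C (Suc q)) F)) ks =
        App (Idt (mfun C q) (colim_var_ob C cl (Suc q) j F)) ks"
      unfolding colim_var_Ar[OF i] using colim_map_idt[OF is_functor_slice[OF F l], of j]
      by (simp add: colim_var_ob_simps slice_simps)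
  qed
  then show ?case by (simp only: colim_var_Ob[OF F])
next
  case (6 \<eta> \<theta> F G H)
  note FC = category_mfun[OF category_axioms]
  note c = category.comp_hom[OF FC 6]
  show ?case
  proof (rule Hom_fun_eqI[OF colim_var_Ar_Hom[OF c]
        category.comp_hom[OF FC colim_var_Ar_Hom[OF 6(1)] colim_var_Ar_Hom[OF 6(2)]]])
    fix ks assume ks: "ks \<in> Obj (Dop_pow q)"
    then have l: "length ks = q" by simp
    show "App (FAr (colim_var C cl (Suc q) j) (\<theta> \<cdot>\<^bsub>mfun C (Suc q)\<^esub> \<eta>)) ks =
      App (FAr (colim_var C cl (Suc q) j) \<theta> \<cdot>\<^bsub>mfun C q\<^esub> FAr (colim_var C cl (Suc q) j) \<eta>) ks"
      unfolding colim_var_Ar[OF c] colim_var_Ar[OF 6(1)] colim_var_Ar[OF 6(2)]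
      using colim_map_comp[OF slice_nt[OF 6(1) l] slice_nt[OF 6(2) l], of j] ks by simp
  qed
qed (auto simp: colim_var_def msimp_cat_def)

subsection \<open>The canonical isomorphism for one variable\<close>

lemma decs_slice_Ar:
  assumes f: "f \<in> Hom Dop l l'" and ks: "length ks = q"
  shows "FAr (slice j (decs (Suc q) X) ks) f = FAr X (dec_arr (insert_at j f (map (Idt Delta) ks)))"
  using insert_at_Hom_Dop_pow[OF Idt_Dop_pow_Hom[OF ks] f, of j]
  by (simp add: slice_simps(2)[OF f] Hom_Dop_pow decs_Ar)

text \<open>An arrow out of the colimit is recovered from its component at [0]:
  \<open>split_insert\<close> provides a retraction \<rho> and an extra degeneracy by means of a
  neighbouring block, which exists as q > 0. All of this consists of equations in
  \<open>Delta\<close> that X carries over.\<close>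

lemma colimit_decs:
  assumes X: "is_functor Dop C X" and l: "length ks = q" and q: "q > 0" and j: "j \<le> q"
  shows "is_colimit Dop C (slice j (decs (Suc q) X) ks) (FOb X (dec_ob ks)) (\<lambda>l. FAr X (incl_at j l ks))"
proof -
  have ne: "ks \<noteq> []" and j': "j \<le> length ks" using l q j by auto
  define ins where "ins h = dec_arr (insert_at j h (map (Idt Delta) ks))" for h
  have Zo: "FOb (slice j (decs (Suc q) X) ks) l = FOb X (dec_ob (insert_at j l ks))" for l
    using \<open>length ks = q\<close> by (simp add: slice_simps decs_Ob)
  have Za: "FAr (slice j (decs (Suc q) X) ks) h = FAr X (ins h)" if "h \<in> Hom Delta l l'" for h l l'
    using decs_slice_Ar[of h l' l ks q j X] that \<open>length ks = q\<close> by (simp add: ins_def)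
  have iks: "map (Idt Delta) ks \<in> Hom (pow_cat Delta q) ks ks"
    using l by (simp add: Hom_pow Idt_Delta dmono_id)
  have ih: "ins h \<in> Hom Delta (dec_ob (insert_at j l ks)) (dec_ob (insert_at j l' ks))" if "h \<in> Hom Delta l l'" for h l l'
    unfolding ins_def by (rule dec_arr_Hom(1)[OF insert_at_Hom_pow[OF iks that] zero_less_Suc])
  note inc = incl_at_Hom[OF j' ne]
  have inat: "ins h \<odot> incl_at j l ks = incl_at j l' ks" if "h \<in> Hom Delta l l'" for h l l'
    using incl_at_natural[OF iks that j q] dec_arr_idt[OF ne] Delta.comp_idt_right[OF inc] by (simp add: ins_def)
  have coc: "is_cocone Dop C (slice j (decs (Suc q) X) ks) (FOb X (dec_ob ks)) (\<lambda>l. FAr X (incl_at j l ks))"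
    unfolding is_cocone_def
  proof (intro conjI ballI)
    show "FOb X (dec_ob ks) \<in> Obj C" by (rule sfn_Ob[OF X])
    show "FAr X (incl_at j l ks) \<in> Hom C (FOb (slice j (decs (Suc q) X) ks) l) (FOb X (dec_ob ks))" for l
      using sfn_Hom[OF X inc] by (simp add: Zo)
    fix f assume "f \<in> Arr Dop"
    then have f: "f \<in> Hom Delta (Cod Dop f) (Dom Dop f)" by (simp add: in_Hom)
    show "FAr X (incl_at j (Cod Dop f) ks) \<cdot> FAr (slice j (decs (Suc q) X) ks) f = FAr X (incl_at j (Dom Dop f) ks)"
      unfolding Za[OF f] sfn_comp[OF X inc ih[OF f], symmetric] inat[OF f] ..
  qed
  obtain \<rho> where r: "\<rho> \<in> Hom Delta (dec_ob (insert_at j 0 ks)) (dec_ob ks)"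
    "\<rho> \<odot> incl_at j 0 ks = Idt Delta (dec_ob ks)"
    "\<And>l. \<exists>a b t. a \<in> Hom Delta 0 (Suc l) \<and> b \<in> Hom Delta l (Suc l) \<and>
       t \<in> Hom Delta (dec_ob (insert_at j (Suc l) ks)) (dec_ob (insert_at j l ks)) \<and>
       t \<odot> ins a = incl_at j l ks \<odot> \<rho> \<and>
       t \<odot> ins b = Idt Delta (dec_ob (insert_at j l ks))"
    using split_insert[OF j' ne] unfolding ins_def by blast
  show ?thesis
    unfolding is_colimit_def
  proof (intro conjI allI impI)
    show "is_cocone Dop C (slice j (decs (Suc q) X) ks) (FOb X (dec_ob ks)) (\<lambda>l. FAr X (incl_at j l ks))" by (rule coc)
    fix d \<mu> assume m: "is_cocone Dop C (slice j (decs (Suc q) X) ks) d \<mu>"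
    have mh: "\<mu> l \<in> Hom C (FOb X (dec_ob (insert_at j l ks))) d" for l
      using m by (simp add: is_cocone_def Zo)
    have mn: "\<mu> l \<cdot> FAr X (ins h) = \<mu> l'" if "h \<in> Hom Delta l l'" for h l l'
      using m that Za[OF that] by (auto simp: is_cocone_def in_Hom)
    note Xr = sfn_Hom[OF X r(1)]
    \<comment> \<open>Levels 0 and l are linked through level l + 1: the composite of t with the
      join of a is \<rho> followed by the inclusion, and its composite with the join of b is the
      identity.\<close>
    have eq: "\<mu> 0 \<cdot> FAr X \<rho> \<cdot> FAr X (incl_at j l ks) = \<mu> l" for l
    proof -
      obtain a b t where h: "a \<in> Hom Delta 0 (Suc l)" "b \<in> Hom Delta l (Suc l)"
         "t \<in> Hom Delta (dec_ob (insert_at j (Suc l) ks)) (dec_ob (insert_at j l ks))"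
        and t: "t \<odot> ins a = incl_at j l ks \<odot> \<rho>"
         "t \<odot> ins b = Idt Delta (dec_ob (insert_at j l ks))"
        using r(3) by blast
      have "\<mu> 0 \<cdot> FAr X \<rho> \<cdot> FAr X (incl_at j l ks) = \<mu> 0 \<cdot> FAr X (incl_at j l ks \<odot> \<rho>)"
        using comp_assoc[OF sfn_Hom[OF X inc] Xr mh] sfn_comp[OF X r(1) inc] by simp
      also have "\<dots> = \<mu> 0 \<cdot> (FAr X (ins a) \<cdot> FAr X t)"
        using sfn_comp[OF X ih[OF h(1)] h(3)] t(1) by simp
      also have "\<dots> = \<mu> (Suc l) \<cdot> FAr X t"
        using comp_assoc[OF sfn_Hom[OF X h(3)] sfn_Hom[OF X ih[OF h(1)]] mh] mn[OF h(1)] by simp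
      also have "\<dots> = \<mu> l \<cdot> (FAr X (ins b) \<cdot> FAr X t)"
        using comp_assoc[OF sfn_Hom[OF X h(3)] sfn_Hom[OF X ih[OF h(2)]] mh] mn[OF h(2)] by simp
      also have "\<dots> = \<mu> l"
        using sfn_comp[OF X ih[OF h(2)] h(3)] t(2) sfn_idt[OF X] comp_idt_right[OF mh, of l] by (simp flip: sfn_comp)
      finally show ?thesis .
    qed
    show "\<exists>!u. u \<in> Hom C (FOb X (dec_ob ks)) d \<and> (\<forall>l\<in>Obj Dop. u \<cdot> FAr X (incl_at j l ks) = \<mu> l)"
    proof (rule ex1I[of _ "\<mu> 0 \<cdot> FAr X \<rho>"])
      show "\<mu> 0 \<cdot> FAr X \<rho> \<in> Hom C (FOb X (dec_ob ks)) d \<and> (\<forall>l\<in>Obj Dop. \<mu> 0 \<cdot> FAr X \<rho> \<cdot> FAr X (incl_at j l ks) = \<mu> l)"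
        using comp_hom[OF Xr mh] eq by simp
      fix w assume w: "w \<in> Hom C (FOb X (dec_ob ks)) d \<and> (\<forall>l\<in>Obj Dop. w \<cdot> FAr X (incl_at j l ks) = \<mu> l)"
      \<comment> \<open>The inclusion for [0] is split by \<rho>, so w is determined by its
        component there.\<close>
      then have "w \<cdot> (FAr X (incl_at j 0 ks) \<cdot> FAr X \<rho>) = \<mu> 0 \<cdot> FAr X \<rho>"
        using comp_assoc[OF Xr sfn_Hom[OF X inc], of w d] by simp
      then show "w = \<mu> 0 \<cdot> FAr X \<rho>"
        using sfn_comp[OF X inc r(1)] r(2) sfn_idt[OF X] comp_idt_right[of w "FOb X (dec_ob ks)" d] w
        by (simp flip: sfn_comp)
    qed
  qed
qed

lemma precomp_dec: "is_functor Dop C X \<Longrightarrow> FOb (dec_pull C p) X = decs p X"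
  by (simp add: dec_pull_def precomp_simps)

lemma can_var_App:
  assumes X: "is_functor Dop C X" and l: "length ks = q" and q: "q > 0" and j: "j \<le> q"
  shows "iso_arr C (fst (cl (slice j (decs (Suc q) X) ks))) (FOb X (dec_ob ks)) (App (can_var C cl (Suc q) j X) ks)"
    and "App (can_var C cl (Suc q) j X) ks \<cdot> snd (cl (slice j (decs (Suc q) X) ks)) i = FAr X (incl_at j i ks)"
proof -
  have D: "is_functor Dop C (slice j (decs (Suc q) X) ks)"
    using is_functor_slice[OF is_functor_decs[OF X zero_less_Suc] l] .
  have eq: "App (can_var C cl (Suc q) j X) ks = colim_desc Dop C (cl (slice j (decs (Suc q) X) ks))
      (FOb X (dec_ob ks)) (\<lambda>l. FAr X (incl_at j l ks))"
    using l by (simp add: can_var_def precomp_dec[OF X])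
  note c = colimit_decs[OF X l q j]
  show "iso_arr C (fst (cl (slice j (decs (Suc q) X) ks))) (FOb X (dec_ob ks)) (App (can_var C cl (Suc q) j X) ks)"
    unfolding eq by (rule iso_arr_colim_desc[OF category_Dop D cl_colimit[OF D] c])
  show "App (can_var C cl (Suc q) j X) ks \<cdot> snd (cl (slice j (decs (Suc q) X) ks)) i = FAr X (incl_at j i ks)"
    unfolding eq using colim_desc_unique(2)[OF cl_colimit[OF D], of "FOb X (dec_ob ks)"] c
    by (simp add: is_colimit_def)
qed

text \<open>Invertibility holds componentwise, by comparison of two colimits of one diagram.
  Naturality is checked on the injections, where it is \<open>incl_at_natural\<close> with an
  identity inserted.\<close>

lemma can_var_iso:
  assumes X: "is_functor Dop C X" and q: "q > 0" and j: "j \<le> q"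
  shows "iso_arr (mfun C q) (FOb (colim_var C cl (Suc q) j) (decs (Suc q) X)) (decs q X)
    (can_var C cl (Suc q) j X)"
proof (rule iso_arr_fun_cat[OF category_Dop_pow category_axioms])
  define Z where "Z = decs (Suc q) X"
  have Z: "is_functor (Dop_pow (Suc q)) C Z" unfolding Z_def by (rule is_functor_decs[OF X zero_less_Suc])
  note Zc = colim_var_Ob[OF Z]
  show "iso_arr C (FOb (FOb (colim_var C cl (Suc q) j) (decs (Suc q) X)) ks) (FOb (decs q X) ks)
      (App (can_var C cl (Suc q) j X) ks)" if "ks \<in> Obj (Dop_pow q)" for ks
    using can_var_App(1)[OF X _ q j, of ks] that
    by (simp add: Zc[unfolded Z_def] colim_var_ob_simps decs_Ob)
  show "can_var C cl (Suc q) j X \<in> Hom (mfun C q) (FOb (colim_var C cl (Suc q) j) (decs (Suc q) X)) (decs q X)"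
    unfolding Z_def[symmetric] Zc
  proof (rule Hom_funI[OF is_functor_colim_var_ob[OF Z] is_functor_decs[OF X q]])
    show "Src (can_var C cl (Suc q) j X) = colim_var_ob C cl (Suc q) j Z"
      using Zc by (simp add: can_var_def precomp_dec[OF X] Z_def)
    show "Tgt (can_var C cl (Suc q) j X) = decs q X" by (simp add: can_var_def precomp_dec[OF X])
    show "App (can_var C cl (Suc q) j X) \<in> extensional (Obj (Dop_pow q))" by (simp add: can_var_def)
    show "App (can_var C cl (Suc q) j X) ks \<in> Hom C (FOb (colim_var_ob C cl (Suc q) j Z) ks) (FOb (decs q X) ks)"
      if "ks \<in> Obj (Dop_pow q)" for ks
      using iso_arr_Hom[OF can_var_App(1)[OF X _ q j, of ks]] that by (simp add: colim_var_ob_simps decs_Ob Z_def)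
    fix fs ks ls assume fs: "fs \<in> Hom (Dop_pow q) ks ls"
    then have fs': "fs \<in> Hom (pow_cat Delta q) ls ks" by (simp add: Hom_Dop_pow)
    have l: "length ks = q" "length ls = q" using fs by (auto simp: Hom_pow)
    have ne: "ks \<noteq> []" "ls \<noteq> []" using l q by auto
    note ck = can_var_App[OF X l(1) q j, folded Z_def] and cl = can_var_App[OF X l(2) q j, folded Z_def]
    note ckh = iso_arr_Hom[OF ck(1)] and clh = iso_arr_Hom[OF cl(1)]
    note D = is_functor_slice[OF Z l(1)] is_functor_slice[OF Z l(2)]
    note m = colim_map[OF slice_ar[OF Z fs]]
    note Xf = sfn_Hom[OF X dec_arr_Hom(1)[OF fs' q]]
    have "App (can_var C cl (Suc q) j X) ls \<cdot>
        colim_map (slice j Z ks) (slice j Z ls) (\<lambda>l. FAr Z (insert_at j (Idt Dop l) fs)) =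
        FAr X (dec_arr fs) \<cdot> App (can_var C cl (Suc q) j X) ks"
    proof (rule cl_ext[OF D(1) comp_hom[OF m(1) clh] comp_hom[OF ckh Xf]])
      fix i
      have ii: "Idt Delta i \<in> Hom Delta i i" by (simp add: Idt_Delta dmono_id)
      note ih = insert_at_Hom_pow[OF fs' ii, of j]
      have "App (can_var C cl (Suc q) j X) ls \<cdot>
        colim_map (slice j Z ks) (slice j Z ls) (\<lambda>l. FAr Z (insert_at j (Idt Dop l) fs)) \<cdot> snd (cl (slice j Z ks)) i =
        FAr X (incl_at j i ls) \<cdot> FAr Z (insert_at j (Idt Dop i) fs)"
        using comp_assoc[OF cl_Hom[OF D(1)] m(1) clh, of i] m(2) cl(2)
          comp_assoc[OF sfn_mapD(3)[OF slice_ar[OF Z fs]] cl_Hom[OF D(2)] clh, of i] by simp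
      also have "\<dots> = FAr X (incl_at j i ls) \<cdot> FAr X (dec_arr (insert_at j (Idt Delta i) fs))"
        using decs_Ar[OF ih, of X] by (simp add: Z_def)
      also have "\<dots> = FAr X (dec_arr fs) \<cdot> FAr X (incl_at j i ks)"
        using sfn_comp[OF X incl_at_Hom[of j ls i] dec_arr_Hom(1)[OF ih]] incl_at_natural[OF fs' ii j q]
          sfn_comp[OF X dec_arr_Hom(1)[OF fs' q] incl_at_Hom[of j ks i]] l j ne by simp
      also have "\<dots> = FAr X (dec_arr fs) \<cdot> App (can_var C cl (Suc q) j X) ks \<cdot> snd (cl (slice j Z ks)) i"
        using comp_assoc[OF cl_Hom[OF D(1)] ckh Xf] ck(2) by simp
      finally show "App (can_var C cl (Suc q) j X) ls \<cdot>
        colim_map (slice j Z ks) (slice j Z ls) (\<lambda>l. FAr Z (insert_at j (Idt Dop l) fs)) \<cdot> snd (cl (slice j Z ks)) i =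
        FAr X (dec_arr fs) \<cdot> App (can_var C cl (Suc q) j X) ks \<cdot> snd (cl (slice j Z ks)) i" .
    qed
    then show "App (can_var C cl (Suc q) j X) ls \<cdot> FAr (colim_var_ob C cl (Suc q) j Z) fs =
        FAr (decs q X) fs \<cdot> App (can_var C cl (Suc q) j X) ks"
      using decs_Ar[OF fs', of X] by (simp add: colim_var_ob_simps(2)[OF fs])
  qed
qed

text \<open>On the injections both sides become the two ways around the naturality square of e at
  the inclusion, and \<open>label_arr_incl_at\<close> identifies the label obtained. Here a colimit
  turns into restriction along the injection that omits j.\<close>

lemma can_var_label_nt:
  assumes X: "is_functor Dop C X" and Y: "is_functor Dop C Y" and e: "all_family C X Y n e"
    and L: "labels n L" "length L = Suc q" and q: "q > 0" and j: "j \<le> q"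
  shows "can_var C cl (Suc q) j Y \<cdot>\<^bsub>mfun C q\<^esub> FAr (colim_var C cl (Suc q) j) (label_nt n L X Y e) =
    label_nt n (remove_at j L) X Y e \<cdot>\<^bsub>mfun C q\<^esub> can_var C cl (Suc q) j X"
proof -
  note FC = category_mfun[OF category_axioms]
  note lr = labels_remove_at[OF L q j]
  define ZX where "ZX = decs (Suc q) X"
  define ZY where "ZY = decs (Suc q) Y"
  have Z: "is_functor (Dop_pow (Suc q)) C ZX" "is_functor (Dop_pow (Suc q)) C ZY"
    unfolding ZX_def ZY_def by (rule is_functor_decs[OF X zero_less_Suc] is_functor_decs[OF Y zero_less_Suc])+
  note cX = category.iso_arr_Hom[OF FC can_var_iso[OF X q j, folded ZX_def, unfolded colim_var_Ob[OF Z(1)]]]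
    and cY = category.iso_arr_Hom[OF FC can_var_iso[OF Y q j, folded ZY_def, unfolded colim_var_Ob[OF Z(2)]]]
  note eL = label_nt_Hom[OF X Y e L(1), unfolded L(2), folded ZX_def ZY_def]
  note eR = label_nt_Hom[OF X Y e lr(1), unfolded lr(2)]
  show ?thesis
  proof (rule Hom_fun_eqI[OF category.comp_hom[OF FC colim_var_Ar_Hom[OF eL] cY] category.comp_hom[OF FC cX eR]])
    fix ks assume ks: "ks \<in> Obj (Dop_pow q)"
    then have l: "length ks = q" by simp
    have ne: "ks \<noteq> []" and j': "j \<le> length ks" using l q j by auto
    note ax = can_var_App[OF X l q j, folded ZX_def] and ay = can_var_App[OF Y l q j, folded ZY_def]
    note axh = iso_arr_Hom[OF ax(1)] and ayh = iso_arr_Hom[OF ay(1)]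
    note sl = slice_nt[OF eL l, of j]
    note m = colim_map[OF sl]
    note er = nat_family_Hom[OF e label_arr_Hom[OF lr(1)], of ks, unfolded lr(2), OF l TrueI]
    have "App (can_var C cl (Suc q) j Y) ks \<cdot>
       colim_map (slice j ZX ks) (slice j ZY ks) (\<lambda>l. App (label_nt n L X Y e) (insert_at j l ks)) =
       e (dec_ob ks) (label_arr n (remove_at j L) ks) \<cdot> App (can_var C cl (Suc q) j X) ks"
    proof (rule cl_ext[OF sfn_mapD(1)[OF sl] comp_hom[OF m(1) ayh] comp_hom[OF axh er]])
      fix i
      have li: "length (insert_at j i ks) = length L" using l L(2) by simp
      note inc = incl_at_Hom[OF j' ne, of i]
      have "App (can_var C cl (Suc q) j Y) ks \<cdot>
         colim_map (slice j ZX ks) (slice j ZY ks) (\<lambda>l. App (label_nt n L X Y e) (insert_at j l ks)) \<cdot> snd (cl (slice j ZX ks)) i =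
         FAr Y (incl_at j i ks) \<cdot> e (dec_ob (insert_at j i ks)) (label_arr n L (insert_at j i ks))"
        using comp_assoc[OF cl_Hom[OF sfn_mapD(1)[OF sl]] m(1) ayh, of i] m(2) ay(2)
          comp_assoc[OF sfn_mapD(3)[OF sl] cl_Hom[OF sfn_mapD(2)[OF sl]] ayh, of i] label_nt_App[OF li, of n X Y e] by simp
      also have "\<dots> = e (dec_ob ks) (label_arr n (remove_at j L) ks) \<cdot> FAr X (incl_at j i ks)"
        using nat_family_nat[OF e inc label_arr_Hom[OF L(1) li] label_arr_incl_at[OF L q j l]] by simp
      also have "\<dots> = e (dec_ob ks) (label_arr n (remove_at j L) ks) \<cdot> App (can_var C cl (Suc q) j X) ks \<cdot> snd (cl (slice j ZX ks)) i"
        using comp_assoc[OF cl_Hom[OF sfn_mapD(1)[OF sl]] axh er] ax(2) by simp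
      finally show "App (can_var C cl (Suc q) j Y) ks \<cdot>
         colim_map (slice j ZX ks) (slice j ZY ks) (\<lambda>l. App (label_nt n L X Y e) (insert_at j l ks)) \<cdot> snd (cl (slice j ZX ks)) i =
         e (dec_ob ks) (label_arr n (remove_at j L) ks) \<cdot> App (can_var C cl (Suc q) j X) ks \<cdot> snd (cl (slice j ZX ks)) i" .
    qed
    then show "App (can_var C cl (Suc q) j Y \<cdot>\<^bsub>mfun C q\<^esub> FAr (colim_var C cl (Suc q) j) (label_nt n L X Y e)) ks =
      App (label_nt n (remove_at j L) X Y e \<cdot>\<^bsub>mfun C q\<^esub> can_var C cl (Suc q) j X) ks"
      using ks l lr(2) by (simp add: colim_var_Ar[OF eL] label_nt_App)
  qed
qed

end

section \<open>Iterated colimits and the labels that remain\<close>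

subsection \<open>Several variables\<close>

text \<open>In a decreasing list each label still sits at the position equal to its value when its
  turn comes. The suffix \<open>xs\<close> absorbs the labels above the removed one, so that the
  induction continues below it.\<close>

lemma fold_remove_at:
  assumes "sorted_wrt (>) js" "\<forall>j\<in>set js. j < q"
  shows "fold remove_at js ([0..<q] @ xs) = filter (\<lambda>i. i \<notin> set js) [0..<q] @ xs"
  using assms
proof (induction js arbitrary: q xs)
  case (Cons j js)
  have "[0..<q] = [0..<j] @ j # [Suc j..<q]"
    using Cons.prems(2) upt_add_eq_append[of 0 j "q - j"] upt_conv_Cons[of j q] by simp
  moreover have "filter (\<lambda>i. i \<notin> set (j # js)) [Suc j..<q] = [Suc j..<q]"
    using Cons.prems(1) by (auto intro!: filter_True)
  moreover have "filter (\<lambda>i. i \<notin> set (j # js)) [0..<j] = filter (\<lambda>i. i \<notin> set js) [0..<j]"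
    by (rule filter_cong) auto
  ultimately show ?case
    using Cons.IH[of j "[Suc j..<q] @ xs"] Cons.prems by (simp add: remove_at_def)
qed simp

text \<open>The value of \<alpha> at 0 is hit, so fewer than m + 1 variables are eliminated and at
  least one is left at each stage, as the comparison of colimits requires.\<close>

lemma missed_props:
  assumes "\<alpha> \<in> Hom Delta n m"
  shows "sorted_wrt (>) (missed \<alpha>)" "\<forall>j\<in>set (missed \<alpha>). j < Suc m"
    "fold remove_at (missed \<alpha>) [0..<Suc m] = hit \<alpha>" "Suc m - length (missed \<alpha>) = length (hit \<alpha>)"
    "length (missed \<alpha>) < Suc m" "labels m (hit \<alpha>)"
proof -
  obtain a where a: "\<alpha> = (n, m, a)" using assms by (cases \<alpha>) (auto simp: in_Hom)
  have a0: "a 0 \<le> m" using dmonoD(1)[OF Hom_Delta_dfun(2)[OF assms], of 0] by (simp add: a dfun_def)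
  have "sorted_wrt (>) (rev [0..<Suc m])" by (subst sorted_wrt_rev) (simp del: upt_Suc)
  then show 1: "sorted_wrt (>) (missed \<alpha>)" unfolding a missed.simps by (rule sorted_wrt_filter)
  show 2: "\<forall>j\<in>set (missed \<alpha>). j < Suc m" by (auto simp: a)
  have "filter (\<lambda>i. i \<notin> set (missed \<alpha>)) [0..<Suc m] = hit \<alpha>"
    unfolding a hit.simps missed.simps by (rule filter_cong) auto
  then show "fold remove_at (missed \<alpha>) [0..<Suc m] = hit \<alpha>"
    using fold_remove_at[OF 1 2, of "[]"] by simp
  have "length (hit \<alpha>) + length (missed \<alpha>) = Suc m"
    unfolding a hit.simps missed.simps rev_filter[symmetric] length_rev
    using sum_length_filter_compl[of "\<lambda>j. j \<in> a ` {..n}" "[0..<Suc m]"] by (simp del: upt_Suc)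
  moreover have "a 0 \<in> set (hit \<alpha>)" using a0 by (auto simp: a simp del: upt_Suc)
  then have "hit \<alpha> \<noteq> []" by (metis empty_iff list.set(1))
  ultimately show "Suc m - length (missed \<alpha>) = length (hit \<alpha>)" "length (missed \<alpha>) < Suc m"
    by (auto simp flip: length_greater_0_conv)
  show "labels m (hit \<alpha>)"
    using \<open>hit \<alpha> \<noteq> []\<close> unfolding labels_def a hit.simps
    by (auto simp del: upt_Suc intro!: sorted_wrt_filter)
qed

context dop_colimits
begin

lemma is_functor_colim_vars:
  assumes "sorted_wrt (>) js" "\<forall>j\<in>set js. j < p"
  shows "is_functor (msimp_cat C p) (msimp_cat C (p - length js)) (colim_vars C cl p js)"
  using assms
proof (induction js arbitrary: p)
  case Nil
  then show ?case
    using is_functor_id[OF category_mfun[OF category_axioms]] by (simp add: msimp_cat_def)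
next
  case (Cons j js)
  then obtain q where q: "p = Suc q" by (cases p) auto
  have "is_functor (msimp_cat C q) (msimp_cat C (q - length js)) (colim_vars C cl q js)"
    by (rule Cons.IH) (use Cons.prems q in force)+
  then show ?case
    using is_functor_comp[OF category_mfun[OF category_axioms] is_functor_colim_var]
    by (simp add: q msimp_cat_def)
qed

text \<open>The functor of the remaining colimits preserves the isomorphism belonging to the first
  variable.\<close>

lemma can_vars_iso:
  assumes "is_functor Dop C X" "sorted_wrt (>) js" "\<forall>j\<in>set js. j < p" "length js < p"
  shows "iso_arr (mfun C (p - length js)) (FOb (colim_vars C cl p js) (decs p X))
    (decs (p - length js) X) (can_vars C cl p js X)"
  using assms(2-4)
proof (induction js arbitrary: p)
  case Nil
  then show ?case
    using category.iso_arr_idt[OF category_mfun[OF category_axioms], of "decs p X" p]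
      is_functor_decs[OF assms(1), of p]
    by (simp add: id_fn_def msimp_cat_def precomp_dec[OF assms(1)])
next
  case (Cons j js)
  then obtain q where q: "p = Suc q" by (cases p) auto
  have js: "sorted_wrt (>) js" "\<forall>j\<in>set js. j < q" "length js < q" and j: "j \<le> q" "q > 0"
    using Cons.prems q by force+
  note FC = category_mfun[OF category_axioms]
  have Z: "is_functor (Dop_pow p) C (decs p X)" using is_functor_decs[OF assms(1)] q by simp
  have F: "is_functor (mfun C q) (mfun C (q - length js)) (colim_vars C cl q js)"
    using is_functor_colim_vars[OF js(1,2)] by (simp add: msimp_cat_def)
  show ?case
    using category.iso_arr_comp[OF FC iso_arr_functor[OF F can_var_iso[OF assms(1) j(2,1)] FC] Cons.IH[OF js]] Z
    by (simp add: q comp_fn_def msimp_cat_def)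
qed

text \<open>The square for the first variable is mapped by the functor of the remaining colimits and
  pasted with the square of the induction hypothesis. The last two conjuncts make sure that the
  transformation reached has the expected source and target.\<close>

lemma can_vars_label_nt:
  assumes X: "is_functor Dop C X" and Y: "is_functor Dop C Y" and e: "all_family C X Y n e"
    and "labels n L" "length L = p" "sorted_wrt (>) js" "\<forall>j\<in>set js. j < p" "length js < p"
  shows "can_vars C cl p js Y \<cdot>\<^bsub>mfun C (p - length js)\<^esub>
      FAr (colim_vars C cl p js) (label_nt n L X Y e) =
    label_nt n (fold remove_at js L) X Y e \<cdot>\<^bsub>mfun C (p - length js)\<^esub> can_vars C cl p js X
    \<and> labels n (fold remove_at js L) \<and> length (fold remove_at js L) = p - length js"
  using assms(4-)
proof (induction js arbitrary: p L)
  case Nil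
  note FC = category_mfun[OF category_axioms, of p]
  have l: "label_nt n L X Y e \<in> Hom (mfun C p) (decs p X) (decs p Y)"
    using label_nt_Hom[OF X Y e Nil(1)] Nil(2) by simp
  then have "label_nt n L X Y e \<in> Arr (mfun C p)" by (simp only: in_Hom)
  then show ?case
    using category.comp_idt_left[OF FC l] category.comp_idt_right[OF FC l] Nil
    by (simp add: id_fn_def msimp_cat_def precomp_dec[OF X] precomp_dec[OF Y] del: fun_cat_simps)
next
  case (Cons j js)
  then obtain q where q: "p = Suc q" by (cases p) auto
  have js: "sorted_wrt (>) js" "\<forall>j\<in>set js. j < q" "length js < q" and j: "j \<le> q" "q > 0"
    using Cons.prems q by force+
  have L: "length L = Suc q" using Cons.prems q by simp
  define r where "r = q - length js"
  note FCq = category_mfun[OF category_axioms, of q]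
    and FCr = category_mfun[OF category_axioms, of r]
  note lr = labels_remove_at[OF Cons.prems(1) L j(2,1)]
  note IH = Cons.IH[OF lr js, folded r_def]
  define V where "V = colim_vars C cl q js"
  have F: "is_functor (mfun C q) (mfun C r) V"
    using is_functor_colim_vars[OF js(1,2)] by (simp add: msimp_cat_def V_def r_def)
  have eL: "label_nt n L X Y e \<in> Hom (mfun C (Suc q)) (decs (Suc q) X) (decs (Suc q) Y)"
    using label_nt_Hom[OF X Y e Cons.prems(1)] L by simp
  have eR: "label_nt n (remove_at j L) X Y e \<in> Hom (mfun C q) (decs q X) (decs q Y)"
    using label_nt_Hom[OF X Y e lr(1)] lr(2) by simp
  have eS: "label_nt n (fold remove_at js (remove_at j L)) X Y e \<in> Hom (mfun C r) (decs r X) (decs r Y)"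
    using label_nt_Hom[OF X Y e, of "fold remove_at js (remove_at j L)"] IH by simp
  note a = is_functor_Hom[OF is_functor_colim_var eL, of j]
  note cX = category.iso_arr_Hom[OF FCq can_var_iso[OF X j(2,1)]]
    and cY = category.iso_arr_Hom[OF FCq can_var_iso[OF Y j(2,1)]]
  note rX = category.iso_arr_Hom[OF FCr can_vars_iso[OF X js, folded r_def V_def]]
    and rY = category.iso_arr_Hom[OF FCr can_vars_iso[OF Y js, folded r_def V_def]]
  note VcX = is_functor_Hom[OF F cX] and VcY = is_functor_Hom[OF F cY] and Va = is_functor_Hom[OF F a]
    and VeR = is_functor_Hom[OF F eR]
  let ?c = "\<lambda>g f. g \<cdot>\<^bsub>mfun C r\<^esub> f"
  have 1: "?c (?c (can_vars C cl q js Y) (FAr V (can_var C cl (Suc q) j Y)))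
       (FAr V (FAr (colim_var C cl (Suc q) j) (label_nt n L X Y e))) =
     ?c (can_vars C cl q js Y) (FAr V (label_nt n (remove_at j L) X Y e \<cdot>\<^bsub>mfun C q\<^esub> can_var C cl (Suc q) j X))"
    using category.comp_assoc[OF FCr Va VcY rY] is_functor_Comp[OF F a cY]
      can_var_label_nt[OF X Y e Cons.prems(1) L j(2,1)] by (simp del: fun_cat_simps)
  have 2: "\<dots> = ?c (label_nt n (fold remove_at js (remove_at j L)) X Y e)
      (?c (can_vars C cl q js X) (FAr V (can_var C cl (Suc q) j X)))"
    using is_functor_Comp[OF F cX eR] category.comp_assoc[OF FCr VcX VeR rY]
      IH[folded V_def] category.comp_assoc[OF FCr VcX rX eS] by (simp del: fun_cat_simps)
  have V: "FAr (colim_vars C cl p (j # js)) (label_nt n L X Y e) =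
      FAr V (FAr (colim_var C cl (Suc q) j) (label_nt n L X Y e))"
    using eL by (simp add: comp_fn_def q msimp_cat_def V_def in_Hom del: fun_cat_simps)
  have "can_vars C cl p (j # js) Z =
      ?c (can_vars C cl q js Z) (FAr V (can_var C cl (Suc q) j Z))" for Z
    by (simp add: q V_def r_def msimp_cat_def)
  then show ?case using 1 2 IH V by (simp only: q r_def length_Cons diff_Suc_Suc fold_Cons o_apply simp_thms)
qed

end

section \<open>Strict compatibility of joins with fibres\<close>

subsection \<open>Pulling back along the fibres\<close>

text \<open>A sorted sequence is cut by its values into consecutive intervals; the induction on m
  appends one of them at a time.\<close>

lemma concat_fibres:
  assumes "sorted (map a ys)"
  shows "concat (map (\<lambda>j. filter (\<lambda>i. a i = j) ys) [0..<m]) = filter (\<lambda>i. a i < (m :: nat)) ys"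
proof (induction m)
  case (Suc m)
  have "filter (\<lambda>i. a i < m) ys @ filter (\<lambda>i. a i = m) ys = filter (\<lambda>i. a i < Suc m) ys"
    using assms
  proof (induction ys)
    case (Cons y ys)
    moreover have "filter (\<lambda>i. a i < m) ys = []" if "a y \<ge> m"
      using Cons.prems that by (auto simp: filter_empty_conv)
    ultimately show ?case by auto
  qed simp
  then show ?case using Suc by simp
qed simp

lemma concat_map_filter:
  "(\<And>x. x \<in> set xs \<Longrightarrow> \<not> P x \<Longrightarrow> f x = []) \<Longrightarrow> concat (map f (filter P xs)) = concat (map f xs)"
  by (induction xs) auto

definition fib_ind :: "darr \<Rightarrow> nat \<Rightarrow> nat list" where
  "fib_ind \<alpha> j = filter (\<lambda>i. dfun \<alpha> i = j) [0..<Suc (Dom Delta \<alpha>)]"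

lemma fibre_sub_eq: "fibre_sub \<alpha> j xs = map (nth xs) (fib_ind \<alpha> j)"
  by (cases \<alpha>) (simp add: fib_ind_def dfun_def)

lemma hit_eq: "hit \<alpha> = filter (\<lambda>j. j \<in> dfun \<alpha> ` {..Dom Delta \<alpha>}) [0..<Suc (Cod Delta \<alpha>)]"
  by (cases \<alpha>) (simp add: dfun_def)

lemma fib_ind_bound: "i \<in> set (fib_ind \<alpha> j) \<Longrightarrow> i < Suc (Dom Delta \<alpha>)"
  by (auto simp: fib_ind_def simp del: upt_Suc)

lemma fib_ind_not_Nil: "j \<in> set (hit \<alpha>) \<Longrightarrow> fib_ind \<alpha> j \<noteq> []"
  by (auto simp: hit_eq fib_ind_def filter_empty_conv simp del: upt_Suc)

lemma fibre_sub_not_Nil: "j \<in> set (hit \<alpha>) \<Longrightarrow> fibre_sub \<alpha> j xs \<noteq> []"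
  by (simp add: fibre_sub_eq fib_ind_not_Nil)

text \<open>Fibres of a monotone map are consecutive intervals, and empty ones contribute nothing to
  the concatenation.\<close>

lemma concat_fib_ind:
  assumes "\<alpha> \<in> Hom Delta n m"
  shows "concat (map (fib_ind \<alpha>) (hit \<alpha>)) = [0..<Suc n]"
proof -
  note ad = Hom_Delta_dfun(2)[OF assms]
  have dc: "Dom Delta \<alpha> = n" "Cod Delta \<alpha> = m" using assms by (auto simp: in_Hom)
  have s: "sorted (map (dfun \<alpha>) [0..<Suc n])"
    using dmonoD(2)[OF ad] by (auto simp: sorted_iff_nth_mono simp del: upt_Suc)
  have "concat (map (fib_ind \<alpha>) (hit \<alpha>)) = concat (map (fib_ind \<alpha>) [0..<Suc m])"
    unfolding hit_eq dc
    by (rule concat_map_filter) (force simp: fib_ind_def filter_empty_conv dc simp del: upt_Suc)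
  also have "\<dots> = filter (\<lambda>i. dfun \<alpha> i < Suc m) [0..<Suc n]"
    using concat_fibres[OF s, of "Suc m"] by (simp add: fib_ind_def[abs_def] dc del: upt_Suc)
  also have "\<dots> = [0..<Suc n]"
    using dmonoD(1)[OF ad] by (intro filter_True) (auto simp: less_Suc_eq_le simp del: upt_Suc)
  finally show ?thesis .
qed

lemma concat_fibre_sub:
  assumes "\<alpha> \<in> Hom Delta n m" "length xs = Suc n"
  shows "concat (map (\<lambda>j. fibre_sub \<alpha> j xs) (hit \<alpha>)) = xs"
proof -
  have "concat (map (\<lambda>j. fibre_sub \<alpha> j xs) (hit \<alpha>)) = map (nth xs) (concat (map (fib_ind \<alpha>) (hit \<alpha>)))"
    by (simp add: fibre_sub_eq map_concat o_def)
  then show ?thesis using concat_fib_ind[OF assms(1)] map_nth[of xs] assms(2) by simp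
qed

lemma hit_not_Nil: "\<alpha> \<in> Hom Delta n m \<Longrightarrow> hit \<alpha> \<noteq> []"
  using missed_props(6) by (auto simp: labels_def)

text \<open>By associativity, joining within the fibres and then joining the results is literally
  the plain join. So \<open>pull_fibres\<close> carries dec-pullbacks to dec-pullbacks by an
  equality of functors, and only colimits contribute to \<open>F_can\<close>.\<close>

lemma dec_fibres_dec:
  assumes "\<alpha> \<in> Hom Delta n m"
  shows "length ks = Suc n \<Longrightarrow> dec_ob (map (\<lambda>j. dec_ob (fibre_sub \<alpha> j ks)) (hit \<alpha>)) = dec_ob ks"
    and "length fs = Suc n \<Longrightarrow> dec_arr (map (\<lambda>j. dec_arr (fibre_sub \<alpha> j fs)) (hit \<alpha>)) = dec_arr fs"
proof -
  note ne = hit_not_Nil[OF assms] fibre_sub_not_Nil[of _ \<alpha>]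
  show "dec_ob (map (\<lambda>j. dec_ob (fibre_sub \<alpha> j ks)) (hit \<alpha>)) = dec_ob ks" if "length ks = Suc n"
  proof -
    have "dec_ob (concat (map (\<lambda>j. fibre_sub \<alpha> j ks) (hit \<alpha>))) =
        dec_ob (map dec_ob (map (\<lambda>j. fibre_sub \<alpha> j ks) (hit \<alpha>)))"
      by (rule dec_ob_concat) (use ne in auto)
    then show ?thesis by (simp add: concat_fibre_sub[OF assms that] o_def)
  qed
  show "dec_arr (map (\<lambda>j. dec_arr (fibre_sub \<alpha> j fs)) (hit \<alpha>)) = dec_arr fs" if "length fs = Suc n"
  proof -
    have "dec_arr (concat (map (\<lambda>j. fibre_sub \<alpha> j fs) (hit \<alpha>))) =
        dec_arr (map dec_arr (map (\<lambda>j. fibre_sub \<alpha> j fs) (hit \<alpha>)))"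
      by (rule dec_arr_concat) (use ne in auto)
    then show ?thesis by (simp add: concat_fibre_sub[OF assms that] o_def)
  qed
qed

lemma fibre_sub_Hom:
  assumes "fs \<in> Hom (pow_cat D (Suc (Dom Delta \<alpha>))) ks ls"
  shows "fibre_sub \<alpha> j fs \<in> Hom (pow_cat D (length (fib_ind \<alpha> j))) (fibre_sub \<alpha> j ks) (fibre_sub \<alpha> j ls)"
  using assms fib_ind_bound[OF nth_mem] by (auto simp: Hom_pow fibre_sub_eq)

lemma dec_fibres_simps:
  "length ks = Suc (Dom Delta \<alpha>) \<Longrightarrow> FOb (dec_fibres \<alpha>) ks = map (\<lambda>j. dec_ob (fibre_sub \<alpha> j ks)) (hit \<alpha>)"
  "fs \<in> Hom (pow_cat Delta (Suc (Dom Delta \<alpha>))) ks ls \<Longrightarrow>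
    FAr (dec_fibres \<alpha>) fs = map (\<lambda>j. dec_arr (fibre_sub \<alpha> j fs)) (hit \<alpha>)"
  by (simp_all add: dec_fibres_def in_Hom)

lemma dec_fibres_Hom:
  assumes "fs \<in> Hom (pow_cat Delta (Suc (Dom Delta \<alpha>))) ks ls"
  shows "map (\<lambda>j. dec_arr (fibre_sub \<alpha> j fs)) (hit \<alpha>) \<in> Hom (pow_cat Delta (length (hit \<alpha>)))
    (map (\<lambda>j. dec_ob (fibre_sub \<alpha> j ks)) (hit \<alpha>)) (map (\<lambda>j. dec_ob (fibre_sub \<alpha> j ls)) (hit \<alpha>))"
  using dec_arr_Hom(1)[OF fibre_sub_Hom[OF assms]] fib_ind_not_Nil[OF nth_mem] by (auto simp: Hom_pow)

lemma is_functor_dec_fibres: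
  assumes "\<alpha> \<in> Hom Delta n m"
  shows "is_functor (Dop_pow (Suc n)) (Dop_pow (length (hit \<alpha>))) (dec_fibres \<alpha>)"
proof -
  have n: "Dom Delta \<alpha> = n" using assms by (simp add: in_Hom)
  show ?thesis
  proof (rule is_functorI, goal_cases)
    case (3 ks)
    then show ?case by (simp add: dec_fibres_simps n)
  next
    case (4 fs ks ls)
    then have fs: "fs \<in> Hom (pow_cat Delta (Suc (Dom Delta \<alpha>))) ls ks" by (simp add: Hom_Dop_pow n)
    have "length ks = Suc n" "length ls = Suc n" using 4 by (auto simp: Hom_pow)
    then show ?case using dec_fibres_Hom[OF fs] by (simp add: dec_fibres_simps(1) n dec_fibres_simps(2)[OF fs] Hom_Dop_pow)
  next
    case (5 ks)
    then have l: "length ks = Suc n" by simp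
    have "map (Idt Delta) ks \<in> Hom (pow_cat Delta (Suc (Dom Delta \<alpha>))) ks ks"
      using l by (simp add: Hom_pow Idt_Delta dmono_id n)
    from dec_fibres_simps(2)[OF this]
    have "FAr (dec_fibres \<alpha>) (map (Idt Delta) ks) = map (\<lambda>j. dec_arr (fibre_sub \<alpha> j (map (Idt Delta) ks))) (hit \<alpha>)" .
    also have "\<dots> = map (\<lambda>j. Idt Delta (dec_ob (fibre_sub \<alpha> j ks))) (hit \<alpha>)"
    proof (rule map_cong[OF refl])
      fix j assume j: "j \<in> set (hit \<alpha>)"
      have "fibre_sub \<alpha> j (map (Idt Delta) ks) = map (Idt Delta) (fibre_sub \<alpha> j ks)"
        using fib_ind_bound[of _ \<alpha> j] l by (auto simp: fibre_sub_eq n)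
      then show "dec_arr (fibre_sub \<alpha> j (map (Idt Delta) ks)) = Idt Delta (dec_ob (fibre_sub \<alpha> j ks))"
        using dec_arr_idt[OF fibre_sub_not_Nil[OF j]] by simp
    qed
    finally show ?case using l by (simp add: dec_fibres_simps(1) n o_def)
  next
    case (6 fs gs ks ls ms)
    then have fs: "fs \<in> Hom (pow_cat Delta (Suc (Dom Delta \<alpha>))) ls ks"
      and gs: "gs \<in> Hom (pow_cat Delta (Suc (Dom Delta \<alpha>))) ms ls" by (simp_all add: Hom_Dop_pow n)
    have l: "length fs = Suc n" "length gs = Suc n" using fs gs by (auto simp: Hom_pow n)
    note fg = category.comp_hom[OF category_pow[OF category_Delta] gs fs]
    have "dec_arr (fibre_sub \<alpha> j (map2 (\<cdot>\<^bsub>Delta\<^esub>) fs gs)) =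
        dec_arr (fibre_sub \<alpha> j fs) \<odot> dec_arr (fibre_sub \<alpha> j gs)" if j: "j \<in> set (hit \<alpha>)" for j
    proof -
      have "fibre_sub \<alpha> j (map2 (\<cdot>\<^bsub>Delta\<^esub>) fs gs) = map2 (\<cdot>\<^bsub>Delta\<^esub>) (fibre_sub \<alpha> j fs) (fibre_sub \<alpha> j gs)"
        using fib_ind_bound[of _ \<alpha> j, OF nth_mem] l by (auto simp: fibre_sub_eq n intro!: nth_equalityI)
      then show ?thesis
        using dec_arr_comp[OF fibre_sub_Hom[OF gs] fibre_sub_Hom[OF fs]] fib_ind_not_Nil[OF j] by simp
    qed
    then show ?case
      unfolding Comp_Dop_pow n[symmetric] dec_fibres_simps(2)[OF fs] dec_fibres_simps(2)[OF gs] dec_fibres_simps(2)[OF fg]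
      by (intro nth_equalityI) simp_all
  qed (auto simp: dec_fibres_def n)
qed

context category
begin

lemma is_functor_pull_fibres:
  assumes "\<alpha> \<in> Hom Delta n m"
  shows "is_functor (mfun C (length (hit \<alpha>))) (mfun C (Suc n)) (pull_fibres C \<alpha>)"
  using is_functor_precomp[OF category_Dop_pow category_Dop_pow category_axioms is_functor_dec_fibres[OF assms]] assms
  by (simp add: pull_fibres_def in_Hom)

lemma pull_fibres_decs:
  assumes a: "\<alpha> \<in> Hom Delta n m" and X: "is_functor Dop C X"
  shows "FOb (pull_fibres C \<alpha>) (decs (length (hit \<alpha>)) X) = decs (Suc n) X"
proof -
  have n: "Dom Delta \<alpha> = n" using a by (simp add: in_Hom)
  have r: "length (hit \<alpha>) > 0" using hit_not_Nil[OF a] by simp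
  note D = is_functor_decs[OF X r]
  have eq: "FOb (pull_fibres C \<alpha>) (decs (length (hit \<alpha>)) X) =
      comp_fn (Dop_pow (Suc n)) (decs (length (hit \<alpha>)) X) (dec_fibres \<alpha>)"
    using D by (simp add: pull_fibres_def n precomp_simps)
  show ?thesis
  proof (rule functor_eqI[OF _ is_functor_decs[OF X zero_less_Suc]])
    show "is_functor (Dop_pow (Suc n)) C (FOb (pull_fibres C \<alpha>) (decs (length (hit \<alpha>)) X))"
      using is_functor_Ob[OF is_functor_pull_fibres[OF a]] D by simp
    show "FOb (FOb (pull_fibres C \<alpha>) (decs (length (hit \<alpha>)) X)) ks = FOb (decs (Suc n) X) ks"
      if "ks \<in> Obj (Dop_pow (Suc n))" for ks
      using that dec_fibres_dec(1)[OF a, of ks] unfolding eq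
      by (simp add: comp_fn_def[of "Dop_pow (Suc n)" "decs (length (hit \<alpha>)) X"] dec_fibres_simps(1) decs_Ob n)
    show "FAr (FOb (pull_fibres C \<alpha>) (decs (length (hit \<alpha>)) X)) fs = FAr (decs (Suc n) X) fs"
      if "fs \<in> Arr (Dop_pow (Suc n))" for fs
    proof -
      have fs: "fs \<in> Hom (pow_cat Delta (Suc n)) (map (Dom Delta) fs) (map (Cod Delta) fs)"
        using that by (simp add: in_Hom)
      then have l: "length fs = Suc n" by (simp add: Hom_pow)
      show ?thesis
        using that dec_fibres_dec(2)[OF a l] unfolding eq
        by (simp add: comp_fn_def[of "Dop_pow (Suc n)" "decs (length (hit \<alpha>)) X"]
          dec_fibres_simps(2)[of fs \<alpha>, unfolded n, OF fs] decs_Ar[OF fs]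
          decs_Ar[OF dec_fibres_Hom[of fs \<alpha>, unfolded n, OF fs]])
    qed
  qed
qed

text \<open>On the left every block in the fibre over j receives the label j; on the right block i
  receives \<alpha>(i). These agree by the definition of a fibre.\<close>

lemma label_arr_dec_fibres:
  assumes a: "\<alpha> \<in> Hom Delta n m" and l: "length ks = Suc n"
  shows "label_arr m (hit \<alpha>) (FOb (dec_fibres \<alpha>) ks) = \<alpha> \<odot> label_arr n [0..<Suc n] ks"
proof -
  have n: "Dom Delta \<alpha> = n" using a by (simp add: in_Hom)
  note ad = Hom_Delta_dfun[OF a]
  have lm: "dmono (dec_ob ks) n (block ks)"
    using label_arr_Hom[OF labels_upt, of ks n] l by (simp add: label_arr_upt[OF l] del: upt_Suc)
  have "\<alpha> \<odot> label_arr n [0..<Suc n] ks = dmap (dec_ob ks) m (\<lambda>i. dfun \<alpha> (block ks i))"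
    unfolding label_arr_upt[OF l] using dmap_comp[OF lm, of m "dfun \<alpha>"] ad(1)[symmetric] by simp
  also have "\<dots> = label_arr m (hit \<alpha>) (FOb (dec_fibres \<alpha>) ks)"
    unfolding label_arr_def dec_fibres_simps(1)[of ks \<alpha>, unfolded n, OF l] dec_fibres_dec(1)[OF a l]
  proof (rule dmap_cong)
    fix i assume i: "i \<le> dec_ob ks"
    \<comment> \<open>Labels repeated along the fibres are the values of \<alpha> in order, because
      the fibres enumerate 0, ..., n.\<close>
    have "map (\<lambda>j. replicate (length (fibre_sub \<alpha> j ks)) j) (hit \<alpha>) = map (map (dfun \<alpha>)) (map (fib_ind \<alpha>) (hit \<alpha>))"
      by (auto simp: fibre_sub_eq fib_ind_def map_replicate_const[symmetric] simp del: upt_Suc)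
    then have "concat (map (\<lambda>j. replicate (length (fibre_sub \<alpha> j ks)) j) (hit \<alpha>)) = map (dfun \<alpha>) [0..<Suc n]"
      unfolding concat_fib_ind[OF a, symmetric] map_concat by metis
    moreover have "block ks i < Suc n" using block_less[of ks i] i l by (cases ks) auto
    ultimately show "dfun \<alpha> (block ks i) = hit \<alpha> ! block (map (\<lambda>j. dec_ob (fibre_sub \<alpha> j ks)) (hit \<alpha>)) i"
      using nth_block_concat[of "hit \<alpha>" "\<lambda>j. fibre_sub \<alpha> j ks" i] fib_ind_not_Nil[of _ \<alpha>] hit_not_Nil[OF a]
        i dec_fibres_dec(1)[OF a l] concat_fibre_sub[OF a l]
      by (simp add: fibre_sub_eq del: upt_Suc)
  qed
  finally show ?thesis by simp
qed

text \<open>Here the action on the canonical side, composition with \<alpha>, appears: by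
  \<open>label_arr_dec_fibres\<close> it is what relabelling along the fibres amounts to.\<close>

lemma pull_fibres_label_nt:
  assumes a: "\<alpha> \<in> Hom Delta n m" and X: "is_functor Dop C X" and Y: "is_functor Dop C Y"
    and e: "all_family C X Y m e"
  shows "FAr (pull_fibres C \<alpha>) (label_nt m (hit \<alpha>) X Y e) =
    label_nt n [0..<Suc n] X Y (EAct (canonical_enrichment C) X Y \<alpha> e)"
proof -
  have n: "Dom Delta \<alpha> = n" using a by (simp add: in_Hom)
  have len: "length [0..<Suc n] = Suc n" by simp
  note F = is_functor_pull_fibres[OF a]
  note L = missed_props(6)[OF a]
  note h = label_nt_Hom[OF X Y e L]
  note h1 = is_functor_Hom[OF F h, unfolded pull_fibres_decs[OF a X] pull_fibres_decs[OF a Y]]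
  have "all_family C X Y n (EAct (canonical_enrichment C) X Y \<alpha> e)"
    using all_family_act[OF e a] by (simp add: canonical_simps n)
  note h2 = label_nt_Hom[OF X Y this labels_upt, unfolded len]
  show ?thesis
  proof (rule Hom_fun_eqI[OF h1 h2])
    fix ks assume "ks \<in> Obj (Dop_pow (Suc n))"
    then have l: "length ks = Suc n" by simp
    have lG: "length (FOb (dec_fibres \<alpha>) ks) = length (hit \<alpha>)" using dec_fibres_simps(1)[of ks \<alpha>] l n by simp
    have dG: "dec_ob (FOb (dec_fibres \<alpha>) ks) = dec_ob ks"
      using dec_fibres_simps(1)[of ks \<alpha>] dec_fibres_dec(1)[OF a l] l n by simp
    have "App (FAr (pull_fibres C \<alpha>) (label_nt m (hit \<alpha>) X Y e)) ks =
        App (label_nt m (hit \<alpha>) X Y e) (FOb (dec_fibres \<alpha>) ks)"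
      using l by (simp add: pull_fibres_def precomp_simps(2)[OF h] n)
    also have "\<dots> = e (dec_ob ks) (\<alpha> \<odot> label_arr n [0..<Suc n] ks)"
      using label_nt_App[OF lG, of m X Y e] label_arr_dec_fibres[OF a l] dG by simp
    finally show "App (FAr (pull_fibres C \<alpha>) (label_nt m (hit \<alpha>) X Y e)) ks =
        App (label_nt n [0..<Suc n] X Y (EAct (canonical_enrichment C) X Y \<alpha> e)) ks"
      using label_arr_Hom[OF labels_upt, of ks n] l len label_nt_App[of ks "[0..<Suc n]" n X Y]
      by (simp add: canonical_simps n del: upt_Suc)
  qed
qed

end

section \<open>Transport of enriched structure and agreement of the simplicial actions\<close>

section \<open>Comparison of the enrichments\<close>

text \<open>Restriction starts at the canonical enrichment, while the wanted isomorphism ends there.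
  Closure of E under its operations lets \<open>left\<close> recognise the preimage in each
  compatibility.\<close>

lemma enrichment_iso_sym:
  assumes iso: "enrichment_iso D E E' \<Theta>" and E: "simplicial_enrichment D E"
  shows "enrichment_iso D E' E (\<lambda>X Y n. inv_into (EHom E X Y n) (\<Theta> X Y n))"
proof -
  interpret enrichment_iso D E E' \<Theta> by fact
  interpret E: simplicial_enrichment D E by fact
  interpret D: category D by (rule E.base)
  let ?I = "\<lambda>X Y n. inv_into (EHom E X Y n) (\<Theta> X Y n)"
  have I: "?I X Y n f \<in> EHom E X Y n \<and> \<Theta> X Y n (?I X Y n f) = f"
    if "X \<in> Obj D" "Y \<in> Obj D" "f \<in> EHom E' X Y n" for X Y n f
    using iso_bij[OF that(1,2), of n] that(3) bij_betw_inv_into_right bij_betwE bij_betw_inv_into by metis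
  have left: "?I X Y n f' = f" if "X \<in> Obj D" "Y \<in> Obj D" "f \<in> EHom E X Y n" "\<Theta> X Y n f = f'" for X Y n f f'
    using bij_betw_inv_into_left[OF iso_bij[OF that(1,2)] that(3)] that(4) by simp
  show ?thesis
  proof
    fix X Y Z n m \<alpha> f g u
    assume X: "X \<in> Obj D"
    show "?I X X n (EIdt E' X n) = EIdt E X n"
      by (rule left[OF X X E.eidt_closed[OF X] iso_idt[OF X]])
    assume Y: "Y \<in> Obj D"
    show "bij_betw (?I X Y n) (EHom E' X Y n) (EHom E X Y n)"
      by (rule bij_betw_inv_into[OF iso_bij[OF X Y]])
    show "u \<in> Hom D X Y \<Longrightarrow> ?I X Y 0 (EUnd E' X Y u) = EUnd E X Y u"
      by (rule left[OF X Y _ iso_und[OF X Y]]) (use E.und_bij[OF X Y] bij_betwE in blast)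
    show "\<alpha> \<in> Hom Delta n m \<Longrightarrow> f \<in> EHom E' X Y m \<Longrightarrow> ?I X Y n (EAct E' X Y \<alpha> f) = EAct E X Y \<alpha> (?I X Y m f)"
      using left[OF X Y E.act_closed[OF X Y]] iso_act[OF X Y] I[OF X Y] by metis
    assume Z: "Z \<in> Obj D"
    show "f \<in> EHom E' X Y n \<Longrightarrow> g \<in> EHom E' Y Z n \<Longrightarrow>
        ?I X Z n (EComp E' X Y Z n g f) = EComp E X Y Z n (?I Y Z n g) (?I X Y n f)"
      using left[OF X Z E.ecomp_closed[OF X Y Z]] iso_comp[OF X Y Z] I[OF X Y] I[OF Y Z] by metis
  qed
qed

text \<open>No axiom is presupposed for \<open>E'\<close>: its elements are images of elements of E
  and its operations commute with \<Theta>, so each axiom is the image of the same axiom for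
  E.\<close>

lemma simplicial_enrichment_transport:
  assumes iso: "enrichment_iso D E E' \<Theta>" and E: "simplicial_enrichment D E"
  shows "simplicial_enrichment D E'"
proof -
  interpret enrichment_iso D E E' \<Theta> by fact
  interpret E: simplicial_enrichment D E by fact
  interpret D: category D by (rule E.base)
  have ex: "\<exists>f'\<in>EHom E X Y n. f = \<Theta> X Y n f'" if "X \<in> Obj D" "Y \<in> Obj D" "f \<in> EHom E' X Y n" for X Y n f
    using iso_bij[OF that(1,2), of n] that(3) by (auto simp: bij_betw_def)
  have cl: "\<Theta> X Y n f \<in> EHom E' X Y n" if "X \<in> Obj D" "Y \<in> Obj D" "f \<in> EHom E X Y n" for X Y n f
    using iso_bij[OF that(1,2), of n] that(3) by (auto simp: bij_betw_def)
  show ?thesis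
  proof (unfold_locales, goal_cases)
    case (1 X Y \<alpha> n m f)
    then show ?case using ex[OF 1(1,2,4)] iso_act[OF 1(1-3)] cl E.act_closed[OF 1(1-3)] by metis
  next
    case (2 X Y f n)
    then show ?case
      using ex[OF 2] iso_act[OF 2(1,2) Delta.idt_hom, of n] E.act_idt[OF 2(1,2)] by fastforce
  next
    case (3 X Y \<alpha> n m \<beta> q f)
    obtain f' where f: "f' \<in> EHom E X Y q" "f = \<Theta> X Y q f'" using ex[OF 3(1,2,5)] by blast
    show ?case
      using f iso_act[OF 3(1,2) Delta.comp_hom[OF 3(3,4)]] iso_act[OF 3(1,2,3) E.act_closed[OF 3(1,2,4)]]
        iso_act[OF 3(1,2,4)] E.act_comp[OF 3(1-4)] by metis
  next
    case (4 X Y Z f n g)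
    then show ?case
      using ex[OF 4(1,2,4)] ex[OF 4(2,3,5)] iso_comp[OF 4(1-3)] cl E.ecomp_closed[OF 4(1-3)] by metis
  next
    case (5 X Y Z \<alpha> n m f g)
    obtain f' g' where f: "f' \<in> EHom E X Y m" "f = \<Theta> X Y m f'" and g: "g' \<in> EHom E Y Z m" "g = \<Theta> Y Z m g'"
      using ex[OF 5(1,2,5)] ex[OF 5(2,3,6)] by blast
    show ?case
      unfolding f(2) g(2) iso_comp[OF 5(1-3) f(1) g(1), symmetric] iso_act[OF 5(1,2,4) f(1), symmetric]
        iso_act[OF 5(2,3,4) g(1), symmetric] iso_act[OF 5(1,3,4) E.ecomp_closed[OF 5(1-3) f(1) g(1)], symmetric]
        iso_comp[OF 5(1-3) E.act_closed[OF 5(1,2,4) f(1)] E.act_closed[OF 5(2,3,4) g(1)], symmetric]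
        E.ecomp_act[OF 5(1-4) f(1) g(1)] ..
  next
    case (6 X Y Z W f n g h)
    obtain f' g' h' where f: "f' \<in> EHom E X Y n" "f = \<Theta> X Y n f'" and g: "g' \<in> EHom E Y Z n" "g = \<Theta> Y Z n g'"
      and h: "h' \<in> EHom E Z W n" "h = \<Theta> Z W n h'"
      using ex[OF 6(1,2,5)] ex[OF 6(2,3,6)] ex[OF 6(3,4,7)] by blast
    show ?case
      unfolding f(2) g(2) h(2) iso_comp[OF 6(1-3) f(1) g(1), symmetric] iso_comp[OF 6(2-4) g(1) h(1), symmetric]
        iso_comp[OF 6(1,3,4) E.ecomp_closed[OF 6(1-3) f(1) g(1)] h(1), symmetric]
        iso_comp[OF 6(1,2,4) f(1) E.ecomp_closed[OF 6(2-4) g(1) h(1)], symmetric]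
        E.ecomp_assoc[OF 6(1-4) f(1) g(1) h(1)] ..
  next
    case (7 X n)
    then show ?case using iso_idt[OF 7] cl[OF 7 7 E.eidt_closed[OF 7]] by metis
  next
    case (8 X \<alpha> n m)
    then show ?case using iso_idt[OF 8(1)] iso_act[OF 8(1,1,2) E.eidt_closed[OF 8(1)]] E.eidt_act[OF 8] by metis
  next
    case (9 X Y f n)
    then show ?case using ex[OF 9] iso_idt[OF 9(2)] iso_comp[OF 9(1,2,2) _ E.eidt_closed[OF 9(2)]]
        E.ecomp_idt_left[OF 9(1,2)] by metis
  next
    case (10 X Y f n)
    then show ?case using ex[OF 10] iso_idt[OF 10(1)] iso_comp[OF 10(1,1,2) E.eidt_closed[OF 10(1)]]
        E.ecomp_idt_right[OF 10(1,2)] by metis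
  next
    case (11 X Y)
    have "bij_betw (\<Theta> X Y 0 \<circ> EUnd E X Y) (Hom D X Y) (EHom E' X Y 0)"
      by (rule bij_betw_trans[OF E.und_bij[OF 11] iso_bij[OF 11]])
    then show ?case using bij_betw_cong[of "Hom D X Y" "\<Theta> X Y 0 \<circ> EUnd E X Y" "EUnd E' X Y"] iso_und[OF 11] by simp
  next
    case (12 X)
    then show ?case using iso_und[OF 12 12 D.idt_hom[OF 12]] E.und_idt[OF 12] iso_idt[OF 12] by simp
  next
    case (13 X Y Z u v)
    have u: "EUnd E X Y u \<in> EHom E X Y 0" "EUnd E Y Z v \<in> EHom E Y Z 0"
      using bij_betwE[OF E.und_bij] 13 by blast+
    show ?case
      unfolding iso_und[OF 13(1,2,4), symmetric] iso_und[OF 13(2,3,5), symmetric]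
        iso_und[OF 13(1,3) D.comp_hom[OF 13(4,5)], symmetric] E.und_comp[OF 13] iso_comp[OF 13(1-3) u] ..
  qed
qed

context dop_colimits
begin

text \<open>The action conjugates by \<open>F_can\<close>. The square for all eliminated variables,
  mapped by the pullback along the fibres, lets \<open>iso_arr_conj\<close> replace the conjugate by
  the pullback of the restriction with labels \<open>hit \<alpha>\<close>, which is known.\<close>

lemma dec_EAct:
  assumes X: "is_functor Dop C X" and Y: "is_functor Dop C Y" and a: "\<alpha> \<in> Hom Delta n m"
    and e: "all_family C X Y m e"
  shows "EAct (dec_enrichment C cl) X Y \<alpha> (label_nt m [0..<Suc m] X Y e) =
    label_nt n [0..<Suc n] X Y (EAct (canonical_enrichment C) X Y \<alpha> e)"
proof -
  have nm: "Dom Delta \<alpha> = n" "Cod Delta \<alpha> = m" using a by (auto simp: in_Hom)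
  note mp = missed_props[OF a]
  have len: "length [0..<Suc m] = Suc m" "length [0..<Suc n] = Suc n" by simp_all
  define r where "r = length (hit \<alpha>)"
  have r: "Suc m - length (missed \<alpha>) = r" using mp(4) by (simp add: r_def)
  note FCr = category_mfun[OF category_axioms, of r]
    and FCm = category_mfun[OF category_axioms, of "Suc m"]
    and FCn = category_mfun[OF category_axioms, of "Suc n"]
  define V where "V = colim_vars C cl (Suc m) (missed \<alpha>)"
  define P where "P = pull_fibres C \<alpha>"
  have V: "is_functor (mfun C (Suc m)) (mfun C r) V"
    using is_functor_colim_vars[OF mp(1,2)] r by (simp add: msimp_cat_def V_def)
  have P: "is_functor (mfun C r) (mfun C (Suc n)) P"
    using is_functor_pull_fibres[OF a] by (simp add: P_def r_def)
  have PD: "FOb P (decs r Z) = decs (Suc n) Z" if "is_functor Dop C Z" for Z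
    using pull_fibres_decs[OF a that] by (simp add: P_def r_def)
  define K where "K Z = can_vars C cl (Suc m) (missed \<alpha>) Z" for Z
  have K: "iso_arr (mfun C r) (FOb V (decs (Suc m) Z)) (decs r Z) (K Z)" if "is_functor Dop C Z" for Z
    using can_vars_iso[OF that mp(1,2,5)] unfolding r V_def K_def .
  have PK: "iso_arr (mfun C (Suc n)) (FOb P (FOb V (decs (Suc m) Z))) (decs (Suc n) Z) (FAr P (K Z))"
    if "is_functor Dop C Z" for Z
    using iso_arr_functor[OF P K[OF that] FCr] unfolding PD[OF that] .
  define f where "f = label_nt m [0..<Suc m] X Y e"
  have f: "f \<in> Hom (mfun C (Suc m)) (decs (Suc m) X) (decs (Suc m) Y)"
    using label_nt_Hom[OF X Y e labels_upt] unfolding len f_def .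
  have h: "label_nt m (hit \<alpha>) X Y e \<in> Hom (mfun C r) (decs r X) (decs r Y)"
    using label_nt_Hom[OF X Y e mp(6)] by (simp add: r_def)
  note Vf = is_functor_Hom[OF V f]
  \<comment> \<open>The labels left after deleting all missed ones form the image of
    \<alpha>.\<close>
  have sq: "K Y \<cdot>\<^bsub>mfun C r\<^esub> FAr V f = label_nt m (hit \<alpha>) X Y e \<cdot>\<^bsub>mfun C r\<^esub> K X"
    using can_vars_label_nt[OF X Y e labels_upt len(1) mp(1,2,5)] unfolding r mp(3) V_def K_def f_def by blast
  note KY = category.iso_arr_Hom[OF FCr K[OF Y]] and KX = category.iso_arr_Hom[OF FCr K[OF X]]
  have "FAr P (K Y) \<cdot>\<^bsub>mfun C (Suc n)\<^esub> FAr P (FAr V f) =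
      FAr P (label_nt m (hit \<alpha>) X Y e) \<cdot>\<^bsub>mfun C (Suc n)\<^esub> FAr P (K X)"
    using is_functor_Comp[OF P Vf KY] is_functor_Comp[OF P KX h] sq by simp
  then have "FAr P (K Y) \<cdot>\<^bsub>mfun C (Suc n)\<^esub> FAr P (FAr V f) \<cdot>\<^bsub>mfun C (Suc n)\<^esub>
      inv_arr (mfun C (Suc n)) (FAr P (K X)) = FAr P (label_nt m (hit \<alpha>) X Y e)"
    using category.iso_arr_conj[OF FCn PK[OF X] category.iso_arr_Hom[OF FCn PK[OF Y]] is_functor_Hom[OF P Vf]
        is_functor_Hom[OF P h, unfolded PD[OF X] PD[OF Y]]] by simp
  moreover have "FAr (F_arr C cl \<alpha>) f = FAr P (FAr V f)"
    using f by (simp add: F_arr_def comp_fn_def F_ob_def msimp_cat_def nm V_def P_def in_Hom del: fun_cat_simps)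
  moreover have "F_can C cl \<alpha> Z = FAr P (K Z)" for Z
    by (simp add: F_can_def P_def K_def nm)
  ultimately have "EAct (dec_enrichment C cl) X Y \<alpha> f = FAr P (label_nt m (hit \<alpha>) X Y e)"
    by (simp add: dec_enrichment_def Let_def nm F_ob_def msimp_cat_def del: fun_cat_simps)
  then show ?thesis using pull_fibres_label_nt[OF a X Y e] by (simp add: f_def P_def del: upt_Suc)
qed

lemma dec_enrichment_iso:
  "enrichment_iso (simp_cat C) (canonical_enrichment C) (dec_enrichment C cl) (\<lambda>X Y n. label_nt n [0..<Suc n] X Y)"
proof (unfold_locales, unfold simp_cat_simps mem_Collect_eq, goal_cases)
  case (1 X Y n)
  then show ?case using label_nt_bij[OF 1]
    by (simp add: dec_enrichment_def F_ob_def msimp_cat_def precomp_dec del: upt_Suc)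
next
  case (2 X Y \<alpha> n m f)
  then show ?case using dec_EAct[OF 2(1-3), of f] by (simp add: canonical_EHom[OF 2(1,2)])
next
  case (3 X Y Z f n g)
  then show ?case using label_arr_Hom[OF labels_upt, of _ n]
    by (auto simp: label_nt_def canonical_simps dec_enrichment_def F_ob_def msimp_cat_def fun_eq_iff restrict_def
        simp del: upt_Suc)
next
  case (4 X n)
  then show ?case using label_arr_Hom[OF labels_upt, of _ n]
    by (auto simp: label_nt_def canonical_simps dec_enrichment_def F_ob_def msimp_cat_def fun_eq_iff restrict_def
      precomp_dec decs_Ob simp del: upt_Suc)
next
  \<comment> \<open>For n = 0 the only label is 0 and \<open>dec 1\<close> merely unwraps
    one-element lists, so both sides have the component of u at \<open>dec_ob ks\<close>.\<close>
  case (5 X Y u)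
  have "FOb (dec 1) ks = dec_ob ks" if "length ks = 1" for ks using that by (simp add: dec_def)
  then show ?case using label_arr_Hom[OF labels_upt, of _ 0] 5(3)
    by (auto simp: label_nt_def canonical_simps dec_enrichment_def dec_pull_def precomp_simps(2)[OF 5(3)]
        fun_eq_iff restrict_def simp del: upt_Suc)
qed

end

text \<open>The axioms are checked on the canonical side and travel along restriction to Hom_F; the
  isomorphism in the stated direction is the inverse of restriction.\<close>

theorem proposition4p25:
  fixes C :: "('o, 'a) cat" and cl :: "('o, 'a) colims"
  assumes "category C"
    and "infinite (UNIV :: 's set)"
    and "cocomplete TYPE('s) C"
    and "colimit_choice Dop C cl"
  shows "simplicial_enrichment (simp_cat C) (dec_enrichment C cl) \<and>
    simplicial_enrichment (simp_cat C) (canonical_enrichment C) \<and>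
    enrichments_isomorphic (simp_cat C) (dec_enrichment C cl) (canonical_enrichment C)"
proof -
  interpret category C by fact
  interpret dop_colimits C cl by unfold_locales fact
  note can = simplicial_enrichment_canonical and iso = dec_enrichment_iso
  show ?thesis
    using simplicial_enrichment_transport[OF iso can] can enrichment_iso_sym[OF iso can]
    unfolding enrichments_isomorphic_def by blast
qed

end
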